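(* Let $C$ be the non-complete intersection Gorenstein monomial curve $x_i=t^{n_i}$ ($1\le i\le4$) in $\mathbb{A}^4(K)$, with $n_1<n_2<n_3<n_4$. Suppose that $I(C)$ is given as in case 1(b), i.e. $I(C)$ is minimally generated by $$f_1=x_1^{a_1}-x_3^{a_{13}}x_4^{a_{14}},\quad f_2=x_2^{a_2}-x_1^{a_{21}}x_3^{a_{23}},\quad f_3=x_3^{a_3}-x_2^{a_{32}}x_4^{a_{34}},$$ $$f_4=x_4^{a_4}-x_1^{a_{41}}x_2^{a_{42}},\quad f_5=x_1^{a_{21}}x_4^{a_{34}}-x_2^{a_{42}}x_3^{a_{13}},$$ and also that $a_{42}\le a_{32}$. Then $C$ has Cohen-Macaulay tangent cone at the origin if and only if (1) $a_2\le a_{21}+a_{23}$, (2) $a_{42}+a_{13}\le a_{21}+a_{34}$, and (3) either $a_{34}<a_{14}$ and $a_3+a_{13}\le a_{21}+a_{32}-a_{42}+2a_{34}$, or $a_{14}\le a_{34}$ and $a_3+a_{13}\le a_1+a_{32}+a_{34}-a_{14}$.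
   Context: $K$ is a field and $n_1,\dots,n_4$ are positive integers with $\gcd(n_1,\dots,n_4)=1$. $I(C)$ is the kernel of the $K$-algebra homomorphism $K[x_1,\dots,x_4]\to K[t]$, $x_i\mapsto t^{n_i}$. $C$ is Gorenstein if the semigroup $\mathcal{S}=\{g_1n_1+\cdots+g_4n_4: g_i\in\mathbb{N}\}$ is symmetric ($\mathbb{N}$ = non-negative integers). In the description of $I(C)$, all exponents are integers with $0<a_{ij}<a_j$, and (by Bresinsky) $a_1=a_{21}+a_{41}$, $a_2=a_{32}+a_{42}$, $a_3=a_{13}+a_{23}$, $a_4=a_{14}+a_{34}$. $C$ has Cohen-Macaulay tangent cone at the origin if the ring $K[x_1,\dots,x_4]/I(C)_*$ is Cohen-Macaulay, where $I(C)_*$ is generated by the homogeneous (standard grading) summands $f_*$ of least degree of the polynomials $f\in I(C)$. *)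

theory Defs
  imports
    "HOL-Library.Poly_Mapping"
    "HOL-Library.Numeral_Type"
    "HOL-Library.Extended_Nat"
    "HOL-Algebra.QuotRing"
    "HOL-Algebra.Ring_Divisibility"
    "HOL-Algebra.Algebraic_Closure_Type"
begin

section \<open>Cohen-Macaulay rings\<close>

definition krull_dim :: "('a, 'b) ring_scheme \<Rightarrow> enat" where
  "krull_dim R = Sup {enat n |n. \<exists>p :: nat \<Rightarrow> 'a set.
     (\<forall>i\<le>n. primeideal (p i) R) \<and> (\<forall>i<n. p i \<subset> p (Suc i))}"

text \<open>The condition at index \<open>i\<close> says that the class of \<open>xs ! i\<close> is a nonzerodivisor of
  the ring \<open>R / (xs ! 0, \<dots>, xs ! (i - 1))\<close>.\<close>

definition regular_sequence :: "('a, 'b) ring_scheme \<Rightarrow> 'a list \<Rightarrow> bool" where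
  "regular_sequence R xs \<longleftrightarrow> set xs \<subseteq> carrier R \<and>
     (\<forall>i<length xs. \<forall>a\<in>carrier R.
        xs ! i \<otimes>\<^bsub>R\<^esub> a \<in> Idl\<^bsub>R\<^esub> (set (take i xs)) \<longrightarrow> a \<in> Idl\<^bsub>R\<^esub> (set (take i xs))) \<and>
     Idl\<^bsub>R\<^esub> (set xs) \<noteq> carrier R"

definition depth :: "('a, 'b) ring_scheme \<Rightarrow> 'a set \<Rightarrow> enat" where
  "depth R m = Sup {enat (length xs) |xs. regular_sequence R xs \<and> set xs \<subseteq> m}"

definition cohen_macaulay_local_ring :: "('a, 'b) ring_scheme \<Rightarrow> bool" where
  "cohen_macaulay_local_ring R \<longleftrightarrow> cring R \<and> noetherian_ring R \<and>
     (\<exists>m. (\<forall>I. maximalideal I R \<longleftrightarrow> I = m) \<and> depth R m = krull_dim R)"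

text \<open>The localization \<open>R\<^sub>P\<close> at a prime ideal \<open>P\<close>; its elements are the classes of the
  pairs \<open>(a, s)\<close>, standing for \<open>a / s\<close> with \<open>s \<notin> P\<close>.\<close>

definition fraction_rel :: "('a, 'b) ring_scheme \<Rightarrow> 'a set \<Rightarrow> ('a \<times> 'a) rel" where
  "fraction_rel R P = {((a, s), (b, t)).
     a \<in> carrier R \<and> b \<in> carrier R \<and> s \<in> carrier R - P \<and> t \<in> carrier R - P \<and>
     (\<exists>u\<in>carrier R - P. u \<otimes>\<^bsub>R\<^esub> (a \<otimes>\<^bsub>R\<^esub> t) = u \<otimes>\<^bsub>R\<^esub> (b \<otimes>\<^bsub>R\<^esub> s))}"

definition localization :: "('a, 'b) ring_scheme \<Rightarrow> 'a set \<Rightarrow> ('a \<times> 'a) set ring" where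
  "localization R P = \<lparr>
     carrier = (carrier R \<times> (carrier R - P)) // fraction_rel R P,
     monoid.mult = (\<lambda>A B. \<Union>(a, s)\<in>A. \<Union>(b, t)\<in>B.
        fraction_rel R P `` {(a \<otimes>\<^bsub>R\<^esub> b, s \<otimes>\<^bsub>R\<^esub> t)}),
     one = fraction_rel R P `` {(\<one>\<^bsub>R\<^esub>, \<one>\<^bsub>R\<^esub>)},
     ring.zero = fraction_rel R P `` {(\<zero>\<^bsub>R\<^esub>, \<one>\<^bsub>R\<^esub>)},
     add = (\<lambda>A B. \<Union>(a, s)\<in>A. \<Union>(b, t)\<in>B.
        fraction_rel R P `` {(a \<otimes>\<^bsub>R\<^esub> t \<oplus>\<^bsub>R\<^esub> b \<otimes>\<^bsub>R\<^esub> s, s \<otimes>\<^bsub>R\<^esub> t)})\<rparr>"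

definition cohen_macaulay_ring :: "('a, 'b) ring_scheme \<Rightarrow> bool" where
  "cohen_macaulay_ring R \<longleftrightarrow> cring R \<and> noetherian_ring R \<and>
     (\<forall>m. maximalideal m R \<longrightarrow> cohen_macaulay_local_ring (localization R m))"


section \<open>Polynomials\<close>

type_synonym ('v, 'k) mpoly = "('v \<Rightarrow>\<^sub>0 nat) \<Rightarrow>\<^sub>0 'k"

abbreviation mpoly_ring :: "('v, 'k::field) mpoly ring" where
  "mpoly_ring \<equiv> ring_of_type_algebra"

definition Var :: "'v \<Rightarrow> ('v, 'k::field) mpoly" where
  "Var i = Poly_Mapping.single (Poly_Mapping.single i 1) 1"

definition minimally_generated_by :: "('a, 'b) ring_scheme \<Rightarrow> 'a set \<Rightarrow> 'a set \<Rightarrow> bool" where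
  "minimally_generated_by R I G \<longleftrightarrow>
     G \<subseteq> carrier R \<and> Idl\<^bsub>R\<^esub> G = I \<and> (\<forall>H. H \<subset> G \<longrightarrow> Idl\<^bsub>R\<^esub> H \<noteq> I)"

definition homogeneous_part :: "nat \<Rightarrow> ('v::finite, 'k::field) mpoly \<Rightarrow> ('v, 'k) mpoly" where
  "homogeneous_part d f =
     (\<Sum>m | m \<in> Poly_Mapping.keys f \<and> (\<Sum>i\<in>UNIV. Poly_Mapping.lookup m i) = d. Poly_Mapping.single m (Poly_Mapping.lookup f m))"

text \<open>For \<open>f = 0\<close> this is \<open>0\<close>, whatever value \<open>LEAST\<close> takes.\<close>

definition initial_form :: "('v::finite, 'k::field) mpoly \<Rightarrow> ('v, 'k) mpoly" where
  "initial_form f = homogeneous_part (LEAST d. homogeneous_part d f \<noteq> 0) f"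

definition initial_ideal :: "('v::finite, 'k::field) mpoly set \<Rightarrow> ('v, 'k) mpoly set" where
  "initial_ideal I = Idl\<^bsub>mpoly_ring\<^esub> (initial_form ` I)"


section \<open>Monomial curves\<close>

text \<open>A monomial curve \<open>x\<^sub>i = t ^ n i\<close> is represented by its exponents \<open>n\<close>.\<close>

definition curve_hom :: "('v::finite \<Rightarrow> nat) \<Rightarrow> ('v, 'k::field) mpoly \<Rightarrow> 'k poly" where
  "curve_hom n f =
     (\<Sum>m\<in>Poly_Mapping.keys f. Polynomial.monom (Poly_Mapping.lookup f m) (\<Sum>i\<in>UNIV. n i * Poly_Mapping.lookup m i))"

definition curve_ideal :: "('v::finite \<Rightarrow> nat) \<Rightarrow> ('v, 'k::field) mpoly set" where
  "curve_ideal n = a_kernel mpoly_ring ring_of_type_algebra (curve_hom n)"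

definition curve_semigroup :: "('v::finite \<Rightarrow> nat) \<Rightarrow> nat set" where
  "curve_semigroup n = {\<Sum>i\<in>UNIV. g i * n i |g. True}"

text \<open>\<open>F\<close> is the Frobenius number, which is \<open>-1\<close> if \<open>S\<close> contains every natural number.\<close>

definition symmetric_semigroup :: "nat set \<Rightarrow> bool" where
  "symmetric_semigroup S \<longleftrightarrow> (\<exists>F::int.
     F \<notin> int ` S \<and> (\<forall>z>F. z \<in> int ` S) \<and>
     (\<forall>z. z \<in> int ` S \<longleftrightarrow> F - z \<notin> int ` S))"

definition gorenstein_curve :: "('v::finite \<Rightarrow> nat) \<Rightarrow> bool" where
  "gorenstein_curve n \<longleftrightarrow> symmetric_semigroup (curve_semigroup n)"

text \<open>The curve has codimension \<open>CARD('v) - 1\<close> in affine space.  The dummy argument fixes the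
  coefficient field.\<close>

definition complete_intersection_curve :: "'k::field itself \<Rightarrow> ('v::finite \<Rightarrow> nat) \<Rightarrow> bool" where
  "complete_intersection_curve _ n \<longleftrightarrow> (\<exists>G :: ('v, 'k) mpoly set.
     finite G \<and> card G = CARD('v) - 1 \<and> Idl\<^bsub>mpoly_ring\<^esub> G = curve_ideal n)"

definition cohen_macaulay_tangent_cone :: "'k::field itself \<Rightarrow> ('v::finite \<Rightarrow> nat) \<Rightarrow> bool" where
  "cohen_macaulay_tangent_cone _ n \<longleftrightarrow>
     cohen_macaulay_ring
       ((mpoly_ring :: ('v, 'k) mpoly ring) Quot initial_ideal (curve_ideal n))"

end

theory Submission
  imports Defs
begin

text \<open>
  Write \<open>n\<^sub>1 < n\<^sub>2 < n\<^sub>3 < n\<^sub>4\<close> for the weights of the variables.  The proof turns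
  Cohen-Macaulayness into a statement about factorizations in the semigroup and then decides that
  statement by following the five binomial moves.

  \<^bold>\<open>From rings to factorizations.\<close>  Call a monomial longest if no monomial of the same weight has
  larger degree.  The initial ideal consists of the polynomials whose coefficients at the longest
  monomials of each weight add up to \<open>0\<close> (\<open>initial_ideal_curve_ideal\<close>), so the coordinate ring
  \<open>R\<close> of the tangent cone has one basis element for each element of the semigroup.  Since
  \<open>n\<^sub>1\<close> is the least weight, \<open>n\<^sub>1\<close> copies of \<open>x\<^sub>i\<close> with \<open>i \<noteq> 1\<close> can be traded for \<open>n\<^sub>i > n\<^sub>1\<close>
  copies of \<open>x\<^sub>1\<close>; hence \<open>x\<^sub>2\<close>, \<open>x\<^sub>3\<close> and \<open>x\<^sub>4\<close> are nilpotent in \<open>R\<close>, and setting them to \<open>0\<close> is a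
  surjection of \<open>R\<close> onto \<open>K[x\<^sub>1]\<close> with nilpotent kernel.  For a noetherian ring with such a
  surjection every localization at a maximal ideal has dimension one and depth at most one, and it is
  Cohen-Macaulay iff its maximal ideal contains a nonzerodivisor
  (\<open>cohen_macaulay_localization_iff\<close>).  If multiplication by \<open>x\<^sub>1\<close> takes longest monomials to
  longest ones, then every nonzero polynomial in \<open>x\<^sub>1\<close> is a nonzerodivisor of \<open>R\<close>, and each maximal
  ideal contains one.  If it does not, some longest monomial becomes \<open>0\<close> when multiplied by any
  variable, so no element of the maximal ideal at the origin is a nonzerodivisor
  (\<open>cohen_macaulay_tangent_cone_iff\<close>).

  \<^bold>\<open>The factorizations.\<close>  The condition on \<open>x\<^sub>1\<close> says that whenever a monomial \<open>m\<close> without \<open>x\<^sub>1\<close>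
  has the weight of some monomial divisible by \<open>x\<^sub>1\<close>, one of the latter is at least as long as
  \<open>m\<close> (\<open>shift_preserves_longest_iff\<close>).  Two monomials of equal weight lie in the same sets closed
  under the moves given by the generators \<open>f\<^sub>1, \<dots>, f\<^sub>5\<close> (\<open>equal_weight_same_class\<close>).  A suitable closed
  set shows that the monomials \<open>m\<close> in question are exactly the multiples of
  \<open>x\<^sub>2\<^bsup>a\<^sub>2\<^esup>\<close>, \<open>x\<^sub>4\<^bsup>a\<^sub>4\<^esup>\<close>, \<open>x\<^sub>3\<^bsup>a\<^sub>1\<^sub>3\<^esup>x\<^sub>4\<^bsup>a\<^sub>1\<^sub>4\<^esup>\<close>, \<open>x\<^sub>2\<^bsup>a\<^sub>4\<^sub>2\<^esup>x\<^sub>3\<^bsup>a\<^sub>1\<^sub>3\<^esup>\<close> and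
  \<open>x\<^sub>3\<^bsup>a\<^sub>3 + a\<^sub>1\<^sub>3\<^esup>\<close>, so it suffices to look at these five.  The second and the third can always be
  replaced because \<open>n\<^sub>4\<close> is the largest and \<open>n\<^sub>1\<close> the smallest weight.  For each of the
  others the complete class of monomials of the same weight can be written down, and comparing lengths
  gives the three conditions in turn.
\<close>

section \<open>Localization at a prime ideal\<close>

lemma (in cring) ideal_of_closed:
  assumes "J \<subseteq> carrier R" "\<zero> \<in> J" "\<And>a b. a \<in> J \<Longrightarrow> b \<in> J \<Longrightarrow> a \<oplus> b \<in> J"
    "\<And>r a. r \<in> carrier R \<Longrightarrow> a \<in> J \<Longrightarrow> r \<otimes> a \<in> J"
  shows "ideal J R"
proof (rule idealI[OF ring_axioms])
  have "\<ominus> a \<in> J" if "a \<in> J" for a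
    using assms(4)[of "\<ominus> \<one>" a] that assms(1) by (auto simp: l_minus)
  then show "subgroup J (add_monoid R)"
    using assms by (intro subgroup.intro) (auto simp: a_inv_def)
  show "x \<otimes> a \<in> J" "a \<otimes> x \<in> J" if "a \<in> J" "x \<in> carrier R" for a x
    using assms(1,4) that m_comm[of a x] by auto
qed

definition fraction :: "('a, 'b) ring_scheme \<Rightarrow> 'a set \<Rightarrow> 'a \<Rightarrow> 'a \<Rightarrow> ('a \<times> 'a) set" where
  "fraction R P a s = fraction_rel R P `` {(a, s)}"

context primeideal
begin

abbreviation den :: "'a set" where "den \<equiv> carrier R - I"

lemma one_den: "\<one> \<in> den"
  using I_notcarr one_imp_carrier by auto

lemma mult_den: "s \<in> den \<Longrightarrow> t \<in> den \<Longrightarrow> s \<otimes> t \<in> den"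
  using I_prime by auto

lemma fraction_rel_iff:
  "((a, s), (b, t)) \<in> fraction_rel R I \<longleftrightarrow> a \<in> carrier R \<and> b \<in> carrier R \<and> s \<in> den \<and> t \<in> den \<and>
     (\<exists>u\<in>den. u \<otimes> (a \<otimes> t) = u \<otimes> (b \<otimes> s))"
  by (simp add: fraction_rel_def)

lemma equiv_fraction_rel: "equiv (carrier R \<times> den) (fraction_rel R I)"
proof (rule equivI)
  show "fraction_rel R I \<subseteq> (carrier R \<times> den) \<times> (carrier R \<times> den)"
    by (auto simp: fraction_rel_def)
  show "refl_on (carrier R \<times> den) (fraction_rel R I)"
    using one_den by (auto simp: refl_on_def fraction_rel_iff)
  show "sym (fraction_rel R I)"
    by (rule symI) (auto simp: fraction_rel_def intro: sym)
  show "trans (fraction_rel R I)"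
  proof (rule transI, clarify)
    fix a s b t c r
    assume "((a, s), (b, t)) \<in> fraction_rel R I" "((b, t), (c, r)) \<in> fraction_rel R I"
    then obtain u v where c: "a \<in> carrier R" "b \<in> carrier R" "c \<in> carrier R"
      and d: "s \<in> den" "t \<in> den" "r \<in> den" "u \<in> den" "v \<in> den"
      and e: "u \<otimes> (a \<otimes> t) = u \<otimes> (b \<otimes> s)" "v \<otimes> (b \<otimes> r) = v \<otimes> (c \<otimes> t)"
      by (auto simp: fraction_rel_iff)
    have d': "s \<in> carrier R" "t \<in> carrier R" "r \<in> carrier R" "u \<in> carrier R" "v \<in> carrier R"
      using d by auto
    have "u \<otimes> v \<otimes> t \<otimes> (a \<otimes> r) = v \<otimes> r \<otimes> (u \<otimes> (a \<otimes> t))"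
      using c d' by algebra
    also have "\<dots> = u \<otimes> s \<otimes> (v \<otimes> (b \<otimes> r))"
      unfolding e(1) using c d' by algebra
    also have "\<dots> = u \<otimes> v \<otimes> t \<otimes> (c \<otimes> s)"
      unfolding e(2) using c d' by algebra
    finally show "((a, s), (c, r)) \<in> fraction_rel R I"
      using c d mult_den by (auto simp: fraction_rel_iff intro!: bexI[of _ "u \<otimes> v \<otimes> t"])
  qed
qed

lemma fraction_eq_iff:
  assumes "a \<in> carrier R" "s \<in> den" "b \<in> carrier R" "t \<in> den"
  shows "fraction R I a s = fraction R I b t \<longleftrightarrow> (\<exists>u\<in>den. u \<otimes> (a \<otimes> t) = u \<otimes> (b \<otimes> s))"
  using assms eq_equiv_class_iff[OF equiv_fraction_rel, of "(a, s)" "(b, t)"]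
  by (auto simp: fraction_def fraction_rel_iff)

lemma fraction_eqI:
  assumes "a \<in> carrier R" "s \<in> den" "b \<in> carrier R" "t \<in> den" "a \<otimes> t = b \<otimes> s"
  shows "fraction R I a s = fraction R I b t"
  using assms one_den by (subst fraction_eq_iff) (auto intro!: bexI[of _ \<one>])

lemma carrier_localization: "carrier (localization R I) = {fraction R I a s |a s. a \<in> carrier R \<and> s \<in> den}"
  by (auto simp: localization_def fraction_def quotient_def)

lemma fraction_closed: "a \<in> carrier R \<Longrightarrow> s \<in> den \<Longrightarrow> fraction R I a s \<in> carrier (localization R I)"
  by (auto simp: carrier_localization)

lemma localization_cases:
  assumes "x \<in> carrier (localization R I)"
  obtains a s where "a \<in> carrier R" "s \<in> den" "x = fraction R I a s"
  using assms by (auto simp: carrier_localization)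

text \<open>By symmetry, independence of the representatives has to be checked in one argument only.\<close>

lemma mult_fraction:
  assumes "a \<in> carrier R" "s \<in> den" "b \<in> carrier R" "t \<in> den"
  shows "fraction R I a s \<otimes>\<^bsub>localization R I\<^esub> fraction R I b t = fraction R I (a \<otimes> b) (s \<otimes> t)"
proof -
  let ?f = "\<lambda>p q. fraction R I (fst p \<otimes> fst q) (snd p \<otimes> snd q)"
  have "congruent2 (fraction_rel R I) (fraction_rel R I) ?f"
  proof (rule congruent2_commuteI[OF equiv_fraction_rel])
    show "?f p q = ?f q p" if "p \<in> carrier R \<times> den" "q \<in> carrier R \<times> den" for p q
      using that by (auto simp: m_comm)
    show "?f r p = ?f r q" if r: "r \<in> carrier R \<times> den" and pq: "(p, q) \<in> fraction_rel R I" for p q r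
    proof -
      obtain a s b t c w where [simp]: "p = (a, s)" "q = (b, t)" "r = (c, w)"
        by (metis surj_pair)
      have c: "a \<in> carrier R" "b \<in> carrier R" "c \<in> carrier R"
        "s \<in> carrier R" "t \<in> carrier R" "w \<in> carrier R" and d: "s \<in> den" "t \<in> den" "w \<in> den"
        using r pq by (auto simp: fraction_rel_iff)
      obtain u where u: "u \<in> den" "u \<otimes> (a \<otimes> t) = u \<otimes> (b \<otimes> s)"
        using pq by (auto simp: fraction_rel_iff)
      have uc: "u \<in> carrier R" using u by auto
      have "u \<otimes> (c \<otimes> a \<otimes> (w \<otimes> t)) = u \<otimes> (a \<otimes> t) \<otimes> c \<otimes> w" using c uc by algebra
      also have "\<dots> = u \<otimes> (c \<otimes> b \<otimes> (w \<otimes> s))" unfolding u(2) using c uc by algebra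
      finally show ?thesis
        using c d u mult_den by (auto simp: fraction_eq_iff)
    qed
  qed
  from UN_equiv_class2[OF equiv_fraction_rel equiv_fraction_rel this, of "(a, s)" "(b, t)"]
  show ?thesis using assms
    by (simp add: localization_def fraction_def case_prod_beta)
qed

lemma add_fraction:
  assumes "a \<in> carrier R" "s \<in> den" "b \<in> carrier R" "t \<in> den"
  shows "fraction R I a s \<oplus>\<^bsub>localization R I\<^esub> fraction R I b t
    = fraction R I (a \<otimes> t \<oplus> b \<otimes> s) (s \<otimes> t)"
proof -
  let ?f = "\<lambda>p q. fraction R I (fst p \<otimes> snd q \<oplus> fst q \<otimes> snd p) (snd p \<otimes> snd q)"
  have "congruent2 (fraction_rel R I) (fraction_rel R I) ?f"
  proof (rule congruent2_commuteI[OF equiv_fraction_rel])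
    show "?f p q = ?f q p" if "p \<in> carrier R \<times> den" "q \<in> carrier R \<times> den" for p q
      using that by (auto simp: m_comm a_comm)
    show "?f r p = ?f r q" if r: "r \<in> carrier R \<times> den" and pq: "(p, q) \<in> fraction_rel R I" for p q r
    proof -
      obtain a s b t c w where [simp]: "p = (a, s)" "q = (b, t)" "r = (c, w)"
        by (metis surj_pair)
      have c: "a \<in> carrier R" "b \<in> carrier R" "c \<in> carrier R"
        "s \<in> carrier R" "t \<in> carrier R" "w \<in> carrier R" and d: "s \<in> den" "t \<in> den" "w \<in> den"
        using r pq by (auto simp: fraction_rel_iff)
      obtain u where u: "u \<in> den" "u \<otimes> (a \<otimes> t) = u \<otimes> (b \<otimes> s)"
        using pq by (auto simp: fraction_rel_iff)
      have uc: "u \<in> carrier R" using u by auto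
      have "u \<otimes> ((c \<otimes> s \<oplus> a \<otimes> w) \<otimes> (w \<otimes> t)) = u \<otimes> (a \<otimes> t) \<otimes> w \<otimes> w \<oplus> u \<otimes> c \<otimes> s \<otimes> t \<otimes> w"
        using c uc by algebra
      also have "\<dots> = u \<otimes> ((c \<otimes> t \<oplus> b \<otimes> w) \<otimes> (w \<otimes> s))" unfolding u(2) using c uc by algebra
      finally show ?thesis
        using c d u mult_den by (auto simp: fraction_eq_iff)
    qed
  qed
  from UN_equiv_class2[OF equiv_fraction_rel equiv_fraction_rel this, of "(a, s)" "(b, t)"]
  show ?thesis using assms
    by (simp add: localization_def fraction_def case_prod_beta)
qed

lemma one_localization: "\<one>\<^bsub>localization R I\<^esub> = fraction R I \<one> \<one>"
  by (simp add: localization_def fraction_def)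

lemma zero_localization: "\<zero>\<^bsub>localization R I\<^esub> = fraction R I \<zero> \<one>"
  by (simp add: localization_def fraction_def)

lemma cring_localization: "cring (localization R I)"
proof (rule cringI)
  let ?Q = "localization R I"
  have car: "s \<in> den \<Longrightarrow> s \<in> carrier R" for s by auto
  show "abelian_group ?Q"
  proof (rule abelian_groupI)
    fix x y z assume "x \<in> carrier ?Q" "y \<in> carrier ?Q" "z \<in> carrier ?Q"
    then obtain a b c s t r where xyz: "x = fraction R I a s" "y = fraction R I b t" "z = fraction R I c r"
      and c: "a \<in> carrier R" "b \<in> carrier R" "c \<in> carrier R" and d: "s \<in> den" "t \<in> den" "r \<in> den"
      by (metis localization_cases)
    note c' = d[THEN car]
    have st: "s \<otimes> t \<in> den" "t \<otimes> r \<in> den" using d mult_den by auto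
    show "x \<oplus>\<^bsub>?Q\<^esub> y \<oplus>\<^bsub>?Q\<^esub> z = x \<oplus>\<^bsub>?Q\<^esub> (y \<oplus>\<^bsub>?Q\<^esub> z)"
      unfolding xyz add_fraction[OF c(1) d(1) c(2) d(2)] add_fraction[OF c(2) d(2) c(3) d(3)]
      apply (subst add_fraction)
          apply (use c c' d st in simp_all)[4]
      apply (subst add_fraction)
          apply (use c c' d st in simp_all)[4]
      apply (rule fraction_eqI)
          apply (use c c' in simp)
         apply (use d mult_den in blast)
        apply (use c c' in simp)
       apply (use d mult_den in blast)
      apply (use c c' in algebra)
      done
  next
    fix x y assume "x \<in> carrier ?Q" "y \<in> carrier ?Q"
    then obtain a b s t where xyz: "x = fraction R I a s" "y = fraction R I b t"
      and c: "a \<in> carrier R" "b \<in> carrier R" and d: "s \<in> den" "t \<in> den"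
      by (metis localization_cases)
    note c' = d[THEN car]
    show "x \<oplus>\<^bsub>?Q\<^esub> y \<in> carrier ?Q" using c c' d mult_den by (auto simp: xyz add_fraction intro!: fraction_closed)
    show "x \<oplus>\<^bsub>?Q\<^esub> y = y \<oplus>\<^bsub>?Q\<^esub> x" using c c' d by (simp add: xyz add_fraction a_comm m_comm)
  next
    show "\<zero>\<^bsub>?Q\<^esub> \<in> carrier ?Q" unfolding zero_localization by (rule fraction_closed[OF zero_closed one_den])
  next
    fix x assume "x \<in> carrier ?Q"
    then obtain a s where xyz: "x = fraction R I a s" and c: "a \<in> carrier R" and d: "s \<in> den"
      by (metis localization_cases)
    note c' = d[THEN car]
    show "\<zero>\<^bsub>?Q\<^esub> \<oplus>\<^bsub>?Q\<^esub> x = x" using c c' d one_den by (simp add: xyz add_fraction zero_localization)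
    have "fraction R I (\<ominus> a) s \<oplus>\<^bsub>?Q\<^esub> x = \<zero>\<^bsub>?Q\<^esub>"
      unfolding xyz zero_localization
      apply (subst add_fraction)
          apply (use c d in simp_all)[4]
      apply (rule fraction_eqI)
          apply (use c c' in simp)
         apply (use d mult_den in blast)
        apply (use one_den in simp)
       apply (rule one_den)
      apply (use c c' in algebra)
      done
    then show "\<exists>y\<in>carrier ?Q. y \<oplus>\<^bsub>?Q\<^esub> x = \<zero>\<^bsub>?Q\<^esub>"
      by (rule bexI) (rule fraction_closed[OF a_inv_closed[OF c] d])
  qed
  show "comm_monoid ?Q"
  proof (rule comm_monoidI)
    fix x y z assume "x \<in> carrier ?Q" "y \<in> carrier ?Q" "z \<in> carrier ?Q"
    then obtain a b c s t r where xyz: "x = fraction R I a s" "y = fraction R I b t" "z = fraction R I c r"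
      and c: "a \<in> carrier R" "b \<in> carrier R" "c \<in> carrier R" and d: "s \<in> den" "t \<in> den" "r \<in> den"
      by (metis localization_cases)
    note c' = d[THEN car]
    have st: "s \<otimes> t \<in> den" "t \<otimes> r \<in> den" using d mult_den by auto
    show "x \<otimes>\<^bsub>?Q\<^esub> y \<otimes>\<^bsub>?Q\<^esub> z = x \<otimes>\<^bsub>?Q\<^esub> (y \<otimes>\<^bsub>?Q\<^esub> z)"
      unfolding xyz using c c' d st by (simp add: mult_fraction m_assoc del: Diff_iff)
  next
    fix x y assume "x \<in> carrier ?Q" "y \<in> carrier ?Q"
    then obtain a b s t where xyz: "x = fraction R I a s" "y = fraction R I b t"
      and c: "a \<in> carrier R" "b \<in> carrier R" and d: "s \<in> den" "t \<in> den"
      by (metis localization_cases)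
    note c' = d[THEN car]
    show "x \<otimes>\<^bsub>?Q\<^esub> y \<in> carrier ?Q" using c c' d mult_den by (auto simp: xyz mult_fraction intro!: fraction_closed)
    show "x \<otimes>\<^bsub>?Q\<^esub> y = y \<otimes>\<^bsub>?Q\<^esub> x" using c c' d by (simp add: xyz mult_fraction m_comm)
  next
    show "\<one>\<^bsub>?Q\<^esub> \<in> carrier ?Q" unfolding one_localization by (rule fraction_closed[OF one_closed one_den])
  next
    fix x assume "x \<in> carrier ?Q"
    then obtain a s where xyz: "x = fraction R I a s" and c: "a \<in> carrier R" and d: "s \<in> den"
      by (metis localization_cases)
    note c' = d[THEN car]
    show "\<one>\<^bsub>?Q\<^esub> \<otimes>\<^bsub>?Q\<^esub> x = x" using c c' d one_den by (simp add: xyz mult_fraction one_localization)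
  qed
  fix x y z assume "x \<in> carrier ?Q" "y \<in> carrier ?Q" "z \<in> carrier ?Q"
  then obtain a b c s t r where xyz: "x = fraction R I a s" "y = fraction R I b t" "z = fraction R I c r"
    and c: "a \<in> carrier R" "b \<in> carrier R" "c \<in> carrier R" and d: "s \<in> den" "t \<in> den" "r \<in> den"
    by (metis localization_cases)
  note c' = d[THEN car]
  have st: "s \<otimes> t \<in> den" "t \<otimes> r \<in> den" "s \<otimes> r \<in> den" using d mult_den by auto
  show "(x \<oplus>\<^bsub>?Q\<^esub> y) \<otimes>\<^bsub>?Q\<^esub> z = (x \<otimes>\<^bsub>?Q\<^esub> z) \<oplus>\<^bsub>?Q\<^esub> (y \<otimes>\<^bsub>?Q\<^esub> z)"
    unfolding xyz add_fraction[OF c(1) d(1) c(2) d(2)] mult_fraction[OF c(2) d(2) c(3) d(3)]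
      mult_fraction[OF c(1) d(1) c(3) d(3)]
      apply (subst mult_fraction)
          apply (use c c' d st in simp_all)[4]
      apply (subst add_fraction)
          apply (use c c' d st in simp_all)[4]
      apply (rule fraction_eqI)
          apply (use c c' in simp)
         apply (use d mult_den in blast)
        apply (use c c' in simp)
       apply (use d mult_den in blast)
      apply (use c c' in algebra)
    done
qed

lemma fraction_eq_zero_iff:
  assumes "a \<in> carrier R" "s \<in> den"
  shows "fraction R I a s = \<zero>\<^bsub>localization R I\<^esub> \<longleftrightarrow> (\<exists>u\<in>den. u \<otimes> a = \<zero>)"
  using assms one_den unfolding zero_localization by (subst fraction_eq_iff) auto

lemma fraction_hom: "ring_hom_ring R (localization R I) (\<lambda>a. fraction R I a \<one>)"
proof (rule ring_hom_ringI)
  interpret Q: cring "localization R I" by (rule cring_localization)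
  show "ring (localization R I)" by (rule Q.ring_axioms)
  show "ring R" by (rule ring_axioms)
qed (use one_den in \<open>auto simp: add_fraction mult_fraction one_localization fraction_closed simp del: Diff_iff\<close>)

definition contraction :: "('a \<times> 'a) set set \<Rightarrow> 'a set" where
  "contraction J = {a \<in> carrier R. fraction R I a \<one> \<in> J}"

definition extension :: "'a set \<Rightarrow> ('a \<times> 'a) set set" where
  "extension K = {fraction R I a s |a s. a \<in> K \<and> s \<in> den}"

lemma ideal_contraction:
  assumes "ideal J (localization R I)"
  shows "ideal (contraction J) R"
  unfolding contraction_def using ring_hom_ring.ideal_vimage[OF fraction_hom assms] .

text \<open>Denominators are units of the localization, so an ideal is determined by its numerators.\<close>

lemma fraction_mem_iff:
  assumes J: "ideal J (localization R I)" and a: "a \<in> carrier R" and s: "s \<in> den"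
  shows "fraction R I a s \<in> J \<longleftrightarrow> a \<in> contraction J"
proof -
  interpret J: ideal J "localization R I" by (rule J)
  have sc: "s \<in> carrier R" using s by auto
  have "fraction R I s \<one> \<otimes>\<^bsub>localization R I\<^esub> fraction R I a s = fraction R I (s \<otimes> a) (\<one> \<otimes> s)"
    by (rule mult_fraction[OF sc one_den a s])
  also have "\<dots> = fraction R I a \<one>"
    by (rule fraction_eqI) (use a sc s one_den in \<open>auto simp: m_comm\<close>)
  finally have 1: "fraction R I s \<one> \<otimes>\<^bsub>localization R I\<^esub> fraction R I a s = fraction R I a \<one>" .
  have "fraction R I \<one> s \<otimes>\<^bsub>localization R I\<^esub> fraction R I a \<one> = fraction R I (\<one> \<otimes> a) (s \<otimes> \<one>)"
    by (rule mult_fraction[OF one_closed s a one_den])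
  also have "\<dots> = fraction R I a s"
    using a sc by simp
  finally have 2: "fraction R I \<one> s \<otimes>\<^bsub>localization R I\<^esub> fraction R I a \<one> = fraction R I a s" .
  show ?thesis
    using J.I_l_closed[OF _ fraction_closed[OF sc one_den]]
      J.I_l_closed[OF _ fraction_closed[OF one_closed s]] 1 2 a
    by (metis (mono_tags, lifting) contraction_def mem_Collect_eq)
qed

lemma ideal_subset_iff:
  assumes "ideal J (localization R I)" "ideal K (localization R I)"
  shows "J \<subseteq> K \<longleftrightarrow> contraction J \<subseteq> contraction K"
proof
  show "J \<subseteq> K \<Longrightarrow> contraction J \<subseteq> contraction K" by (auto simp: contraction_def)
  assume s: "contraction J \<subseteq> contraction K"
  show "J \<subseteq> K"
  proof
    fix x assume x: "x \<in> J"
    then have "x \<in> carrier (localization R I)" using assms(1) ideal.Icarr by metis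
    then obtain a s where "a \<in> carrier R" "s \<in> den" "x = fraction R I a s" by (rule localization_cases)
    then show "x \<in> K" using s x assms fraction_mem_iff by blast
  qed
qed

text \<open>A numerator outside \<open>I\<close> is a unit of the localization.\<close>

lemma contraction_disjoint:
  assumes J: "ideal J (localization R I)" and ne: "J \<noteq> carrier (localization R I)"
  shows "contraction J \<subseteq> I"
proof
  fix a assume a: "a \<in> contraction J"
  show "a \<in> I"
  proof (rule ccontr)
    assume "a \<notin> I"
    then have ad: "a \<in> den" and ac: "a \<in> carrier R" using a by (auto simp: contraction_def)
    have "fraction R I a a \<in> J" using fraction_mem_iff[OF J ac ad] a by simp
    moreover have "fraction R I a a = \<one>\<^bsub>localization R I\<^esub>"
      unfolding one_localization by (rule fraction_eqI) (use ac ad one_den in auto)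
    ultimately show False using ne ideal.one_imp_carrier[OF J] by simp
  qed
qed

lemma primeideal_contraction:
  assumes "primeideal J (localization R I)"
  shows "primeideal (contraction J) R"
proof -
  interpret J: primeideal J "localization R I" by fact
  have i: "ideal (contraction J) R" by (rule ideal_contraction[OF J.is_ideal])
  show ?thesis
  proof (rule primeidealI[OF i is_cring])
    show "carrier R \<noteq> contraction J"
      using contraction_disjoint[OF J.is_ideal] J.I_notcarr one_den by auto
    fix a b assume ab: "a \<in> carrier R" "b \<in> carrier R" "a \<otimes> b \<in> contraction J"
    then have "fraction R I a \<one> \<otimes>\<^bsub>localization R I\<^esub> fraction R I b \<one> \<in> J"
      using one_den by (simp add: mult_fraction contraction_def)
    then show "a \<in> contraction J \<or> b \<in> contraction J"
      using J.I_prime[OF fraction_closed[OF ab(1) one_den] fraction_closed[OF ab(2) one_den]] ab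
      by (simp add: contraction_def)
  qed
qed

lemma noetherian_localization:
  assumes "noetherian_ring R"
  shows "noetherian_ring (localization R I)"
proof -
  interpret Q: cring "localization R I" by (rule cring_localization)
  show ?thesis
  proof (rule Q.noetherian_ringI)
    fix J assume J: "ideal J (localization R I)"
    obtain A where A: "A \<subseteq> carrier R" "finite A" "contraction J = Idl A"
      using noetherian_ring.finetely_gen[OF assms ideal_contraction[OF J]] by metis
    let ?B = "(\<lambda>a. fraction R I a \<one>) ` A"
    have B: "?B \<subseteq> carrier (localization R I)" using A fraction_closed[OF _ one_den] by auto
    have AJ: "A \<subseteq> contraction J" using A genideal_self by metis
    have id: "ideal (Idl\<^bsub>localization R I\<^esub> ?B) (localization R I)" using B Q.genideal_ideal by simp
    have "A \<subseteq> contraction (Idl\<^bsub>localization R I\<^esub> ?B)"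
      using A Q.genideal_self[OF B] by (auto simp: contraction_def)
    then have "contraction J \<subseteq> contraction (Idl\<^bsub>localization R I\<^esub> ?B)"
      unfolding A(3) by (rule genideal_minimal[OF ideal_contraction[OF id]])
    then have "J \<subseteq> Idl\<^bsub>localization R I\<^esub> ?B" using ideal_subset_iff[OF J id] by simp
    moreover have "Idl\<^bsub>localization R I\<^esub> ?B \<subseteq> J"
      by (rule Q.genideal_minimal[OF J]) (use AJ in \<open>auto simp: contraction_def\<close>)
    ultimately show "\<exists>B\<subseteq>carrier (localization R I). finite B \<and> J = Idl\<^bsub>localization R I\<^esub> B"
      using B A(2) by (intro exI[of _ ?B]) auto
  qed
qed

text \<open>Primality is what allows cancelling the multipliers outside \<open>I\<close> that occur in equality of fractions.\<close>

lemma fraction_mem_extension_iff: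
  assumes K: "primeideal K R" "K \<subseteq> I" and a: "a \<in> carrier R" "s \<in> den"
  shows "fraction R I a s \<in> extension K \<longleftrightarrow> a \<in> K"
proof
  show "a \<in> K \<Longrightarrow> fraction R I a s \<in> extension K" using a by (auto simp: extension_def)
  interpret K: primeideal K R by fact
  assume "fraction R I a s \<in> extension K"
  then obtain b t where bt: "b \<in> K" "t \<in> den" "fraction R I a s = fraction R I b t"
    by (auto simp: extension_def)
  then obtain u where u: "u \<in> den" "u \<otimes> (a \<otimes> t) = u \<otimes> (b \<otimes> s)"
    using fraction_eq_iff a K.Icarr by metis
  have "u \<otimes> (b \<otimes> s) \<in> K" by (rule K.I_l_closed[OF K.I_r_closed[OF bt(1)]]) (use a u in auto)
  then have "u \<otimes> (a \<otimes> t) \<in> K" using u by simp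
  moreover have "u \<notin> K" "t \<notin> K" "u \<in> carrier R" "t \<in> carrier R" using u bt K by auto
  ultimately show "a \<in> K" using K.I_prime[of u "a \<otimes> t"] K.I_prime[of a t] a by auto
qed

lemma ideal_extension:
  assumes "ideal K R"
  shows "ideal (extension K) (localization R I)"
proof -
  interpret Q: cring "localization R I" by (rule cring_localization)
  interpret K: ideal K R by fact
  show ?thesis
  proof (rule Q.ideal_of_closed)
    show "extension K \<subseteq> carrier (localization R I)"
      unfolding extension_def using fraction_closed[OF K.Icarr] by blast
    show "\<zero>\<^bsub>localization R I\<^esub> \<in> extension K"
      using K.zero_closed one_den unfolding zero_localization extension_def by blast
    fix x y assume "x \<in> extension K" "y \<in> extension K"
    then obtain a s b t where *: "x = fraction R I a s" "y = fraction R I b t" "a \<in> K" "b \<in> K" "s \<in> den" "t \<in> den"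
      by (auto simp: extension_def)
    have "a \<otimes> t \<oplus> b \<otimes> s \<in> K" using * by (auto intro!: K.a_closed K.I_r_closed)
    then show "x \<oplus>\<^bsub>localization R I\<^esub> y \<in> extension K"
      using * K.Icarr mult_den add_fraction[of a s b t] by (auto simp: extension_def)
  next
    fix x y assume "x \<in> carrier (localization R I)" "y \<in> extension K"
    then obtain a s b t where *: "x = fraction R I a s" "y = fraction R I b t" "a \<in> carrier R" "b \<in> K" "s \<in> den" "t \<in> den"
      by (auto simp: extension_def carrier_localization)
    have "a \<otimes> b \<in> K" using * by (auto intro!: K.I_l_closed)
    then show "x \<otimes>\<^bsub>localization R I\<^esub> y \<in> extension K"
      using * K.Icarr mult_den mult_fraction[of a s b t] by (auto simp: extension_def)
  qed
qed

lemma contraction_extension: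
  assumes "primeideal K R" "K \<subseteq> I"
  shows "contraction (extension K) = K"
proof -
  interpret K: primeideal K R by fact
  show ?thesis
    using fraction_mem_extension_iff[OF assms _ one_den] K.Icarr by (auto simp: contraction_def)
qed

lemma primeideal_extension:
  assumes K: "primeideal K R" "K \<subseteq> I"
  shows "primeideal (extension K) (localization R I)"
proof (rule primeidealI)
  interpret K: primeideal K R by fact
  show "ideal (extension K) (localization R I)" by (rule ideal_extension[OF K.is_ideal])
  show "cring (localization R I)" by (rule cring_localization)
  have "fraction R I \<one> \<one> \<notin> extension K"
    using fraction_mem_extension_iff[OF K one_closed one_den] K.I_notcarr K.one_imp_carrier by auto
  then show "carrier (localization R I) \<noteq> extension K"
    using fraction_closed[OF one_closed one_den] by auto
  fix x y assume "x \<in> carrier (localization R I)" "y \<in> carrier (localization R I)"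
    and xy: "x \<otimes>\<^bsub>localization R I\<^esub> y \<in> extension K"
  then obtain a s b t where *: "x = fraction R I a s" "y = fraction R I b t" "a \<in> carrier R" "b \<in> carrier R" "s \<in> den" "t \<in> den"
    by (metis localization_cases)
  have "a \<otimes> b \<in> K"
    using xy * mult_den fraction_mem_extension_iff[OF K, of "a \<otimes> b" "s \<otimes> t"] by (simp add: mult_fraction)
  then show "x \<in> extension K \<or> y \<in> extension K"
    using * K.I_prime fraction_mem_extension_iff[OF K] by auto
qed

lemma maximalideal_localization_iff:
  "maximalideal J (localization R I) \<longleftrightarrow> J = extension I"
proof -
  have pI: "primeideal I R" by (rule primeideal)
  have eI: "ideal (extension I) (localization R I)" by (rule ideal_extension[OF is_ideal])
  have *: "J \<subseteq> extension I"
    if "ideal J (localization R I)" "J \<noteq> carrier (localization R I)" for J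
    using contraction_disjoint[OF that] ideal_subset_iff[OF that(1) eI] contraction_extension[OF pI] by simp
  have ne: "extension I \<noteq> carrier (localization R I)"
    using primeideal.I_notcarr[OF primeideal_extension[OF pI]] by auto
  show ?thesis
  proof
    assume "maximalideal J (localization R I)"
    then interpret J: maximalideal J "localization R I" .
    show "J = extension I"
      using J.I_maximal[OF eI] *[OF J.is_ideal] J.I_notcarr ne ideal.Icarr[OF eI] by auto
  next
    assume J: "J = extension I"
    show "maximalideal J (localization R I)"
      unfolding J by (rule maximalidealI[OF eI]) (use ne * in auto)
  qed
qed

end

section \<open>Nilpotent thickenings of the affine line\<close>

lemma poly_ideal_principal:
  fixes S :: "'k::field poly set"
  assumes "0 \<in> S" "\<And>p q. p \<in> S \<Longrightarrow> q \<in> S \<Longrightarrow> p + q \<in> S" "\<And>p q. q \<in> S \<Longrightarrow> p * q \<in> S"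
  obtains d where "d \<in> S" "\<And>p. p \<in> S \<Longrightarrow> d dvd p"
proof (cases "S = {0}")
  case True
  then show thesis using that by simp
next
  case False
  then have "\<exists>p. p \<in> S \<and> p \<noteq> 0" using assms(1) by auto
  then obtain d where d: "d \<in> S" "d \<noteq> 0" "\<And>q. q \<in> S \<Longrightarrow> q \<noteq> 0 \<Longrightarrow> degree d \<le> degree q"
    using ex_has_least_nat[of "\<lambda>p. p \<in> S \<and> p \<noteq> 0" _ degree] by metis
  have "d dvd p" if "p \<in> S" for p
  proof -
    have "p mod d = p + (- (p div d)) * d" by (simp add: minus_div_mult_eq_mod[symmetric])
    then have "p mod d \<in> S" using assms(2,3) that d(1) by metis
    then have "p mod d = 0" using d(3)[of "p mod d"] degree_mod_less[OF d(2), of p] by fastforce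
    then show ?thesis by auto
  qed
  then show thesis using that d(1) by blast
qed

text \<open>The valuation of \<open>a\<close> at \<open>d\<close>; only the existence of the decomposition matters, and it holds for every
nonunit since the degree drops with each division.\<close>

lemma poly_split_off_power:
  fixes a d :: "'k::field poly"
  assumes "a \<noteq> 0" "\<not> is_unit d"
  shows "\<exists>j c. a = d ^ j * c \<and> \<not> d dvd c"
  using assms(1)
proof (induction "degree a" arbitrary: a rule: less_induct)
  case less
  show ?case
  proof (cases "d dvd a")
    case False
    then show ?thesis by (intro exI[of _ 0] exI[of _ a]) simp
  next
    case True
    then obtain b where b: "a = d * b" by auto
    have "b \<noteq> 0" "d \<noteq> 0" using b less by auto
    moreover from this have "degree d > 0"
      using assms(2) is_unit_iff_degree by blast
    ultimately obtain j c where "b = d ^ j * c" "\<not> d dvd c"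
      using less.hyps[of b] b by (auto simp: degree_mult_eq)
    then show ?thesis using b by (intro exI[of _ "Suc j"] exI[of _ c]) simp
  qed
qed

text \<open>The spectrum of such a ring \<open>R\<close> is that of \<open>K[t]\<close>: prime ideals contain the nilpotent kernel of \<open>\<phi>\<close>
and are therefore determined by their images.\<close>

locale nil_thickening = cring R for R (structure) +
  fixes \<phi> :: "'a \<Rightarrow> 'k::field poly"
  assumes noetherian: "noetherian_ring R"
    and phi_add: "a \<in> carrier R \<Longrightarrow> b \<in> carrier R \<Longrightarrow> \<phi> (a \<oplus> b) = \<phi> a + \<phi> b"
    and phi_mult: "a \<in> carrier R \<Longrightarrow> b \<in> carrier R \<Longrightarrow> \<phi> (a \<otimes> b) = \<phi> a * \<phi> b"
    and phi_one: "\<phi> \<one> = 1"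
    and phi_surj: "\<exists>a\<in>carrier R. \<phi> a = p"
    and phi_nil: "a \<in> carrier R \<Longrightarrow> \<phi> a = 0 \<Longrightarrow> \<exists>N::nat. a [^] N = \<zero>"
begin

lemma phi_zero: "\<phi> \<zero> = 0"
  using phi_add[of \<zero> \<zero>] by (metis add_cancel_right_right l_zero zero_closed)

lemma phi_minus: "a \<in> carrier R \<Longrightarrow> b \<in> carrier R \<Longrightarrow> \<phi> (a \<ominus> b) = \<phi> a - \<phi> b"
  using phi_add[of "\<ominus> b" b] phi_add[of a "\<ominus> b"] phi_zero
  by (simp add: l_neg minus_eq eq_neg_iff_add_eq_0)

lemma phi_pow: "a \<in> carrier R \<Longrightarrow> \<phi> (a [^] (j::nat)) = \<phi> a ^ j"
  by (induction j) (auto simp: phi_one phi_mult)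

lemma primeideal_pow_mem:
  assumes "primeideal K R" "a \<in> carrier R" "a [^] (j::nat) \<in> K"
  shows "a \<in> K"
  using assms(3)
proof (induction j)
  case 0
  interpret K: primeideal K R by fact
  show ?case using 0 K.I_notcarr K.one_imp_carrier by auto
next
  case (Suc j)
  then show ?case using primeideal.I_prime[OF assms(1), of "a [^] j" a] assms(2) by auto
qed

lemma primeideal_mem_iff:
  assumes K: "primeideal K R" and a: "a \<in> carrier R"
  shows "a \<in> K \<longleftrightarrow> \<phi> a \<in> \<phi> ` K"
proof
  interpret K: primeideal K R by fact
  assume "\<phi> a \<in> \<phi> ` K"
  then obtain b where b: "b \<in> K" "\<phi> a = \<phi> b" by auto
  have bc: "b \<in> carrier R" using b K.Icarr by simp
  obtain N where "(a \<ominus> b) [^] (N::nat) = \<zero>"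
    using phi_nil[of "a \<ominus> b"] phi_minus[OF a bc] b a bc by auto
  then have "a \<ominus> b \<in> K"
    using primeideal_pow_mem[OF K, of "a \<ominus> b" N] a bc K.zero_closed by auto
  then have "(a \<ominus> b) \<oplus> b \<in> K" using b K.a_closed by simp
  moreover have "(a \<ominus> b) \<oplus> b = a" using a bc by algebra
  ultimately show "a \<in> K" by simp
qed simp

lemma phi_image_principal:
  assumes K: "ideal K R"
  obtains d where "d \<in> K" "\<And>a. a \<in> K \<Longrightarrow> \<phi> d dvd \<phi> a"
proof -
  interpret K: ideal K R by fact
  have 1: "0 \<in> \<phi> ` K" using phi_zero K.zero_closed by force
  have 2: "p + q \<in> \<phi> ` K" if pq: "p \<in> \<phi> ` K" "q \<in> \<phi> ` K" for p q
  proof -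
    obtain a b where "p = \<phi> a" "q = \<phi> b" "a \<in> K" "b \<in> K" using pq by auto
    then have "p + q = \<phi> (a \<oplus> b)" "a \<oplus> b \<in> K" using phi_add K.a_closed K.Icarr by auto
    then show ?thesis by blast
  qed
  have 3: "p * q \<in> \<phi> ` K" if q: "q \<in> \<phi> ` K" for p q
  proof -
    obtain a b where "p = \<phi> a" "q = \<phi> b" "a \<in> carrier R" "b \<in> K" using q phi_surj[of p] by auto
    then have "p * q = \<phi> (a \<otimes> b)" "a \<otimes> b \<in> K" using phi_mult K.I_l_closed K.Icarr by auto
    then show ?thesis by blast
  qed
  obtain p where "p \<in> \<phi> ` K" "\<And>q. q \<in> \<phi> ` K \<Longrightarrow> p dvd q"
    by (rule poly_ideal_principal[of "\<phi> ` K"]) (use 1 2 3 in auto)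
  then show thesis using that by auto
qed

text \<open>In the principal ideal domain \<open>K[t]\<close> a nonzero prime ideal is maximal.  Choose \<open>h \<in> K\<close> and \<open>d \<in> L\<close>
whose images generate those of \<open>K\<close> and \<open>L\<close>.  Then \<open>\<phi> h = \<phi> d \<phi> e\<close> for some \<open>e\<close>, and primality of
\<open>K\<close> puts either \<open>d\<close> into \<open>K\<close>, which gives \<open>L \<subseteq> K\<close>, or \<open>e\<close>, which would make \<open>\<phi> d\<close> a unit.\<close>

lemma primeideal_eq_of_nonzero:
  assumes K: "primeideal K R" and L: "primeideal L R" and KL: "K \<subseteq> L"
    and ne: "c \<in> K" "\<phi> c \<noteq> 0"
  shows "K = L"
proof
  interpret K: primeideal K R by fact
  interpret L: primeideal L R by fact
  obtain h where h: "h \<in> K" "\<And>a. a \<in> K \<Longrightarrow> \<phi> h dvd \<phi> a" using phi_image_principal[OF K.is_ideal] by blast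
  obtain d where d: "d \<in> L" "\<And>a. a \<in> L \<Longrightarrow> \<phi> d dvd \<phi> a" using phi_image_principal[OF L.is_ideal] by blast
  have h0: "\<phi> h \<noteq> 0" using h(2)[OF ne(1)] ne(2) by auto
  obtain e where e: "e \<in> carrier R" "\<phi> h = \<phi> d * \<phi> e"
    using d(2)[of h] h(1) KL phi_surj by (metis dvdE subset_iff)
  have "d \<otimes> e \<in> K"
    using primeideal_mem_iff[OF K, of "d \<otimes> e"] phi_mult[of d e] e imageI[OF h(1), of \<phi>] d(1) L.Icarr by auto
  moreover have "e \<notin> K"
  proof
    assume "e \<in> K"
    then have "\<phi> h dvd \<phi> e" using h(2) by simp
    then have "\<phi> d dvd 1" using e(2) h0 by (metis dvd_mult_cancel_right dvd_times_right_cancel_iff mult_1 mult_zero_right)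
    then obtain g where g: "g \<in> carrier R" "1 = \<phi> d * \<phi> g" using phi_surj by (metis dvdE)
    have "d \<otimes> g \<in> L" using d(1) g L.I_r_closed by simp
    then have "\<one> \<in> L"
      using primeideal_mem_iff[OF L one_closed] phi_one phi_mult[of d g] g d(1) L.Icarr by force
    then show False using L.I_notcarr L.one_imp_carrier by simp
  qed
  ultimately have dK: "d \<in> K" using K.I_prime[of d e] d(1) e(1) L.Icarr by auto
  show "L \<subseteq> K"
  proof
    fix x assume x: "x \<in> L"
    then obtain g where g: "g \<in> carrier R" "\<phi> x = \<phi> d * \<phi> g" using d(2) phi_surj by (metis dvdE)
    have "d \<otimes> g \<in> K" using dK g K.I_r_closed by simp
    then show "x \<in> K" using primeideal_mem_iff[OF K, of x] x phi_mult[of d g] g L.Icarr dK K.Icarr by force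
  qed
qed (rule KL)

definition nil_ideal :: "'a set" where "nil_ideal = {a \<in> carrier R. \<phi> a = 0}"

lemma primeideal_nil_ideal: "primeideal nil_ideal R"
proof (rule primeidealI)
  show "ideal nil_ideal R"
    by (rule ideal_of_closed) (auto simp: nil_ideal_def phi_add phi_mult phi_zero)
  show "carrier R \<noteq> nil_ideal" using phi_one by (force simp: nil_ideal_def)
  show "a \<in> nil_ideal \<or> b \<in> nil_ideal"
    if "a \<in> carrier R" "b \<in> carrier R" "a \<otimes> b \<in> nil_ideal" for a b
    using that phi_mult[of a b] by (simp add: nil_ideal_def)
qed (rule is_cring)

lemma nil_ideal_subset:
  assumes K: "primeideal K R"
  shows "nil_ideal \<subseteq> K"
proof
  interpret K: primeideal K R by fact
  fix a assume "a \<in> nil_ideal"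
  then have "a \<in> carrier R" "\<phi> a = \<phi> \<zero>" by (auto simp: nil_ideal_def phi_zero)
  then show "a \<in> K" using primeideal_mem_iff[OF K] imageI[OF K.zero_closed, of \<phi>] by simp
qed

text \<open>\<open>K[t]\<close> is not a field, so the kernel of \<open>\<phi>\<close> is not maximal.\<close>

lemma maximalideal_has_nonzero:
  assumes "maximalideal M R"
  shows "\<exists>c\<in>M. \<phi> c \<noteq> 0"
proof (rule ccontr)
  assume *: "\<not> ?thesis"
  interpret M: maximalideal M R by fact
  have M: "primeideal M R" using maximalideal_prime assms by simp
  have sub: "M \<subseteq> nil_ideal" using * M.Icarr by (auto simp: nil_ideal_def)
  obtain x where x: "x \<in> carrier R" "\<phi> x = [:0, 1:]" using phi_surj by metis
  \<comment> \<open>The elements whose image is divisible by the indeterminate form a proper ideal above \<open>M\<close>.\<close>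
  let ?J = "{a \<in> carrier R. [:0, 1:] dvd \<phi> a}"
  have "ideal ?J R"
    by (rule ideal_of_closed) (auto simp: phi_add phi_mult phi_zero)
  moreover have "M \<subseteq> ?J" using sub by (auto simp: nil_ideal_def)
  ultimately have "?J = M \<or> ?J = carrier R" using M.I_maximal[of ?J] by auto
  then show False
  proof
    assume "?J = M"
    moreover have "x \<in> ?J" using x by simp
    ultimately have "x \<in> nil_ideal" using sub by blast
    then show False using x by (simp add: nil_ideal_def)
  next
    assume "?J = carrier R"
    then have "\<one> \<in> ?J" by simp
    then have "[:0, 1:] dvd (1 :: 'k poly)" using phi_one by simp
    then show False using is_unit_iff_degree[of "[:0, 1:] :: 'k poly"] by simp
  qed
qed

text \<open>The kernel of \<open>\<phi>\<close> and \<open>M\<close> give a chain of length one.  In a longer chain the middle prime would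
contain an element outside the kernel and hence be equal to the one above it.\<close>

lemma krull_dim_localization:
  assumes max: "maximalideal M R"
  shows "krull_dim (localization R M) = 1"
proof -
  have M: "primeideal M R" by (rule maximalideal_prime[OF max])
  interpret M: primeideal M R by (rule M)
  let ?Q = "localization R M"
  let ?chain = "\<lambda>n p. (\<forall>i\<le>n. primeideal (p i) ?Q) \<and> (\<forall>i<n. p i \<subset> p (Suc i))"
  let ?p = "\<lambda>i::nat. if i = 0 then M.extension nil_ideal else M.extension M"
  have sub: "nil_ideal \<subseteq> M" by (rule nil_ideal_subset[OF M])
  have "nil_ideal \<noteq> M" using maximalideal_has_nonzero[OF max] by (auto simp: nil_ideal_def)
  then have "M.extension nil_ideal \<noteq> M.extension M"
    using M.contraction_extension[OF primeideal_nil_ideal sub] M.contraction_extension[OF M] by auto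
  moreover have "M.extension nil_ideal \<subseteq> M.extension M" using sub by (auto simp: M.extension_def)
  ultimately have 1: "?chain 1 ?p"
    using M.primeideal_extension[OF primeideal_nil_ideal sub] M.primeideal_extension[OF M] by auto
  have 2: "n \<le> 1" if "?chain n p" for n and p :: "nat \<Rightarrow> ('a \<times> 'a) set set"
  proof (rule ccontr)
    assume n: "\<not> n \<le> 1"
    let ?c = "\<lambda>i. M.contraction (p i)"
    have pr: "primeideal (p 0) ?Q" "primeideal (p 1) ?Q" "primeideal (p 2) ?Q" using that n by auto
    have id: "ideal (p 0) ?Q" "ideal (p 1) ?Q" "ideal (p 2) ?Q"
      using pr primeideal.axioms(1) by blast+
    have step: "\<forall>i<n. p i \<subset> p (Suc i)" using that by blast
    have sub: "p 0 \<subset> p 1" "p 1 \<subset> p 2"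
      using step[rule_format, of 0] step[rule_format, of 1] n by (simp_all add: numeral_2_eq_2)
    then have c: "?c 0 \<subset> ?c 1" "?c 1 \<subset> ?c 2"
      using M.ideal_subset_iff id by (metis psubset_eq subset_antisym equalityE)+
    obtain x where x: "x \<in> ?c 1" "x \<notin> ?c 0" using c by auto
    then have "x \<notin> nil_ideal" using nil_ideal_subset[OF M.primeideal_contraction[OF pr(1)]] by auto
    then have "\<phi> x \<noteq> 0" using x by (auto simp: nil_ideal_def M.contraction_def)
    then have "?c 1 = ?c 2"
      using primeideal_eq_of_nonzero[OF M.primeideal_contraction[OF pr(2)] M.primeideal_contraction[OF pr(3)] _ x(1)] c
      by auto
    then show False using c by simp
  qed
  show ?thesis unfolding krull_dim_def
  proof (rule antisym)
    show "Sup {enat n |n. \<exists>p. ?chain n p} \<le> 1"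
      by (rule Sup_least) (use 2 in \<open>auto simp: one_enat_def simp del: One_nat_def\<close>)
    show "1 \<le> Sup {enat n |n. \<exists>p. ?chain n p}"
      unfolding one_enat_def by (rule Sup_upper) (use exI[where P = "?chain 1", OF 1] in blast)
  qed
qed

text \<open>Modulo \<open>J\<close> the elements \<open>z\<close> and \<open>u\<close> are equal.\<close>

lemma power_transfer:
  assumes J: "ideal J R" and c: "z \<in> carrier R" "u \<in> carrier R" "g \<in> carrier R"
    and zu: "z \<ominus> u \<in> J" and mem: "z [^] (j::nat) \<otimes> g \<in> J"
  shows "u [^] j \<otimes> g \<in> J"
  using c(3) mem
proof (induction j arbitrary: g)
  case 0
  then show ?case by simp
next
  case (Suc j)
  interpret J: ideal J R by fact
  have "z [^] j \<otimes> (z \<otimes> g) \<in> J" using Suc.prems c by (simp add: m_assoc)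
  then have 1: "u [^] j \<otimes> (z \<otimes> g) \<in> J" using Suc c by simp
  have "\<ominus> (u [^] j \<otimes> g) \<otimes> (z \<ominus> u) \<in> J" using J.I_l_closed[OF zu] c Suc.prems by simp
  then have "u [^] j \<otimes> (z \<otimes> g) \<oplus> \<ominus> (u [^] j \<otimes> g) \<otimes> (z \<ominus> u) \<in> J" using 1 J.a_closed by simp
  moreover have "v \<otimes> (z \<otimes> g) \<oplus> \<ominus> (v \<otimes> g) \<otimes> (z \<ominus> u) = v \<otimes> u \<otimes> g" if "v \<in> carrier R" for v
    using that c Suc.prems by algebra
  ultimately show ?case using c by (simp add: nat_pow_Suc)
qed

lemma regular_pow:
  assumes "\<And>g. g \<in> carrier R \<Longrightarrow> b \<otimes> g \<in> J \<Longrightarrow> g \<in> J" "b \<in> carrier R" "g \<in> carrier R"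
    "b [^] (j::nat) \<otimes> g \<in> J"
  shows "g \<in> J"
  using assms(3,4)
proof (induction j arbitrary: g)
  case 0
  then show ?case by simp
next
  case (Suc j)
  have "b [^] j \<otimes> (b \<otimes> g) \<in> J" using Suc.prems assms(2) by (simp add: m_assoc)
  then have "b \<otimes> g \<in> J" using Suc assms(2) by simp
  then show ?case using assms(1) Suc.prems by simp
qed

text \<open>The ideals \<open>J0\<close> and \<open>J1\<close> stand for the contractions of \<open>0\<close> and of the ideal generated by \<open>a\<close> in
the localization at \<open>M\<close>.  The quotient by a nonzerodivisor has dimension zero, which here is made
explicit: if \<open>\<phi> d\<close> generates the image of \<open>M\<close> in \<open>K[t]\<close> and \<open>\<phi> a = (\<phi> d)\<^sup>j \<phi> w\<close> with \<open>\<phi> w\<close> not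
divisible by \<open>\<phi> d\<close>, then \<open>b\<^sup>j w\<close> is a multiple of \<open>a\<close> up to a nilpotent element.  So some power of
\<open>b\<close> times some power of \<open>w\<close> lies in \<open>J1\<close>, and regularity of \<open>b\<close> modulo \<open>J1\<close> leaves a power of \<open>w\<close>
in \<open>J1\<close>, although \<open>w\<close> is not in \<open>M\<close>.\<close>

lemma no_two_regular_elements:
  assumes max: "maximalideal M R" and a: "a \<in> M" and b: "b \<in> M"
    and J0: "ideal J0 R" "J0 \<subseteq> M" and J1: "ideal J1 R" "J1 \<subseteq> M" "a \<in> J1"
    and ra: "\<And>g. g \<in> carrier R \<Longrightarrow> a \<otimes> g \<in> J0 \<Longrightarrow> g \<in> J0"
    and rb: "\<And>g. g \<in> carrier R \<Longrightarrow> b \<otimes> g \<in> J1 \<Longrightarrow> g \<in> J1"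
  shows False
proof -
  have M: "primeideal M R" by (rule maximalideal_prime[OF max])
  interpret M: primeideal M R by (rule M)
  interpret J1: ideal J1 R by (rule J1)
  interpret J0: ideal J0 R by (rule J0)
  have ab: "a \<in> carrier R" "b \<in> carrier R" using a b M.Icarr by auto
  have one: "\<one> \<notin> M" using M.one_imp_carrier M.I_notcarr by auto
  have a0: "\<phi> a \<noteq> 0"
  proof
    assume "\<phi> a = 0"
    then obtain N where "a [^] (N::nat) = \<zero>" using phi_nil ab by blast
    then have "\<one> \<in> J0" using regular_pow[OF ra ab(1) one_closed, of N] ab J0.zero_closed by simp
    then show False using one J0 by auto
  qed
  obtain d where d: "d \<in> M" "\<And>a. a \<in> M \<Longrightarrow> \<phi> d dvd \<phi> a"
    using phi_image_principal[OF M.is_ideal] by blast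
  have dc: "d \<in> carrier R" using d M.Icarr by simp
  have "\<not> is_unit (\<phi> d)"
  proof
    assume "is_unit (\<phi> d)"
    then obtain e where e: "e \<in> carrier R" "1 = \<phi> d * \<phi> e" using phi_surj by (metis dvdE)
    have "d \<otimes> e \<in> M" using d e M.I_r_closed by simp
    then have "\<phi> \<one> \<in> \<phi> ` M" using e phi_mult[OF dc e(1)] phi_one by force
    then show False using primeideal_mem_iff[OF M one_closed] one by simp
  qed
  then obtain j c where "\<phi> a = \<phi> d ^ j * c" "\<not> \<phi> d dvd c" using poly_split_off_power[OF a0] by blast
  then obtain w where w: "w \<in> carrier R" "\<phi> a = \<phi> d ^ j * \<phi> w" "\<not> \<phi> d dvd \<phi> w"
    using phi_surj[of c] by auto
  have wM: "w \<notin> M" using w d by auto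
  obtain e where e: "e \<in> carrier R" "\<phi> b = \<phi> d * \<phi> e"
    using d(2)[OF b] phi_surj by (metis dvdE)
  \<comment> \<open>Both have the image \<open>(\<phi> d \<phi> e)\<^sup>j \<phi> w\<close>.\<close>
  let ?u = "b [^] j \<otimes> w" and ?v = "a \<otimes> e [^] j"
  have uv: "?u \<in> carrier R" "?v \<in> carrier R" using ab e w by auto
  have "\<phi> ?u = \<phi> ?v" using ab e w by (simp add: phi_mult phi_pow power_mult_distrib)
  then have "\<phi> (?u \<ominus> ?v) = 0" using uv by (simp add: phi_minus)
  then obtain N where N: "(?u \<ominus> ?v) [^] (N::nat) = \<zero>" using phi_nil uv by blast
  have "?u \<ominus> ?v \<ominus> ?u = \<ominus> (e [^] j) \<otimes> a"
  proof -
    have "?u \<ominus> a \<otimes> f \<ominus> ?u = \<ominus> f \<otimes> a" if "f \<in> carrier R" for f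
    proof -
      have "u \<ominus> a \<otimes> f \<ominus> u = \<ominus> f \<otimes> a" if "u \<in> carrier R" "f \<in> carrier R" for u f
        using that ab by algebra
      then show ?thesis using uv that by blast
    qed
    then show ?thesis using e by simp
  qed
  moreover have "\<ominus> (e [^] j) \<otimes> a \<in> J1" using J1.I_l_closed[OF J1(3)] e by simp
  ultimately have "?u \<ominus> ?v \<ominus> ?u \<in> J1" by simp
  then have "?u [^] N \<otimes> \<one> \<in> J1"
    using power_transfer[OF J1(1), of "?u \<ominus> ?v" ?u \<one> N] uv N J1.zero_closed by auto
  then have "(b [^] j) [^] N \<otimes> w [^] N \<in> J1" using ab w by (simp add: nat_pow_distrib)
  then have "b [^] (j * N) \<otimes> w [^] N \<in> J1" using ab by (simp add: nat_pow_pow)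
  then have "w [^] N \<in> J1" using regular_pow[OF rb ab(2) nat_pow_closed[OF w(1)]] by simp
  then show False using J1(2) primeideal_pow_mem[OF M w(1)] wM by auto
qed

text \<open>Dimension is one and depth at most one, so the question is whether the maximal ideal of the localization
contains a nonzerodivisor.  Clearing denominators expresses this in \<open>R\<close> itself.\<close>

lemma cohen_macaulay_localization_iff:
  assumes max: "maximalideal M R"
  shows "cohen_macaulay_local_ring (localization R M) \<longleftrightarrow>
    (\<exists>a\<in>M. \<forall>b\<in>carrier R. (\<exists>u\<in>carrier R - M. u \<otimes> (a \<otimes> b) = \<zero>) \<longrightarrow> (\<exists>u\<in>carrier R - M. u \<otimes> b = \<zero>))"
    (is "_ \<longleftrightarrow> ?reg")
proof -
  have M: "primeideal M R" by (rule maximalideal_prime[OF max])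
  interpret M: primeideal M R by (rule M)
  let ?Q = "localization R M"
  interpret Q: cring ?Q by (rule M.cring_localization)
  have eM: "ideal (M.extension M) ?Q" by (rule M.ideal_extension[OF M.is_ideal])
  have ex_ne: "M.extension M \<noteq> carrier ?Q"
    using primeideal.I_notcarr[OF M.primeideal_extension[OF M]] by auto
  have memZ: "M.contraction {\<zero>\<^bsub>?Q\<^esub>} = {a \<in> carrier R. \<exists>u\<in>M.den. u \<otimes> a = \<zero>}"
    using M.fraction_eq_zero_iff[OF _ M.one_den] by (auto simp: M.contraction_def)
  have Idl0: "Idl\<^bsub>?Q\<^esub> {} = {\<zero>\<^bsub>?Q\<^esub>}"
    using Q.genideal_minimal[OF Q.zeroideal, of "{}"] additive_subgroup.zero_closed[OF ideal.axioms(1)[OF Q.genideal_ideal[of "{}"]]]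
    by auto
  \<comment> \<open>Regularity modulo an ideal of the localization is seen on numerators.\<close>
  have reg: "(\<forall>y\<in>carrier ?Q. fraction R M a s \<otimes>\<^bsub>?Q\<^esub> y \<in> J \<longrightarrow> y \<in> J) \<longleftrightarrow>
     (\<forall>b\<in>carrier R. a \<otimes> b \<in> M.contraction J \<longrightarrow> b \<in> M.contraction J)"
    if J: "ideal J ?Q" and a: "a \<in> carrier R" "s \<in> M.den" for J a s
  proof -
    have "fraction R M a s \<otimes>\<^bsub>?Q\<^esub> fraction R M b t \<in> J \<longleftrightarrow> a \<otimes> b \<in> M.contraction J"
      if "b \<in> carrier R" "t \<in> M.den" for b t
      using M.mult_fraction[OF a that] M.fraction_mem_iff[OF J, of "a \<otimes> b" "s \<otimes> t"] M.mult_den a that by auto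
    moreover have "fraction R M b t \<in> J \<longleftrightarrow> b \<in> M.contraction J" if "b \<in> carrier R" "t \<in> M.den" for b t
      using M.fraction_mem_iff[OF J that] .
    ultimately have *: "(fraction R M a s \<otimes>\<^bsub>?Q\<^esub> fraction R M b t \<in> J \<longrightarrow> fraction R M b t \<in> J) \<longleftrightarrow>
      (a \<otimes> b \<in> M.contraction J \<longrightarrow> b \<in> M.contraction J)" if "b \<in> carrier R" "t \<in> M.den" for b t
      using that by simp
    show ?thesis
    proof (intro iffI ballI)
      fix b assume "\<forall>y\<in>carrier ?Q. fraction R M a s \<otimes>\<^bsub>?Q\<^esub> y \<in> J \<longrightarrow> y \<in> J" and b: "b \<in> carrier R"
      then show "a \<otimes> b \<in> M.contraction J \<longrightarrow> b \<in> M.contraction J"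
        using *[OF b M.one_den] M.fraction_closed[OF b M.one_den] by simp
    next
      fix y assume r: "\<forall>b\<in>carrier R. a \<otimes> b \<in> M.contraction J \<longrightarrow> b \<in> M.contraction J" and "y \<in> carrier ?Q"
      then obtain b t where b: "b \<in> carrier R" "t \<in> M.den" and y: "y = fraction R M b t"
        by (elim M.localization_cases)
      show "fraction R M a s \<otimes>\<^bsub>?Q\<^esub> y \<in> J \<longrightarrow> y \<in> J"
        unfolding y *[OF b] using r b(1) by simp
    qed
  qed
  have le: "length xs \<le> 1" if xs: "regular_sequence ?Q xs" "set xs \<subseteq> M.extension M" for xs
  proof (rule ccontr)
    assume "\<not> length xs \<le> 1"
    then obtain x y zs where [simp]: "xs = x # y # zs" by (cases xs; cases "tl xs") auto
    obtain a s b t where ab: "x = fraction R M a s" "y = fraction R M b t" "a \<in> M" "b \<in> M" "s \<in> M.den" "t \<in> M.den"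
      using xs(2) by (auto simp: M.extension_def)
    have abc: "a \<in> carrier R" "b \<in> carrier R" using ab M.Icarr by auto
    have sx: "set xs \<subseteq> carrier ?Q" using xs by (simp add: regular_sequence_def)
    have ix: "ideal (Idl\<^bsub>?Q\<^esub> {x}) ?Q" using Q.genideal_ideal[of "{x}"] sx by simp
    have r: "\<forall>i<length xs. \<forall>a\<in>carrier ?Q. xs ! i \<otimes>\<^bsub>?Q\<^esub> a \<in> Idl\<^bsub>?Q\<^esub> (set (take i xs)) \<longrightarrow> a \<in> Idl\<^bsub>?Q\<^esub> (set (take i xs))"
      using xs(1) unfolding regular_sequence_def by blast
    have r0: "\<forall>g\<in>carrier ?Q. x \<otimes>\<^bsub>?Q\<^esub> g \<in> {\<zero>\<^bsub>?Q\<^esub>} \<longrightarrow> g \<in> {\<zero>\<^bsub>?Q\<^esub>}"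
      using r[rule_format, of 0] Idl0 by simp
    have r1: "\<forall>g\<in>carrier ?Q. y \<otimes>\<^bsub>?Q\<^esub> g \<in> Idl\<^bsub>?Q\<^esub> {x} \<longrightarrow> g \<in> Idl\<^bsub>?Q\<^esub> {x}"
      using r[rule_format, of 1] by simp
    have xM: "Idl\<^bsub>?Q\<^esub> {x} \<subseteq> M.extension M"
      by (rule Q.genideal_minimal[OF eM]) (use xs(2) in auto)
    then have ne: "Idl\<^bsub>?Q\<^esub> {x} \<noteq> carrier ?Q" using ex_ne ideal.Icarr[OF eM] by auto
    have "{\<zero>\<^bsub>?Q\<^esub>} \<subseteq> M.extension M" "M.extension M \<subseteq> carrier ?Q"
      using ideal.Icarr[OF eM] additive_subgroup.zero_closed[OF ideal.axioms(1)[OF eM]] by auto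
    then have "{\<zero>\<^bsub>?Q\<^esub>} \<noteq> carrier ?Q" using ex_ne by (metis subset_antisym)
    then have ZM: "M.contraction {\<zero>\<^bsub>?Q\<^esub>} \<subseteq> M" by (rule M.contraction_disjoint[OF Q.zeroideal])
    have "x \<in> Idl\<^bsub>?Q\<^esub> {x}" using Q.genideal_self'[of x] sx by simp
    then have "a \<in> M.contraction (Idl\<^bsub>?Q\<^esub> {x})"
      using M.fraction_mem_iff[OF ix abc(1) ab(5)] ab(1) by simp
    then show False
    proof (rule no_two_regular_elements[OF max ab(3,4) M.ideal_contraction[OF Q.zeroideal] ZM
          M.ideal_contraction[OF ix] M.contraction_disjoint[OF ix ne]])
      show "g \<in> M.contraction {\<zero>\<^bsub>?Q\<^esub>}"
        if "g \<in> carrier R" "a \<otimes> g \<in> M.contraction {\<zero>\<^bsub>?Q\<^esub>}" for g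
        using iffD1[OF reg[OF Q.zeroideal abc(1) ab(5)] r0[unfolded ab(1)]] that by blast
      show "g \<in> M.contraction (Idl\<^bsub>?Q\<^esub> {x})"
        if "g \<in> carrier R" "b \<otimes> g \<in> M.contraction (Idl\<^bsub>?Q\<^esub> {x})" for g
        using iffD1[OF reg[OF ix abc(2) ab(6)] r1[unfolded ab(2)]] that by blast
    qed
  qed
  have depth_iff: "depth ?Q (M.extension M) = 1 \<longleftrightarrow> (\<exists>x\<in>M.extension M. \<forall>y\<in>carrier ?Q. x \<otimes>\<^bsub>?Q\<^esub> y \<in> {\<zero>\<^bsub>?Q\<^esub>} \<longrightarrow> y \<in> {\<zero>\<^bsub>?Q\<^esub>})"
    (is "_ \<longleftrightarrow> ?R")
  proof
    assume d: "depth ?Q (M.extension M) = 1"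
    have "\<exists>xs. regular_sequence ?Q xs \<and> set xs \<subseteq> M.extension M \<and> xs \<noteq> []"
    proof (rule ccontr)
      assume "\<not> ?thesis"
      then have "depth ?Q (M.extension M) \<le> 0"
        unfolding depth_def by (intro Sup_least) (auto simp: zero_enat_def[symmetric])
      then show False using d by simp
    qed
    then obtain x ys where "regular_sequence ?Q (x # ys)" "set (x # ys) \<subseteq> M.extension M"
      by (metis neq_Nil_conv)
    then have r: "\<forall>i<length (x # ys). \<forall>a\<in>carrier ?Q. (x # ys) ! i \<otimes>\<^bsub>?Q\<^esub> a \<in> Idl\<^bsub>?Q\<^esub> (set (take i (x # ys))) \<longrightarrow>
        a \<in> Idl\<^bsub>?Q\<^esub> (set (take i (x # ys)))" and x: "x \<in> M.extension M"
      unfolding regular_sequence_def by simp_all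
    have "\<forall>y\<in>carrier ?Q. x \<otimes>\<^bsub>?Q\<^esub> y \<in> Idl\<^bsub>?Q\<^esub> {} \<longrightarrow> y \<in> Idl\<^bsub>?Q\<^esub> {}"
      using r[rule_format, of 0] by simp
    then show ?R using x unfolding Idl0 by (rule bexI)
  next
    assume ?R
    then obtain x where x: "x \<in> M.extension M" "\<forall>y\<in>carrier ?Q. x \<otimes>\<^bsub>?Q\<^esub> y \<in> Idl\<^bsub>?Q\<^esub> {} \<longrightarrow> y \<in> Idl\<^bsub>?Q\<^esub> {}"
      unfolding Idl0 by blast
    have "Idl\<^bsub>?Q\<^esub> {x} \<subseteq> M.extension M"
      by (rule Q.genideal_minimal[OF eM]) (use x in auto)
    then have "Idl\<^bsub>?Q\<^esub> {x} \<noteq> carrier ?Q" using ex_ne ideal.Icarr[OF eM] by auto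
    then have "regular_sequence ?Q [x]"
      using x ideal.Icarr[OF eM] by (simp add: regular_sequence_def)
    then have "1 \<le> depth ?Q (M.extension M)"
      unfolding depth_def using x by (intro Sup_upper) (auto simp: one_enat_def intro!: exI[of _ "[x]"])
    moreover have "depth ?Q (M.extension M) \<le> 1"
      unfolding depth_def using le by (intro Sup_least) (auto simp: one_enat_def)
    ultimately show "depth ?Q (M.extension M) = 1" by simp
  qed
  have "cohen_macaulay_local_ring ?Q \<longleftrightarrow> depth ?Q (M.extension M) = 1"
  proof -
    have "(\<forall>J. J = M.extension M \<longleftrightarrow> J = m) \<longleftrightarrow> m = M.extension M" for m by auto
    then show ?thesis
      unfolding cohen_macaulay_local_ring_def krull_dim_localization[OF max] M.maximalideal_localization_iff
      by (simp add: M.cring_localization M.noetherian_localization[OF noetherian])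
  qed
  also have "\<dots> \<longleftrightarrow> (\<exists>a\<in>M. \<forall>b\<in>carrier R. a \<otimes> b \<in> M.contraction {\<zero>\<^bsub>?Q\<^esub>} \<longrightarrow> b \<in> M.contraction {\<zero>\<^bsub>?Q\<^esub>})"
    (is "_ = (\<exists>a\<in>M. ?P a)")
  proof -
    have "?R \<longleftrightarrow> (\<exists>a\<in>M. \<exists>s\<in>M.den. \<forall>y\<in>carrier ?Q. fraction R M a s \<otimes>\<^bsub>?Q\<^esub> y \<in> {\<zero>\<^bsub>?Q\<^esub>} \<longrightarrow> y \<in> {\<zero>\<^bsub>?Q\<^esub>})"
      unfolding M.extension_def by blast
    also have "\<dots> \<longleftrightarrow> (\<exists>a\<in>M. ?P a)"
    proof -
      have drop_den: "(\<exists>a\<in>A. \<exists>s\<in>B. W a s) \<longleftrightarrow> (\<exists>a\<in>A. P a)"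
        if "\<And>a s. a \<in> A \<Longrightarrow> s \<in> B \<Longrightarrow> W a s \<longleftrightarrow> P a" "\<exists>b. b \<in> B"
        for A B :: "'a set" and W :: "'a \<Rightarrow> 'a \<Rightarrow> bool" and P
        using that by blast
      show ?thesis
        by (rule drop_den, rule reg[OF Q.zeroideal M.Icarr], assumption, assumption)
          (rule exI, rule M.one_den)
    qed
    finally show ?thesis unfolding depth_iff .
  qed
  also have "\<dots> \<longleftrightarrow> ?reg"
  proof (intro bex_cong ball_cong refl)
    fix a b assume "a \<in> M" "b \<in> carrier R"
    then have "a \<otimes> b \<in> carrier R" using M.Icarr by simp
    then show "(a \<otimes> b \<in> M.contraction {\<zero>\<^bsub>?Q\<^esub>} \<longrightarrow> b \<in> M.contraction {\<zero>\<^bsub>?Q\<^esub>}) \<longleftrightarrow>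
      ((\<exists>u\<in>M.den. u \<otimes> (a \<otimes> b) = \<zero>) \<longrightarrow> (\<exists>u\<in>M.den. u \<otimes> b = \<zero>))"
      using \<open>b \<in> carrier R\<close> unfolding memZ by simp
  qed
  finally show ?thesis .
qed

lemma cohen_macaulay_iff:
  "cohen_macaulay_ring R \<longleftrightarrow> (\<forall>M. maximalideal M R \<longrightarrow>
    (\<exists>a\<in>M. \<forall>b\<in>carrier R. (\<exists>u\<in>carrier R - M. u \<otimes> (a \<otimes> b) = \<zero>) \<longrightarrow> (\<exists>u\<in>carrier R - M. u \<otimes> b = \<zero>)))"
  unfolding cohen_macaulay_ring_def
  by (simp only: noetherian is_cring cohen_macaulay_localization_iff simp_thms cong: imp_cong)

end

section \<open>Ideals of the polynomial ring and linear functionals\<close>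

lemma ideal_type_ring_iff:
  fixes J :: "'a::comm_ring_1 set"
  shows "ideal J ring_of_type_algebra \<longleftrightarrow> 0 \<in> J \<and> (\<forall>a\<in>J. \<forall>b\<in>J. a + b \<in> J) \<and> (\<forall>r. \<forall>a\<in>J. r * a \<in> J)"
proof
  assume "ideal J ring_of_type_algebra"
  then interpret J: ideal J "ring_of_type_algebra" .
  show "0 \<in> J \<and> (\<forall>a\<in>J. \<forall>b\<in>J. a + b \<in> J) \<and> (\<forall>r. \<forall>a\<in>J. r * a \<in> J)"
    using additive_subgroup.zero_closed[OF J.is_additive_subgroup]
      additive_subgroup.a_closed[OF J.is_additive_subgroup] J.I_l_closed by (simp add: ring_of_type_algebra_def)
next
  assume *: "0 \<in> J \<and> (\<forall>a\<in>J. \<forall>b\<in>J. a + b \<in> J) \<and> (\<forall>r. \<forall>a\<in>J. r * a \<in> J)"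
  show "ideal J ring_of_type_algebra"
    by (rule cring.ideal_of_closed[OF cring_from_type_algebra])
      (use * in \<open>auto simp: ring_of_type_algebra_def\<close>)
qed

lemma type_ring_simps [simp]:
  "carrier (ring_of_type_algebra :: 'a::comm_ring_1 ring) = UNIV"
  "(a :: 'a) \<otimes>\<^bsub>ring_of_type_algebra\<^esub> b = a * b"
  "(a :: 'a) \<oplus>\<^bsub>ring_of_type_algebra\<^esub> b = a + b"
  "\<one>\<^bsub>ring_of_type_algebra\<^esub> = (1 :: 'a)"
  "\<zero>\<^bsub>ring_of_type_algebra\<^esub> = (0 :: 'a)"
  by (simp_all add: ring_of_type_algebra_def)

lemma ideal_sum_mem:
  fixes J :: "'a::comm_ring_1 set"
  assumes "ideal J ring_of_type_algebra" "\<And>i. i \<in> A \<Longrightarrow> g i \<in> J"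
  shows "sum g A \<in> J"
  using assms(2)
  by (induction A rule: infinite_finite_induct) (use assms(1) in \<open>auto simp: ideal_type_ring_iff\<close>)

lemma ideal_diff_mem:
  fixes J :: "'a::comm_ring_1 set"
  assumes "ideal J ring_of_type_algebra" "a \<in> J" "b \<in> J"
  shows "a - b \<in> J"
proof -
  have "(- 1) * b \<in> J" using assms unfolding ideal_type_ring_iff by blast
  then have "a + (- 1) * b \<in> J" using assms unfolding ideal_type_ring_iff by blast
  then show ?thesis by simp
qed

lemma mpoly_as_sum: "(f :: 'a \<Rightarrow>\<^sub>0 'b::comm_monoid_add) = (\<Sum>m\<in>Poly_Mapping.keys f. Poly_Mapping.single m (Poly_Mapping.lookup f m))"
  by (rule poly_mapping_eqI) (auto simp: lookup_sum lookup_single when_def in_keys_iff)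

text \<open>The linear extension of a function given on monomials with coefficients.  Evaluations of polynomials and
sums of selected coefficients are both of this form.\<close>

definition linear_sum :: "('a \<Rightarrow> 'b::comm_ring_1 \<Rightarrow> 'c::comm_ring_1) \<Rightarrow> ('a \<Rightarrow>\<^sub>0 'b) \<Rightarrow> 'c" where
  "linear_sum g f = (\<Sum>m\<in>Poly_Mapping.keys f. g m (Poly_Mapping.lookup f m))"

definition additive_coeffs :: "('a \<Rightarrow> 'b::comm_ring_1 \<Rightarrow> 'c::comm_ring_1) \<Rightarrow> bool" where
  "additive_coeffs g \<longleftrightarrow> (\<forall>m c d. g m (c + d) = g m c + g m d)"

lemma additive_coeffs_zero: "additive_coeffs g \<Longrightarrow> g m 0 = 0"
  unfolding additive_coeffs_def by (metis add.right_neutral add_left_cancel)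

lemma linear_sum_superset:
  assumes "additive_coeffs g" "finite A" "Poly_Mapping.keys f \<subseteq> A"
  shows "linear_sum g f = (\<Sum>m\<in>A. g m (Poly_Mapping.lookup f m))"
  unfolding linear_sum_def
  by (rule sum.mono_neutral_left) (use assms additive_coeffs_zero in \<open>auto simp: in_keys_iff\<close>)

lemma linear_sum_add:
  assumes g: "additive_coeffs g"
  shows "linear_sum g (p + q) = linear_sum g p + linear_sum g q"
proof -
  let ?A = "Poly_Mapping.keys p \<union> Poly_Mapping.keys q"
  have "Poly_Mapping.keys (p + q) \<subseteq> ?A" by (rule keys_add)
  then show ?thesis
    using linear_sum_superset[OF g, of ?A "p + q"] linear_sum_superset[OF g, of ?A p] linear_sum_superset[OF g, of ?A q] g
    by (simp add: lookup_add additive_coeffs_def sum.distrib)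
qed

lemma linear_sum_zero [simp]: "linear_sum g 0 = 0"
  by (simp add: linear_sum_def)

lemma linear_sum_sum: "additive_coeffs g \<Longrightarrow> linear_sum g (sum p A) = (\<Sum>i\<in>A. linear_sum g (p i))"
  by (induction A rule: infinite_finite_induct) (auto simp: linear_sum_add)

lemma linear_sum_diff:
  assumes "additive_coeffs g"
  shows "linear_sum g (p - q) = linear_sum g p - linear_sum g q"
  using linear_sum_add[OF assms, of "p - q" q] by simp

lemma linear_sum_single: "additive_coeffs g \<Longrightarrow> linear_sum g (Poly_Mapping.single m c) = g m c"
  by (simp add: linear_sum_def additive_coeffs_zero)

lemma linear_sum_mult:
  assumes g: "additive_coeffs g" and mult: "\<And>m m' c c'. g (m + m') (c * c') = g m c * g m' c'"
  shows "linear_sum g (p * q) = linear_sum g p * linear_sum g (q :: ('a::cancel_comm_monoid_add \<Rightarrow>\<^sub>0 'b::comm_ring_1))"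
proof -
  have "p * q = (\<Sum>m\<in>Poly_Mapping.keys p. \<Sum>m'\<in>Poly_Mapping.keys q.
      Poly_Mapping.single (m + m') (Poly_Mapping.lookup p m * Poly_Mapping.lookup q m'))"
    by (subst mpoly_as_sum[of p], subst mpoly_as_sum[of q])
      (simp add: sum_product mult_single)
  then have "linear_sum g (p * q) = (\<Sum>m\<in>Poly_Mapping.keys p. \<Sum>m'\<in>Poly_Mapping.keys q.
      g m (Poly_Mapping.lookup p m) * g m' (Poly_Mapping.lookup q m'))"
    using g by (simp add: linear_sum_sum linear_sum_single mult)
  then show ?thesis by (simp add: linear_sum_def sum_product)
qed

definition sum_on :: "'a set \<Rightarrow> ('a \<Rightarrow>\<^sub>0 'b::comm_ring_1) \<Rightarrow> 'b" where
  "sum_on E = linear_sum (\<lambda>m c. if m \<in> E then c else 0)"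

lemma additive_sum_on: "additive_coeffs (\<lambda>m c. if m \<in> E then c else 0)"
  by (simp add: additive_coeffs_def)

lemmas sum_on_add = linear_sum_add[OF additive_sum_on, folded sum_on_def]
lemmas sum_on_diff = linear_sum_diff[OF additive_sum_on, folded sum_on_def]
lemmas sum_on_sum = linear_sum_sum[OF additive_sum_on, folded sum_on_def]
lemmas sum_on_single = linear_sum_single[OF additive_sum_on, folded sum_on_def]

lemma sum_on_monomial_mult:
  fixes f :: "'a::cancel_comm_monoid_add \<Rightarrow>\<^sub>0 'b::comm_ring_1"
  shows "sum_on E (Poly_Mapping.single u c * f) = c * sum_on {m. u + m \<in> E} f"
proof -
  have "sum_on E (Poly_Mapping.single u c * f)
      = sum_on E (\<Sum>m\<in>Poly_Mapping.keys f. Poly_Mapping.single (u + m) (c * Poly_Mapping.lookup f m))"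
    by (subst mpoly_as_sum[of f]) (simp add: sum_distrib_left mult_single)
  also have "\<dots> = c * sum_on {m. u + m \<in> E} f"
    unfolding sum_on_sum sum_on_single by (auto simp: sum_on_def linear_sum_def sum_distrib_left intro!: sum.cong)
  finally show ?thesis .
qed

lemma sum_on_eq_zero: "(\<And>m. m \<in> Poly_Mapping.keys f \<Longrightarrow> m \<notin> E) \<Longrightarrow> sum_on E f = 0"
  by (auto simp: sum_on_def linear_sum_def intro!: sum.neutral)

text \<open>Every polynomial is a sum of monomials.\<close>

lemma ideal_of_monomial_closed:
  fixes J :: "('a::cancel_comm_monoid_add \<Rightarrow>\<^sub>0 'b::comm_ring_1) set"
  assumes "0 \<in> J" "\<And>p q. p \<in> J \<Longrightarrow> q \<in> J \<Longrightarrow> p + q \<in> J"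
    "\<And>u c p. p \<in> J \<Longrightarrow> Poly_Mapping.single u c * p \<in> J"
  shows "ideal J ring_of_type_algebra"
  unfolding ideal_type_ring_iff
proof (intro conjI ballI allI)
  fix r p assume p: "p \<in> J"
  have sum: "(\<And>i. i \<in> A \<Longrightarrow> h i \<in> J) \<Longrightarrow> sum h A \<in> J" for h and A :: "'a set"
    by (induction A rule: infinite_finite_induct) (auto simp: assms(1,2))
  have "r * p = (\<Sum>u\<in>Poly_Mapping.keys r. Poly_Mapping.single u (Poly_Mapping.lookup r u) * p)"
    by (subst mpoly_as_sum[of r]) (simp add: sum_distrib_right)
  also have "\<dots> \<in> J" by (rule sum) (rule assms(3)[OF p])
  finally show "r * p \<in> J" .
qed (use assms in auto)

section \<open>The initial ideal of a monomial curve\<close>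

definition weight :: "('v::finite \<Rightarrow> nat) \<Rightarrow> ('v \<Rightarrow>\<^sub>0 nat) \<Rightarrow> nat" where
  "weight n m = (\<Sum>i\<in>UNIV. n i * Poly_Mapping.lookup m i)"

definition tdeg :: "('v::finite \<Rightarrow>\<^sub>0 nat) \<Rightarrow> nat" where
  "tdeg m = (\<Sum>i\<in>UNIV. Poly_Mapping.lookup m i)"

definition longest :: "('v::finite \<Rightarrow> nat) \<Rightarrow> ('v \<Rightarrow>\<^sub>0 nat) \<Rightarrow> bool" where
  "longest n m \<longleftrightarrow> (\<forall>m'. weight n m' = weight n m \<longrightarrow> tdeg m' \<le> tdeg m)"

lemma weight_add: "weight n (a + b) = weight n a + weight n b"
  by (simp add: weight_def lookup_add algebra_simps sum.distrib)

lemma tdeg_add: "tdeg (a + b) = tdeg a + tdeg b"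
  by (simp add: tdeg_def lookup_add sum.distrib)

lemma longest_addD: "longest n (u + m) \<Longrightarrow> longest n m"
  unfolding longest_def by (metis add_le_cancel_left tdeg_add weight_add)

text \<open>The monomials of weight \<open>s\<close> that are longest all represent the basis element of the tangent cone that
belongs to the semigroup element \<open>s\<close>; shorter ones represent \<open>0\<close>.  So this is the coordinate of
the residue class of a polynomial at that basis element.\<close>

definition class_sum :: "('v::finite \<Rightarrow> nat) \<Rightarrow> nat \<Rightarrow> ('v, 'k::field) mpoly \<Rightarrow> 'k" where
  "class_sum n s = sum_on {m. weight n m = s \<and> longest n m}"

definition longest_relations :: "('v::finite \<Rightarrow> nat) \<Rightarrow> ('v, 'k::field) mpoly set" where
  "longest_relations n = {f. \<forall>s. class_sum n s f = 0}"

text \<open>Factors of a longest monomial are longest.  So when a monomial \<open>u\<close> times some longest monomial of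
weight \<open>t\<close> is longest, this holds for all longest monomials of weight \<open>t\<close> at the same time, and
multiplication by \<open>u\<close> moves a coordinate to another place or kills it.\<close>

lemma ideal_longest_relations:
  "ideal (longest_relations n :: ('v::finite, 'k::field) mpoly set) mpoly_ring"
proof (rule ideal_of_monomial_closed)
  show "(0 :: ('v, 'k) mpoly) \<in> longest_relations n"
    by (simp add: longest_relations_def class_sum_def sum_on_def)
  show "p + q \<in> longest_relations n" if "p \<in> longest_relations n" "q \<in> longest_relations n"
    for p q :: "('v, 'k) mpoly"
    using that by (simp add: longest_relations_def class_sum_def sum_on_add)
  fix u c and p :: "('v, 'k) mpoly" assume p: "p \<in> longest_relations n"
  have "class_sum n s (Poly_Mapping.single u c * p) = 0" for s
  proof (cases "\<exists>m. weight n (u + m) = s \<and> longest n (u + m)")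
    case True
    then obtain m0 where m0: "weight n (u + m0) = s" "longest n (u + m0)" by blast
    \<comment> \<open>Multiplication by \<open>u\<close> carries a whole class of longest monomials to longest ones.\<close>
    have "weight n (u + m) = s \<and> longest n (u + m) \<longleftrightarrow> weight n m = weight n m0 \<and> longest n m" for m
    proof
      assume "weight n (u + m) = s \<and> longest n (u + m)"
      then show "weight n m = weight n m0 \<and> longest n m"
        using longest_addD m0 by (auto simp: weight_add)
    next
      assume "weight n m = weight n m0 \<and> longest n m"
      moreover from this have "tdeg m = tdeg m0"
        using longest_addD[OF m0(2)] unfolding longest_def by (metis le_antisym)
      ultimately show "weight n (u + m) = s \<and> longest n (u + m)"
        using m0 unfolding longest_def by (simp add: weight_add tdeg_add)
    qed
    then have "class_sum n s (Poly_Mapping.single u c * p) = c * class_sum n (weight n m0) p"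
      unfolding class_sum_def sum_on_monomial_mult by simp
    then show ?thesis using p by (simp add: longest_relations_def)
  next
    case False
    then show ?thesis
      unfolding class_sum_def sum_on_monomial_mult by (subst sum_on_eq_zero) auto
  qed
  then show "Poly_Mapping.single u c * p \<in> longest_relations n" by (simp add: longest_relations_def)
qed

text \<open>The coefficient of \<open>t\<^sup>s\<close> in the image of \<open>f\<close> collects the monomials of weight \<open>s\<close>.\<close>

lemma curve_ideal_iff: "f \<in> curve_ideal n \<longleftrightarrow> (\<forall>s. sum_on {m. weight n m = s} f = 0)"
proof -
  have "poly.coeff (curve_hom n f) s = sum_on {m. weight n m = s} f" for s
    by (auto simp: curve_hom_def sum_on_def linear_sum_def weight_def coeff_sum intro!: sum.cong)
  moreover have "f \<in> curve_ideal n \<longleftrightarrow> curve_hom n f = 0"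
    by (simp add: curve_ideal_def a_kernel_def')
  ultimately show ?thesis by (simp add: poly_eq_iff)
qed

lemma lookup_homogeneous_part:
  "Poly_Mapping.lookup (homogeneous_part d f) m = (if tdeg m = d then Poly_Mapping.lookup f m else 0)"
  by (auto simp: homogeneous_part_def tdeg_def lookup_sum lookup_single when_def in_keys_iff)

text \<open>Let \<open>d\<close> be the least degree occurring in \<open>f\<close>.  If the longest monomials of weight \<open>s\<close> have degree
\<open>d\<close>, then all monomials of \<open>f\<close> of weight \<open>s\<close> are longest, and their coefficients add up to \<open>0\<close>.
Otherwise the initial form has no longest monomial of weight \<open>s\<close>.\<close>

lemma initial_form_in_longest_relations:
  fixes f :: "('v::finite, 'k::field) mpoly"
  assumes f: "f \<in> curve_ideal n"
  shows "initial_form f \<in> longest_relations n"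
proof -
  define d where "d = (LEAST d. homogeneous_part d f \<noteq> 0)"
  let ?h = "homogeneous_part d f"
  have low: "d \<le> tdeg m" if "m \<in> Poly_Mapping.keys f" for m
  proof -
    have "Poly_Mapping.lookup (homogeneous_part (tdeg m) f) m \<noteq> 0"
      using that by (simp add: lookup_homogeneous_part in_keys_iff)
    then have "homogeneous_part (tdeg m) f \<noteq> 0" by (metis lookup_zero)
    then show ?thesis unfolding d_def by (rule Least_le)
  qed
  have "class_sum n s ?h = 0" for s
  proof (cases "\<exists>m. weight n m = s \<and> longest n m \<and> tdeg m = d")
    case True
    then obtain m0 where m0: "weight n m0 = s" "longest n m0" "tdeg m0 = d" by blast
    have *: "tdeg m = d" "longest n m" if "m \<in> Poly_Mapping.keys f" "weight n m = s" for m
      using low[OF that(1)] m0 that(2) unfolding longest_def by (metis le_antisym)+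
    have "class_sum n s ?h = (\<Sum>m\<in>Poly_Mapping.keys f. if weight n m = s \<and> longest n m then Poly_Mapping.lookup ?h m else 0)"
      unfolding class_sum_def sum_on_def
      by (subst linear_sum_superset[OF additive_sum_on, of "Poly_Mapping.keys f"])
        (auto simp: in_keys_iff lookup_homogeneous_part split: if_splits)
    also have "\<dots> = sum_on {m. weight n m = s} f"
      unfolding sum_on_def linear_sum_def by (rule sum.cong) (use * in \<open>auto simp: lookup_homogeneous_part\<close>)
    finally show ?thesis using f by (simp add: curve_ideal_iff)
  next
    case False
    then show ?thesis unfolding class_sum_def
      by (intro sum_on_eq_zero) (auto simp: in_keys_iff lookup_homogeneous_part split: if_splits)
  qed
  then show ?thesis by (simp add: longest_relations_def initial_form_def d_def)
qed

lemma initial_form_homogeneous: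
  assumes "\<And>m. m \<in> Poly_Mapping.keys f \<Longrightarrow> tdeg m = d"
  shows "initial_form f = f"
proof (cases "f = 0")
  case True
  then show ?thesis
    by (auto simp: initial_form_def lookup_homogeneous_part intro!: poly_mapping_eqI)
next
  case False
  have part: "homogeneous_part e f = (if e = d then f else 0)" for e
    by (rule poly_mapping_eqI) (use assms in \<open>auto simp: lookup_homogeneous_part in_keys_iff\<close>)
  have "(LEAST e. homogeneous_part e f \<noteq> 0) = d"
    by (rule Least_equality) (use False in \<open>auto simp: part split: if_splits\<close>)
  then show ?thesis by (simp add: initial_form_def part)
qed

lemma initial_form_binomial:
  assumes "tdeg m < tdeg m'"
  shows "initial_form (Poly_Mapping.single m 1 - Poly_Mapping.single m' 1) = (Poly_Mapping.single m 1 :: ('v::finite, 'k::field) mpoly)"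
proof -
  let ?f = "Poly_Mapping.single m 1 - Poly_Mapping.single m' 1 :: ('v, 'k) mpoly"
  have part: "homogeneous_part (tdeg m) ?f = Poly_Mapping.single m 1"
    by (rule poly_mapping_eqI) (use assms in \<open>auto simp: lookup_homogeneous_part lookup_minus lookup_single when_def\<close>)
  have below: "homogeneous_part e ?f = 0" if "e < tdeg m" for e
    by (rule poly_mapping_eqI) (use assms that in \<open>auto simp: lookup_homogeneous_part lookup_minus lookup_single when_def\<close>)
  have "(LEAST e. homogeneous_part e ?f \<noteq> 0) = tdeg m"
  proof (rule Least_equality)
    show "homogeneous_part (tdeg m) ?f \<noteq> 0" unfolding part by (metis lookup_single_eq lookup_zero one_neq_zero)
    show "tdeg m \<le> e" if "homogeneous_part e ?f \<noteq> 0" for e using below[of e] that by (meson not_le)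
  qed
  then show ?thesis by (simp add: initial_form_def part)
qed

lemma curve_ideal_binomial:
  "weight n m = weight n m' \<Longrightarrow> Poly_Mapping.single m 1 - Poly_Mapping.single m' 1 \<in> curve_ideal n"
  by (simp add: curve_ideal_iff sum_on_diff sum_on_single)

text \<open>A monomial that is not longest is the initial form of its difference with a longer monomial of the same
weight.  The longest monomials of one weight in a polynomial with vanishing coordinates form a
homogeneous element of the curve ideal, which is its own initial form.\<close>

lemma initial_ideal_curve_ideal:
  "initial_ideal (curve_ideal n) = (longest_relations n :: ('v::finite, 'k::field) mpoly set)"
proof
  interpret P: cring "mpoly_ring :: ('v, 'k) mpoly ring" by (rule cring_from_type_algebra)
  show "initial_ideal (curve_ideal n) \<subseteq> (longest_relations n :: ('v, 'k) mpoly set)"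
    unfolding initial_ideal_def
    by (rule P.genideal_minimal[OF ideal_longest_relations]) (auto intro: initial_form_in_longest_relations)
  let ?J = "initial_ideal (curve_ideal n) :: ('v, 'k) mpoly set"
  have J: "ideal ?J mpoly_ring" unfolding initial_ideal_def by (rule P.genideal_ideal) simp
  have init: "initial_form f \<in> ?J" if "f \<in> curve_ideal n" for f
    unfolding initial_ideal_def using P.genideal_self[of "initial_form ` curve_ideal n"] that by auto
  have short: "Poly_Mapping.single m c \<in> ?J" if "\<not> longest n m" for m c
  proof -
    obtain m' where m': "weight n m' = weight n m" "tdeg m < tdeg m'"
      using \<open>\<not> longest n m\<close> by (auto simp: longest_def not_le)
    have "Poly_Mapping.single m 1 \<in> ?J"
      using init[OF curve_ideal_binomial[OF m'(1)[symmetric]]] unfolding initial_form_binomial[OF m'(2)] .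
    then have "Poly_Mapping.single 0 c * Poly_Mapping.single m 1 \<in> ?J"
      using J unfolding ideal_type_ring_iff by blast
    then show ?thesis by (simp add: mult_single)
  qed
  show "longest_relations n \<subseteq> ?J"
  proof
    fix f :: "('v, 'k) mpoly" assume f: "f \<in> longest_relations n"
    let ?t = "\<lambda>m. Poly_Mapping.single m (Poly_Mapping.lookup f m)"
    let ?K = "{m \<in> Poly_Mapping.keys f. longest n m}"
    let ?g = "\<lambda>s. \<Sum>m | m \<in> ?K \<and> weight n m = s. ?t m"
    have fin: "finite ?K" by simp
    have "?g s \<in> ?J" for s
    proof -
      have "sum_on {m. weight n m = r} (?g s) = (if r = s then class_sum n s f else 0)" for r
      proof -
        have "sum_on {m. weight n m = r} (?g s) = (\<Sum>m | m \<in> ?K \<and> weight n m = s. if r = s then Poly_Mapping.lookup f m else 0)"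
          unfolding sum_on_sum sum_on_single by (rule sum.cong) auto
        also have "\<dots> = (if r = s then class_sum n s f else 0)"
          by (auto simp: class_sum_def sum_on_def linear_sum_def sum.inter_filter[symmetric] intro!: sum.cong)
        finally show ?thesis .
      qed
      then have mem: "?g s \<in> curve_ideal n" using f by (simp add: curve_ideal_iff longest_relations_def)
      have eq: "initial_form (?g s) = ?g s"
      proof (cases "\<exists>m0. m0 \<in> ?K \<and> weight n m0 = s")
        case True
        then obtain m0 where m0: "longest n m0" "weight n m0 = s" by blast
        show ?thesis
        proof (rule initial_form_homogeneous[of _ "tdeg m0"])
          fix m assume "m \<in> Poly_Mapping.keys (?g s)"
          then have "m \<in> ?K \<and> weight n m = s"
            using keys_sum[of ?t "{m. m \<in> ?K \<and> weight n m = s}"] by (auto split: if_splits)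
          then show "tdeg m = tdeg m0" using m0 unfolding longest_def by (auto intro!: le_antisym)
        qed
      next
        case False
        then have "?g s = 0" by (intro sum.neutral) auto
        then show ?thesis using initial_form_homogeneous[of 0] by simp
      qed
      from init[OF mem] show ?thesis unfolding eq .
    qed
    then have "(\<Sum>s\<in>weight n ` ?K. ?g s) \<in> ?J" by (rule ideal_sum_mem[OF J])
    moreover have "(\<Sum>s\<in>weight n ` ?K. ?g s) = (\<Sum>m\<in>?K. ?t m)"
      using sum.group[of ?K "weight n ` ?K" "weight n" ?t] fin by simp
    moreover have "(\<Sum>m\<in>Poly_Mapping.keys f - ?K. ?t m) \<in> ?J"
      by (intro ideal_sum_mem[OF J]) (auto intro: short)
    ultimately have "(\<Sum>m\<in>Poly_Mapping.keys f - ?K. ?t m) + (\<Sum>m\<in>?K. ?t m) \<in> ?J"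
      using J unfolding ideal_type_ring_iff by auto
    also have "(\<Sum>m\<in>Poly_Mapping.keys f - ?K. ?t m) + (\<Sum>m\<in>?K. ?t m) = (\<Sum>m\<in>Poly_Mapping.keys f. ?t m)"
      by (rule sum.subset_diff[symmetric]) auto
    finally show "f \<in> ?J" using mpoly_as_sum[of f] by simp
  qed
qed

lemma longest_exists:
  assumes "\<And>i. n i > 0"
  shows "\<exists>m'. weight n m' = weight n m \<and> longest n m'"
proof -
  have "tdeg m' \<le> weight n m'" for m'
    unfolding tdeg_def weight_def by (rule sum_mono) (use assms in \<open>simp add: Suc_le_eq\<close>)
  then have "\<forall>m'. weight n m' = weight n m \<longrightarrow> tdeg m' < Suc (weight n m)" by (metis le_imp_less_Suc)
  then obtain m' where "weight n m' = weight n m" "\<And>m''. weight n m'' = weight n m \<Longrightarrow> tdeg m'' \<le> tdeg m'"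
    using ex_has_greatest_nat[of "\<lambda>m'. weight n m' = weight n m" m tdeg "Suc (weight n m)"] by auto
  then show ?thesis by (auto simp: longest_def)
qed

section \<open>Quotients of a ring given by a type\<close>

lemma type_ring_minus [simp]: "(a :: 'a::comm_ring_1) \<ominus>\<^bsub>ring_of_type_algebra\<^esub> b = a - b"
proof -
  interpret P: cring "ring_of_type_algebra :: 'a ring" by (rule cring_from_type_algebra)
  have "\<ominus>\<^bsub>ring_of_type_algebra\<^esub> b = - b" by (rule P.minus_equality) simp_all
  then show ?thesis by (simp add: a_minus_def)
qed

abbreviation residue :: "'a::comm_ring_1 set \<Rightarrow> 'a \<Rightarrow> 'a set" where
  "residue J a \<equiv> J +>\<^bsub>ring_of_type_algebra\<^esub> a"

text \<open>This lets computations in the quotient be carried out with representatives, where the arithmetic of the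
type class is available.\<close>

lemma residue_ring:
  fixes J :: "'a::comm_ring_1 set"
  assumes J: "ideal J ring_of_type_algebra"
  shows "cring (ring_of_type_algebra Quot J)"
    and "carrier (ring_of_type_algebra Quot J) = range (residue J)"
    and "residue J a \<otimes>\<^bsub>ring_of_type_algebra Quot J\<^esub> residue J b = residue J (a * b)"
    and "residue J a \<oplus>\<^bsub>ring_of_type_algebra Quot J\<^esub> residue J b = residue J (a + b)"
    and "\<one>\<^bsub>ring_of_type_algebra Quot J\<^esub> = residue J 1"
    and "\<zero>\<^bsub>ring_of_type_algebra Quot J\<^esub> = residue J 0"
    and "residue J a = residue J b \<longleftrightarrow> a - b \<in> J"
proof -
  interpret P: cring "ring_of_type_algebra :: 'a ring" by (rule cring_from_type_algebra)
  interpret J: ideal J "ring_of_type_algebra" by (rule J)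
  show "cring (ring_of_type_algebra Quot J)" by (rule J.quotient_is_cring[OF P.is_cring])
  show "carrier (ring_of_type_algebra Quot J) = range (residue J)"
    unfolding FactRing_def by (auto simp: A_RCOSETS_def')
  show "residue J a \<otimes>\<^bsub>ring_of_type_algebra Quot J\<^esub> residue J b = residue J (a * b)"
    using ring_hom_mult[OF J.rcos_ring_hom, of a b] by simp
  show "residue J a \<oplus>\<^bsub>ring_of_type_algebra Quot J\<^esub> residue J b = residue J (a + b)"
    using ring_hom_add[OF J.rcos_ring_hom, of a b] by simp
  show "\<one>\<^bsub>ring_of_type_algebra Quot J\<^esub> = residue J 1"
    using ring_hom_one[OF J.rcos_ring_hom] by simp
  show "\<zero>\<^bsub>ring_of_type_algebra Quot J\<^esub> = residue J 0"
    using ring_hom_zero[OF J.rcos_ring_hom P.ring_axioms J.quotient_is_ring] by simp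
  show "residue J a = residue J b \<longleftrightarrow> a - b \<in> J"
    using P.quotient_eq_iff_same_a_r_cos[OF J, of a b] by simp
qed

lemma residue_pow:
  assumes J: "ideal J ring_of_type_algebra"
  shows "residue J a [^]\<^bsub>ring_of_type_algebra Quot J\<^esub> (N::nat) = residue J (a ^ N)"
proof -
  interpret Q: cring "ring_of_type_algebra Quot J" by (rule residue_ring(1)[OF J])
  show ?thesis by (induction N) (simp_all add: residue_ring[OF J] mult.commute)
qed

lemma ideal_vimage_residue:
  assumes J: "ideal J ring_of_type_algebra" and K: "ideal K (ring_of_type_algebra Quot J)"
  shows "ideal {a. residue J a \<in> K} ring_of_type_algebra"
proof -
  interpret K: ideal K "ring_of_type_algebra Quot J" by (rule K)
  show ?thesis
    unfolding ideal_type_ring_iff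
    using additive_subgroup.zero_closed[OF K.is_additive_subgroup]
      additive_subgroup.a_closed[OF K.is_additive_subgroup] K.I_l_closed
    by (auto simp: residue_ring(3,4)[OF J, symmetric] residue_ring(6)[OF J] residue_ring(2)[OF J])
qed

section \<open>Polynomials in one of the variables\<close>

text \<open>Induction on the number of generators: the coefficients that occur at a new generator \<open>b\<close> in
elements of \<open>M\<close> form an ideal, and it suffices to add to generators of \<open>M \<inter> span B\<close> one element of \<open>M\<close>
whose coefficient at \<open>b\<close> generates that ideal.\<close>

lemma submodule_finitely_generated:
  fixes scale :: "'k::field poly \<Rightarrow> 'b::ab_group_add \<Rightarrow> 'b"
  assumes mod: "Modules.module scale" and fin: "finite B"
    and M: "Modules.module.subspace scale M" "M \<subseteq> Modules.module.span scale B"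
  shows "\<exists>F\<subseteq>M. finite F \<and> M \<subseteq> Modules.module.span scale F"
  using fin M
proof (induction B arbitrary: M rule: finite_induct)
  case empty
  interpret S: Modules.module scale by (rule mod)
  show ?case using empty by (intro exI[of _ "{}"]) auto
next
  case (insert b B)
  interpret S: Modules.module scale by (rule mod)
  let ?A = "{p. \<exists>g\<in>S.span B. scale p b + g \<in> M}"
  have "\<exists>d\<in>?A. \<forall>p\<in>?A. d dvd p"
  proof (rule poly_ideal_principal[of ?A])
    have "scale 0 b + 0 \<in> M" by (simp add: S.subspace_0[OF insert.prems(1)])
    then show "0 \<in> ?A" using S.span_zero[of B] by blast
    show "p + q \<in> ?A" if pq: "p \<in> ?A" "q \<in> ?A" for p q
    proof -
      obtain g h where gh: "g \<in> S.span B" "scale p b + g \<in> M" "h \<in> S.span B" "scale q b + h \<in> M"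
        using pq by auto
      have "(scale p b + g) + (scale q b + h) \<in> M" using S.subspace_add[OF insert.prems(1)] gh by blast
      also have "(scale p b + g) + (scale q b + h) = scale (p + q) b + (g + h)"
        by (simp add: S.scale_left_distrib)
      finally show ?thesis using S.span_add[OF gh(1,3)] by blast
    qed
    show "p * q \<in> ?A" if q: "q \<in> ?A" for p q
    proof -
      obtain h where h: "h \<in> S.span B" "scale q b + h \<in> M" using q by auto
      have "scale p (scale q b + h) \<in> M" using S.subspace_scale[OF insert.prems(1)] h by blast
      also have "scale p (scale q b + h) = scale (p * q) b + scale p h"
        by (simp add: S.scale_right_distrib)
      finally show ?thesis using S.span_scale[OF h(1)] by blast
    qed
    show "\<exists>d\<in>?A. \<forall>p\<in>?A. d dvd p" if "d \<in> ?A" "\<And>p. p \<in> ?A \<Longrightarrow> d dvd p" for d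
      using that by blast
  qed
  then obtain d where d: "d \<in> ?A" "\<And>p. p \<in> ?A \<Longrightarrow> d dvd p" by blast
  obtain g0 where g0: "g0 \<in> S.span B" "scale d b + g0 \<in> M" using d(1) by auto
  let ?m = "scale d b + g0"
  obtain F where F: "F \<subseteq> M \<inter> S.span B" "finite F" "M \<inter> S.span B \<subseteq> S.span F"
    using insert.IH[of "M \<inter> S.span B"] S.subspace_inter[OF insert.prems(1) S.subspace_span] by auto
  have "M \<subseteq> S.span (insert ?m F)"
  proof
    fix x assume x: "x \<in> M"
    then obtain k where k: "x - scale k b \<in> S.span B" using insert.prems(2) S.span_breakdown_eq by blast
    have "scale k b + (x - scale k b) \<in> M" using x by simp
    then have "k \<in> ?A" using k by blast
    from d(2)[OF this] obtain q where "k = d * q" by (rule dvdE)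
    then have q: "k = q * d" by (simp add: mult.commute)
    have "x - scale q ?m = (x - scale k b) - scale q g0" by (simp add: q S.scale_right_distrib)
    also have "\<dots> \<in> S.span B" using S.span_diff[OF k S.span_scale[OF g0(1)]] .
    finally have "x - scale q ?m \<in> S.span B" .
    moreover have "x - scale q ?m \<in> M"
      using S.subspace_diff[OF insert.prems(1) x S.subspace_scale[OF insert.prems(1) g0(2)]] .
    ultimately have "x - scale q ?m \<in> S.span F" using F by blast
    then show "x \<in> S.span (insert ?m F)" using S.span_breakdown_eq by blast
  qed
  then show ?case using F g0 by (intro exI[of _ "insert ?m F"]) auto
qed

definition eval_at_var :: "'v \<Rightarrow> 'k::field poly \<Rightarrow> ('v, 'k) mpoly" where
  "eval_at_var v p = poly (map_poly (Poly_Mapping.single 0) p) (Var v)"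

lemma eval_at_var_0 [simp]: "eval_at_var v 0 = 0"
  by (simp add: eval_at_var_def)

lemma eval_at_var_pCons:
  "eval_at_var v (pCons a p) = Poly_Mapping.single 0 a + Var v * eval_at_var v p"
  by (simp add: eval_at_var_def map_poly_pCons)

lemma eval_at_var_add: "eval_at_var v (p + q) = eval_at_var v p + eval_at_var v q"
  by (induction p q rule: poly_induct2) (simp_all add: eval_at_var_pCons single_add algebra_simps)

lemma eval_at_var_smult: "eval_at_var v (smult a p) = Poly_Mapping.single 0 a * eval_at_var v p"
  by (induction p) (simp_all add: eval_at_var_pCons mult_single algebra_simps)

lemma eval_at_var_mult: "eval_at_var v (p * q) = eval_at_var v p * eval_at_var v q"
proof (induction p)
  case (pCons a p)
  have "eval_at_var v (pCons a p * q) = eval_at_var v (smult a q) + eval_at_var v (pCons 0 (p * q))"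
    by (simp add: eval_at_var_add)
  then show ?case using pCons.IH by (simp add: eval_at_var_smult eval_at_var_pCons algebra_simps)
qed simp

lemma eval_at_var_1: "eval_at_var v 1 = 1"
  by (simp add: one_pCons eval_at_var_pCons)

lemma eval_at_var_monom: "eval_at_var v (monom c k) = Poly_Mapping.single (Poly_Mapping.single v k) c"
proof (induction k)
  case (Suc k)
  then show ?case
    by (simp add: monom_Suc eval_at_var_pCons Var_def mult_single single_add[symmetric])
qed (simp add: eval_at_var_pCons monom_0)

lemma module_eval_at_var: "Modules.module (\<lambda>p f. eval_at_var v p * f)"
  by standard (simp_all add: eval_at_var_add eval_at_var_mult eval_at_var_1 algebra_simps)

definition restrict_coeff :: "'v \<Rightarrow> ('v \<Rightarrow>\<^sub>0 nat) \<Rightarrow> 'k::field \<Rightarrow> 'k poly" where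
  "restrict_coeff v m c = (if \<forall>i. i \<noteq> v \<longrightarrow> Poly_Mapping.lookup m i = 0 then monom c (Poly_Mapping.lookup m v) else 0)"

definition restrict_to_var :: "'v \<Rightarrow> ('v, 'k::field) mpoly \<Rightarrow> 'k poly" where
  "restrict_to_var v = linear_sum (restrict_coeff v)"

lemma additive_restrict_coeff: "additive_coeffs (restrict_coeff v)"
  by (auto simp: additive_coeffs_def restrict_coeff_def add_monom)

lemma restrict_to_var_add: "restrict_to_var v (p + q) = restrict_to_var v p + restrict_to_var v q"
  unfolding restrict_to_var_def by (rule linear_sum_add[OF additive_restrict_coeff])

lemma restrict_to_var_diff: "restrict_to_var v (p - q) = restrict_to_var v p - restrict_to_var v q"
  unfolding restrict_to_var_def by (rule linear_sum_diff[OF additive_restrict_coeff])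

lemma restrict_to_var_mult: "restrict_to_var v (p * q) = restrict_to_var v p * restrict_to_var v q"
  unfolding restrict_to_var_def
  by (rule linear_sum_mult[OF additive_restrict_coeff])
    (auto simp: restrict_coeff_def lookup_add mult_monom)

lemma restrict_to_var_single0: "restrict_to_var v (Poly_Mapping.single 0 c) = [:c:]"
  unfolding restrict_to_var_def linear_sum_single[OF additive_restrict_coeff]
  by (simp add: restrict_coeff_def monom_0)

lemma restrict_to_var_Var: "restrict_to_var v (Var v) = [:0, 1:]"
  unfolding restrict_to_var_def Var_def linear_sum_single[OF additive_restrict_coeff]
  by (auto simp: restrict_coeff_def lookup_single when_def monom_Suc monom_0)

lemma restrict_eval: "restrict_to_var v (eval_at_var v p) = p"
proof (induction p)
  case 0
  then show ?case by (simp add: restrict_to_var_def)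
next
  case (pCons a p)
  then show ?case
    by (simp add: eval_at_var_pCons restrict_to_var_add restrict_to_var_mult restrict_to_var_single0 restrict_to_var_Var)
qed

lemma coeff_restrict_to_var:
  fixes f :: "('v, 'k::field) mpoly"
  shows "poly.coeff (restrict_to_var v f) k = Poly_Mapping.lookup f (Poly_Mapping.single v k)"
proof -
  have "m = Poly_Mapping.single v k \<longleftrightarrow> (\<forall>i. i \<noteq> v \<longrightarrow> Poly_Mapping.lookup m i = 0) \<and> Poly_Mapping.lookup m v = k"
    for m :: "'v \<Rightarrow>\<^sub>0 nat"
    by (auto simp: poly_mapping_eq_iff fun_eq_iff lookup_single when_def)
  then have "poly.coeff (restrict_to_var v f) k
    = (\<Sum>m\<in>Poly_Mapping.keys f. if m = Poly_Mapping.single v k then Poly_Mapping.lookup f m else 0)"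
    unfolding restrict_to_var_def linear_sum_def coeff_sum
    by (intro sum.cong) (auto simp: restrict_coeff_def)
  then show ?thesis by (simp add: sum.delta in_keys_iff)
qed

section \<open>The tangent cone as a thickening of the affine line\<close>

text \<open>The variable \<open>v\<close> has strictly smaller weight than all others, so that the powers of \<open>x\<^sub>v\<close> are the
only longest monomials of their weights.\<close>

locale least_weight =
  fixes n :: "'v::finite \<Rightarrow> nat" and v :: 'v
  assumes pos: "n v > 0" and least: "\<And>i. i \<noteq> v \<Longrightarrow> n v < n i"
begin

text \<open>The degree in the variables other than \<open>v\<close>, which are nilpotent on the tangent cone.\<close>

definition codeg :: "('v \<Rightarrow>\<^sub>0 nat) \<Rightarrow> nat" where
  "codeg m = (\<Sum>i\<in>UNIV - {v}. Poly_Mapping.lookup m i)"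

lemma codeg_add: "codeg (a + b) = codeg a + codeg b"
  by (simp add: codeg_def lookup_add sum.distrib)

text \<open>Each variable other than \<open>v\<close> weighs at least one more than \<open>v\<close>.\<close>

lemma weight_ge: "n v * tdeg m + codeg m \<le> weight n m"
proof -
  have "n v * tdeg m + codeg m = n v * Poly_Mapping.lookup m v + (\<Sum>i\<in>UNIV - {v}. Suc (n v) * Poly_Mapping.lookup m i)"
    unfolding tdeg_def codeg_def sum.remove[OF finite UNIV_I, of _ v]
    by (simp add: algebra_simps sum_distrib_left sum.distrib)
  also have "\<dots> \<le> n v * Poly_Mapping.lookup m v + (\<Sum>i\<in>UNIV - {v}. n i * Poly_Mapping.lookup m i)"
    using least by (intro add_left_mono sum_mono mult_right_mono) (auto simp: Suc_le_eq)
  also have "\<dots> = weight n m" unfolding weight_def by (simp add: sum.remove[OF finite UNIV_I, of _ v])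
  finally show ?thesis .
qed

lemma codeg_eq_0_iff: "codeg m = 0 \<longleftrightarrow> m = Poly_Mapping.single v (Poly_Mapping.lookup m v)"
  by (auto simp: codeg_def poly_mapping_eq_iff fun_eq_iff lookup_single when_def)

lemma weight_single: "weight n (Poly_Mapping.single i k) = n i * k"
  by (simp add: weight_def lookup_single when_def if_distrib cong: if_cong)

lemma tdeg_single: "tdeg (Poly_Mapping.single (i::'v) k) = k"
  by (simp add: tdeg_def lookup_single when_def)

lemma longest_single: "longest n (Poly_Mapping.single v k)"
  unfolding longest_def weight_single tdeg_single
proof (intro allI impI)
  fix m assume "weight n m = n v * k"
  then have "n v * tdeg m \<le> n v * k" using weight_ge[of m] by linarith
  then show "tdeg m \<le> k" using pos by simp
qed

lemma longest_eq_single: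
  assumes "weight n m = n v * k" "longest n m"
  shows "m = Poly_Mapping.single v k"
proof -
  have "k \<le> tdeg m"
    using assms(2)[unfolded longest_def, rule_format, of "Poly_Mapping.single v k"] assms(1)
    by (simp add: weight_single tdeg_single)
  then have "n v * k \<le> n v * tdeg m" by simp
  then have "codeg m = 0" using weight_ge[of m] assms(1) by linarith
  then obtain j where "m = Poly_Mapping.single v j" using codeg_eq_0_iff by metis
  then show ?thesis using assms(1) pos by (simp add: weight_single)
qed

text \<open>Setting the variables other than \<open>v\<close> to \<open>0\<close> is well defined on the tangent cone because a power of
\<open>x\<^sub>v\<close> is the only longest monomial of its weight.\<close>

lemma restrict_longest_relations:
  assumes "f \<in> longest_relations n"
  shows "restrict_to_var v f = 0"
proof (rule poly_eqI)
  fix k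
  have "class_sum n (n v * k) f = (\<Sum>m\<in>Poly_Mapping.keys f. if m = Poly_Mapping.single v k then Poly_Mapping.lookup f m else 0)"
    unfolding class_sum_def sum_on_def linear_sum_def
    by (intro sum.cong refl) (use longest_eq_single longest_single weight_single in auto)
  then show "poly.coeff (restrict_to_var v f) k = poly.coeff 0 k"
    using assms by (simp add: coeff_restrict_to_var longest_relations_def sum.delta in_keys_iff split: if_splits)
qed

definition nil_bound :: nat where "nil_bound = CARD('v) * n v"

text \<open>By the pigeonhole principle some variable other than \<open>v\<close> occurs with an exponent of at least \<open>n v\<close>.\<close>

lemma not_longest_of_codeg:
  assumes "nil_bound \<le> codeg m"
  shows "\<not> longest n m"
proof -
  have "\<exists>i. i \<noteq> v \<and> n v \<le> Poly_Mapping.lookup m i"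
  proof (rule ccontr)
    assume "\<not> ?thesis"
    then have "codeg m \<le> of_nat (card (UNIV - {v})) * (n v - 1)"
      unfolding codeg_def by (intro sum_bounded_above) (metis DiffE Suc_pred' insertI1 less_Suc_eq_le not_le pos)
    also have "\<dots> = (CARD('v) - 1) * (n v - 1)" by simp
    also have "\<dots> < CARD('v) * n v" using pos by (intro mult_strict_mono) auto
    finally show False using assms by (simp add: nil_bound_def)
  qed
  then obtain i where i: "i \<noteq> v" "n v \<le> Poly_Mapping.lookup m i" by blast
  \<comment> \<open>\<open>n v\<close> copies of \<open>x\<^sub>i\<close> weigh as much as \<open>n i > n v\<close> copies of \<open>x\<^sub>v\<close>.\<close>
  let ?r = "m - Poly_Mapping.single i (n v)"
  have m: "m = ?r + Poly_Mapping.single i (n v)"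
    by (rule poly_mapping_eqI) (use i in \<open>auto simp: lookup_add lookup_minus lookup_single when_def\<close>)
  let ?m' = "?r + Poly_Mapping.single v (n i)"
  have "weight n ?m' = weight n m" by (subst (2) m) (simp add: weight_add weight_single)
  moreover have "tdeg m < tdeg ?m'" by (subst m) (use least[OF i(1)] in \<open>simp add: tdeg_add tdeg_single\<close>)
  ultimately show ?thesis unfolding longest_def by (metis not_le)
qed

lemma high_codeg_in_longest_relations:
  assumes "\<And>m. m \<in> Poly_Mapping.keys f \<Longrightarrow> nil_bound \<le> codeg m"
  shows "f \<in> longest_relations n"
  unfolding longest_relations_def class_sum_def
  by (auto intro!: sum_on_eq_zero dest: assms not_longest_of_codeg)

lemma codeg_power:
  assumes "\<And>m. m \<in> Poly_Mapping.keys f \<Longrightarrow> 1 \<le> codeg m"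
  shows "m \<in> Poly_Mapping.keys (f ^ N) \<Longrightarrow> N \<le> codeg m"
proof (induction N arbitrary: m)
  case (Suc N)
  then obtain a b where "m = a + b" "a \<in> Poly_Mapping.keys f" "b \<in> Poly_Mapping.keys (f ^ N)"
    using keys_mult[of f "f ^ N"] by auto
  then show ?case using assms[of a] Suc.IH[of b] by (simp add: codeg_add)
qed simp

lemma nilpotent_of_restrict_eq_0:
  fixes f :: "('v, 'k::field) mpoly"
  assumes "restrict_to_var v f = 0"
  shows "f ^ nil_bound \<in> longest_relations n"
proof (rule high_codeg_in_longest_relations)
  have "1 \<le> codeg m" if m: "m \<in> Poly_Mapping.keys f" for m
  proof (rule ccontr)
    assume "\<not> ?thesis"
    then have "m = Poly_Mapping.single v (Poly_Mapping.lookup m v)" using codeg_eq_0_iff[of m] by simp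
    then have "poly.coeff (restrict_to_var v f) (Poly_Mapping.lookup m v) = Poly_Mapping.lookup f m"
      by (metis coeff_restrict_to_var)
    then show False using assms m by (simp add: in_keys_iff)
  qed
  then show "nil_bound \<le> codeg m" if "m \<in> Poly_Mapping.keys (f ^ nil_bound)" for m
    using codeg_power that by blast
qed

definition low_monomials :: "('v, 'k::field) mpoly set" where
  "low_monomials = (\<lambda>m. Poly_Mapping.single m 1) ` {m. Poly_Mapping.lookup m v = 0 \<and> codeg m < nil_bound}"

lemma finite_low_monomials: "finite (low_monomials :: ('v, 'k::field) mpoly set)"
proof -
  have "finite (Poly_Mapping.lookup ` {m. Poly_Mapping.lookup m v = 0 \<and> codeg m < nil_bound})"
  proof (rule finite_subset)
    show "Poly_Mapping.lookup ` {m. Poly_Mapping.lookup m v = 0 \<and> codeg m < nil_bound} \<subseteq> UNIV \<rightarrow>\<^sub>E {..nil_bound}"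
    proof
      fix g assume "g \<in> Poly_Mapping.lookup ` {m. Poly_Mapping.lookup m v = 0 \<and> codeg m < nil_bound}"
      then obtain m where m: "Poly_Mapping.lookup m v = 0" "codeg m < nil_bound" and g: "g = Poly_Mapping.lookup m"
        by blast
      have "g i \<le> nil_bound" for i
      proof (cases "i = v")
        case False
        then have "g i \<le> codeg m" unfolding codeg_def g by (intro member_le_sum) auto
        then show ?thesis using m by simp
      qed (use m g in simp)
      then show "g \<in> UNIV \<rightarrow>\<^sub>E {..nil_bound}" by auto
    qed
  qed (auto intro: finite_PiE)
  then have "finite {m. Poly_Mapping.lookup m v = 0 \<and> codeg m < nil_bound}"
    by (rule finite_imageD) (simp add: inj_on_def lookup_inject)
  then show ?thesis by (simp add: low_monomials_def)
qed

text \<open>The tangent cone is a finitely generated module over \<open>K[x\<^sub>v]\<close>.\<close>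

lemma span_low_monomials:
  fixes f :: "('v, 'k::field) mpoly"
  shows "\<exists>g. g \<in> Modules.module.span (\<lambda>p f. eval_at_var v p * f) low_monomials \<and> f - g \<in> longest_relations n"
proof -
  interpret S: Modules.module "\<lambda>p f :: ('v, 'k) mpoly. eval_at_var v p * f" by (rule module_eval_at_var)
  let ?t = "\<lambda>m. Poly_Mapping.single m (Poly_Mapping.lookup f m)"
  let ?K = "{m \<in> Poly_Mapping.keys f. codeg m < nil_bound}"
  have low: "Poly_Mapping.single m c \<in> S.span low_monomials" if m: "codeg m < nil_bound" for m c
  proof -
    let ?r = "m - Poly_Mapping.single v (Poly_Mapping.lookup m v)"
    have m': "m = Poly_Mapping.single v (Poly_Mapping.lookup m v) + ?r"
      by (rule poly_mapping_eqI) (auto simp: lookup_add lookup_minus lookup_single when_def)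
    have "codeg ?r = codeg m" unfolding codeg_def
      by (intro sum.cong) (auto simp: lookup_minus lookup_single when_def)
    then have "Poly_Mapping.single ?r 1 \<in> S.span low_monomials"
      using m by (intro S.span_base) (auto simp: low_monomials_def lookup_minus)
    then have "eval_at_var v (monom c (Poly_Mapping.lookup m v)) * Poly_Mapping.single ?r 1 \<in> S.span low_monomials"
      by (rule S.span_scale)
    then show ?thesis using m' by (simp add: eval_at_var_monom mult_single)
  qed
  have split: "f = (\<Sum>m\<in>Poly_Mapping.keys f - ?K. ?t m) + (\<Sum>m\<in>?K. ?t m)"
    by (subst mpoly_as_sum[of f], rule sum.subset_diff) auto
  have "f - (\<Sum>m\<in>?K. ?t m) = (\<Sum>m\<in>Poly_Mapping.keys f - ?K. ?t m)"
    by (rule diff_eq_eq[THEN iffD2, OF split])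
  also have "\<dots> \<in> longest_relations n"
    by (intro ideal_sum_mem[OF ideal_longest_relations] high_codeg_in_longest_relations)
      (auto split: if_splits)
  finally show ?thesis
    by (intro exI[of _ "\<Sum>m\<in>?K. ?t m"] conjI S.span_sum low) auto
qed

abbreviation relations :: "('v, 'k::field) mpoly set" where
  "relations \<equiv> longest_relations n"

text \<open>The value at a residue class is taken at a chosen representative; it is the same for all of them.\<close>

definition residue_restrict :: "('v, 'k::field) mpoly set \<Rightarrow> 'k poly" where
  "residue_restrict C = restrict_to_var v (SOME f. residue relations f = C)"

lemma restrict_at_residue: "residue_restrict (residue relations f) = restrict_to_var v f"
proof -
  let ?g = "SOME g. residue relations g = residue relations f"
  have "residue relations ?g = residue relations f" by (rule someI[of _ f]) simp
  then have "?g - f \<in> relations" using residue_ring(7)[OF ideal_longest_relations] by blast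
  then have "restrict_to_var v (?g - f) = 0" by (rule restrict_longest_relations)
  then show ?thesis by (simp add: residue_restrict_def restrict_to_var_diff)
qed

text \<open>An ideal of the tangent cone is a submodule of a finitely generated module over the principal ideal
domain \<open>K[x\<^sub>v]\<close>.\<close>

lemma noetherian_quotient:
  "noetherian_ring ((mpoly_ring :: ('v, 'k::field) mpoly ring) Quot relations)"
proof -
  let ?P = "mpoly_ring :: ('v, 'k) mpoly ring"
  let ?L = "relations :: ('v, 'k) mpoly set"
  let ?R = "?P Quot ?L"
  have L: "ideal ?L ?P" by (rule ideal_longest_relations)
  note res = residue_ring[OF L]
  interpret R: cring ?R by (rule res(1))
  interpret S: Modules.module "\<lambda>p f :: ('v, 'k) mpoly. eval_at_var v p * f" by (rule module_eval_at_var)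
  show ?thesis
  proof (rule R.noetherian_ringI)
    fix K assume K: "ideal K ?R"
    interpret K: ideal K ?R by (rule K)
    let ?J = "{f. residue ?L f \<in> K}"
    have J: "ideal ?J ?P" by (rule ideal_vimage_residue[OF L K])
    have sub: "S.subspace T" if "ideal T ?P" for T
      using that unfolding ideal_type_ring_iff S.subspace_def by blast
    obtain F where F: "F \<subseteq> ?J \<inter> S.span low_monomials" "finite F" "?J \<inter> S.span low_monomials \<subseteq> S.span F"
      using submodule_finitely_generated[OF module_eval_at_var finite_low_monomials
          S.subspace_inter[OF sub[OF J] S.subspace_span[of low_monomials]]] by blast
    let ?A = "residue ?L ` F"
    have A: "?A \<subseteq> carrier ?R" by (auto simp: res(2))
    let ?I = "Idl\<^bsub>?R\<^esub> ?A"
    have I: "ideal ?I ?R" by (rule R.genideal_ideal[OF A])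
    have "K \<subseteq> ?I"
    proof
      fix c assume c: "c \<in> K"
      then obtain f where f: "c = residue ?L f" using K.Icarr res(2) by auto
      obtain g where g: "g \<in> S.span low_monomials" "f - g \<in> ?L" using span_low_monomials[of f] by blast
      then have cg: "c = residue ?L g" using res(7) f by simp
      then have "g \<in> S.span F" using g c F by blast
      moreover have "S.span F \<subseteq> {f. residue ?L f \<in> ?I}"
        by (rule S.span_minimal[OF _ sub[OF ideal_vimage_residue[OF L I]]])
          (use R.genideal_self[OF A] in auto)
      ultimately show "c \<in> ?I" using cg by blast
    qed
    moreover have "?I \<subseteq> K" by (rule R.genideal_minimal[OF K]) (use F in auto)
    ultimately show "\<exists>A\<subseteq>carrier ?R. finite A \<and> K = Idl\<^bsub>?R\<^esub> A"
      using A F(2) by (intro exI[of _ ?A]) auto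
  qed
qed

lemma nil_thickening_quotient:
  "nil_thickening ((mpoly_ring :: ('v, 'k::field) mpoly ring) Quot relations) residue_restrict"
proof -
  let ?P = "mpoly_ring :: ('v, 'k) mpoly ring"
  let ?L = "relations :: ('v, 'k) mpoly set"
  have L: "ideal ?L ?P" by (rule ideal_longest_relations)
  note res = residue_ring[OF L]
  have zero: "residue ?L f = \<zero>\<^bsub>?P Quot ?L\<^esub> \<longleftrightarrow> f \<in> ?L" for f
    using res(7)[of f 0] by (simp add: res(6))
  show ?thesis
  proof (rule nil_thickening.intro[OF res(1) nil_thickening_axioms.intro])
    show "noetherian_ring (?P Quot ?L)" by (rule noetherian_quotient)
    fix a b assume "a \<in> carrier (?P Quot ?L)" "b \<in> carrier (?P Quot ?L)"
    then obtain f g where [simp]: "a = residue ?L f" "b = residue ?L g" by (auto simp: res(2))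
    show "residue_restrict (a \<oplus>\<^bsub>?P Quot ?L\<^esub> b) = residue_restrict a + residue_restrict b"
      by (simp add: res(4) restrict_at_residue restrict_to_var_add)
    show "residue_restrict (a \<otimes>\<^bsub>?P Quot ?L\<^esub> b) = residue_restrict a * residue_restrict b"
      by (simp add: res(3) restrict_at_residue restrict_to_var_mult)
  next
    show "residue_restrict \<one>\<^bsub>?P Quot ?L\<^esub> = 1"
      using restrict_to_var_single0[of v 1] by (simp add: res(5) restrict_at_residue one_pCons)
    show "\<exists>a\<in>carrier (?P Quot ?L). residue_restrict a = p" for p
      by (rule bexI[of _ "residue ?L (eval_at_var v p)"]) (simp_all add: res(2) restrict_at_residue restrict_eval)
    fix a assume "a \<in> carrier (?P Quot ?L)" and a0: "residue_restrict a = 0"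
    then obtain f where f: "a = residue ?L f" by (auto simp: res(2))
    then have "f ^ nil_bound \<in> ?L" using nilpotent_of_restrict_eq_0 a0 by (simp add: restrict_at_residue)
    then have "a [^]\<^bsub>?P Quot ?L\<^esub> nil_bound = \<zero>\<^bsub>?P Quot ?L\<^esub>"
      unfolding f residue_pow[OF L] zero .
    then show "\<exists>N::nat. a [^]\<^bsub>?P Quot ?L\<^esub> N = \<zero>\<^bsub>?P Quot ?L\<^esub>" ..
  qed
qed

section \<open>Cohen-Macaulayness and longest factorizations\<close>

text \<open>In terms of the semigroup: adding \<open>n v\<close> increases the maximal length of a factorization by
exactly one.\<close>

definition shift_preserves_longest :: bool where
  "shift_preserves_longest \<longleftrightarrow> (\<forall>m. longest n m \<longrightarrow> longest n (Poly_Mapping.single v 1 + m))"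

text \<open>Multiplication by \<open>x\<^sub>v\<close> is then injective on the basis elements of the tangent cone.\<close>

lemma class_sum_Var_mult:
  assumes "shift_preserves_longest"
  shows "class_sum n r (Var v * g) = (if n v \<le> r then class_sum n (r - n v) g else 0)"
proof (cases "n v \<le> r")
  case True
  have "weight n (Poly_Mapping.single v 1 + m) = r \<and> longest n (Poly_Mapping.single v 1 + m) \<longleftrightarrow>
      weight n m = r - n v \<and> longest n m" for m
    using assms longest_addD[of n "Poly_Mapping.single v 1" m] True
    by (auto simp: shift_preserves_longest_def weight_add weight_single)
  then show ?thesis using True unfolding class_sum_def Var_def sum_on_monomial_mult by simp
next
  case False
  then show ?thesis unfolding class_sum_def Var_def sum_on_monomial_mult
    by (subst sum_on_eq_zero) (auto simp: weight_add weight_single)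
qed

lemma class_sum_const_mult: "class_sum n r (Poly_Mapping.single 0 c * g) = c * class_sum n r g"
  unfolding class_sum_def sum_on_monomial_mult by simp

lemma class_sum_add: "class_sum n r (f + g) = class_sum n r f + class_sum n r g"
  by (simp add: class_sum_def sum_on_add)

lemma class_sum_eval_eq_0:
  assumes "shift_preserves_longest" "\<And>t. t \<le> s \<Longrightarrow> class_sum n t f = 0"
  shows "t \<le> s \<Longrightarrow> class_sum n t (eval_at_var v p * f) = 0"
proof (induction p arbitrary: t)
  case 0
  then show ?case by (simp add: class_sum_def sum_on_def)
next
  case (pCons a p)
  have "eval_at_var v (pCons a p) * f = Poly_Mapping.single 0 a * f + Var v * (eval_at_var v p * f)"
    by (simp add: eval_at_var_pCons algebra_simps)
  then show ?case
    using assms(2) pCons.prems pCons.IH[of "t - n v"]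
    by (simp add: class_sum_add class_sum_const_mult class_sum_Var_mult[OF assms(1)])
qed

text \<open>The lowest coordinate of \<open>f\<close> times the lowest coefficient of \<open>p\<close> cannot cancel in \<open>p(x\<^sub>v) f\<close>.\<close>

lemma eval_at_var_regular:
  fixes f :: "('v, 'k::field) mpoly"
  assumes ext: "shift_preserves_longest" and p: "p \<noteq> 0" and mem: "eval_at_var v p * f \<in> relations"
  shows "f \<in> relations"
  using p mem
proof (induction p)
  case 0
  then show ?case by simp
next
  case (pCons a p)
  let ?g = "eval_at_var v p * f"
  have "eval_at_var v (pCons a p) * f = Poly_Mapping.single 0 a * f + Var v * ?g"
    by (simp add: eval_at_var_pCons algebra_simps)
  then have eq: "a * class_sum n r f + (if n v \<le> r then class_sum n (r - n v) ?g else 0) = 0" for r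
    using pCons.prems(2)
    by (simp add: longest_relations_def class_sum_add class_sum_const_mult class_sum_Var_mult[OF ext])
  show ?case
  proof (cases "a = 0")
    case True
    have "class_sum n r ?g = 0" for r using eq[of "r + n v"] True by simp
    then have "?g \<in> relations" by (simp add: longest_relations_def)
    then show ?thesis using pCons True by simp
  next
    case False
    have "class_sum n r f = 0" for r
    proof (induction r rule: less_induct)
      case (less r)
      show ?case
      proof (cases "n v \<le> r")
        case True
        have "class_sum n (r - n v) ?g = 0"
          by (rule class_sum_eval_eq_0[OF ext, of "r - n v"]) (use less True pos in auto)
        then show ?thesis using eq[of r] False True by simp
      next
        case nle: False
        then show ?thesis using eq[of r] False by simp
      qed
    qed
    then show ?thesis by (simp add: longest_relations_def)
  qed
qed

text \<open>Among the longest monomials whose product with \<open>x\<^sub>v\<close> is not longest, the degree in the other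
variables is bounded.  One for which this degree is maximal is annihilated by all variables.\<close>

lemma socle_monomial:
  assumes "\<not> shift_preserves_longest"
  shows "\<exists>m. longest n m \<and> (\<forall>i. \<not> longest n (Poly_Mapping.single i 1 + m))"
proof -
  let ?P = "\<lambda>m. longest n m \<and> \<not> longest n (Poly_Mapping.single v 1 + m)"
  obtain m0 where "?P m0" using assms by (auto simp: shift_preserves_longest_def)
  moreover have "\<forall>m. ?P m \<longrightarrow> codeg m < nil_bound" using not_longest_of_codeg not_le by blast
  ultimately obtain m where m: "?P m" "\<And>m'. ?P m' \<Longrightarrow> codeg m' \<le> codeg m"
    using ex_has_greatest_nat[of ?P m0 codeg nil_bound] by blast
  have "\<not> longest n (Poly_Mapping.single i 1 + m)" for i
  proof (cases "i = v")
    case False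
    show ?thesis
    proof
      assume l: "longest n (Poly_Mapping.single i 1 + m)"
      have "\<not> longest n (Poly_Mapping.single v 1 + (Poly_Mapping.single i 1 + m))"
        using m(1) longest_addD[of n "Poly_Mapping.single i 1" "Poly_Mapping.single v 1 + m"]
        by (auto simp: ac_simps)
      then have "codeg (Poly_Mapping.single i 1 + m) \<le> codeg m" using m(2) l by blast
      moreover have "codeg (Poly_Mapping.single i 1) \<noteq> 0"
        using False by (simp add: codeg_def lookup_single when_def)
      ultimately show False by (simp add: codeg_add)
    qed
  qed (use m in simp)
  then show ?thesis using m(1) by blast
qed

lemma socle_annihilated:
  fixes f :: "('v, 'k::field) mpoly"
  assumes m: "\<And>i. \<not> longest n (Poly_Mapping.single i 1 + m)" and f: "Poly_Mapping.lookup f 0 = 0"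
  shows "f * Poly_Mapping.single m 1 \<in> relations"
proof -
  have "\<not> longest n (m + k)" if k: "k \<in> Poly_Mapping.keys f" for k
  proof
    assume l: "longest n (m + k)"
    have "k \<noteq> 0" using k f by (auto simp: in_keys_iff)
    then obtain i where i: "Poly_Mapping.lookup k i \<noteq> 0" by (metis lookup_zero poly_mapping_eqI)
    have "k = Poly_Mapping.single i 1 + (k - Poly_Mapping.single i 1)"
      by (rule poly_mapping_eqI) (use i in \<open>auto simp: lookup_add lookup_minus lookup_single when_def\<close>)
    then have "m + k = (k - Poly_Mapping.single i 1) + (Poly_Mapping.single i 1 + m)" by (metis add.assoc add.commute)
    then show False using m longest_addD l by metis
  qed
  then have "sum_on {k. weight n (m + k) = s \<and> longest n (m + k)} f = 0" for s
    by (intro sum_on_eq_zero) auto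
  then have "class_sum n s (Poly_Mapping.single m 1 * f) = 0" for s
    unfolding class_sum_def sum_on_monomial_mult by simp
  then show ?thesis by (simp add: longest_relations_def mult.commute)
qed

text \<open>For every maximal ideal \<open>M\<close> there is a nonzero polynomial \<open>p\<close> with \<open>p(x\<^sub>v) \<in> M\<close>, and it is a
nonzerodivisor even before localizing.\<close>

lemma cohen_macaulay_if_shift:
  assumes ext: "shift_preserves_longest"
  shows "cohen_macaulay_ring ((mpoly_ring :: ('v, 'k::field) mpoly ring) Quot relations)"
proof -
  let ?P = "mpoly_ring :: ('v, 'k) mpoly ring"
  let ?L = "relations :: ('v, 'k) mpoly set"
  let ?R = "?P Quot ?L"
  have L: "ideal ?L ?P" by (rule ideal_longest_relations)
  note res = residue_ring[OF L]
  have zero: "residue ?L f = \<zero>\<^bsub>?R\<^esub> \<longleftrightarrow> f \<in> ?L" for f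
    using res(7)[of f 0] by (simp add: res(6))
  interpret R: nil_thickening ?R residue_restrict by (rule nil_thickening_quotient)
  show ?thesis
    unfolding R.cohen_macaulay_iff
  proof (intro allI impI)
    fix M assume max: "maximalideal M ?R"
    have M: "primeideal M ?R" by (rule R.maximalideal_prime[OF max])
    obtain c where c: "c \<in> M" "residue_restrict c \<noteq> 0" using R.maximalideal_has_nonzero[OF max] by blast
    define p where "p = residue_restrict c"
    let ?a = "residue ?L (eval_at_var v p)"
    have "residue_restrict ?a = p" by (simp add: restrict_at_residue restrict_eval)
    then have a: "?a \<in> M"
      using R.primeideal_mem_iff[OF M, of ?a] imageI[OF c(1), of residue_restrict] by (simp add: p_def res(2))
    have "u \<otimes>\<^bsub>?R\<^esub> b = \<zero>\<^bsub>?R\<^esub>"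
      if u: "u \<in> carrier ?R" and b: "b \<in> carrier ?R" and ab: "u \<otimes>\<^bsub>?R\<^esub> (?a \<otimes>\<^bsub>?R\<^esub> b) = \<zero>\<^bsub>?R\<^esub>" for u b
    proof -
      obtain h g where [simp]: "u = residue ?L h" "b = residue ?L g" using u b by (auto simp: res(2))
      have "h * (eval_at_var v p * g) \<in> ?L" using ab by (simp add: res(3) zero)
      then have "eval_at_var v p * (h * g) \<in> ?L" by (simp add: ac_simps)
      then have "h * g \<in> ?L" using eval_at_var_regular[OF ext] c(2) p_def by blast
      then show ?thesis by (simp add: res(3) zero)
    qed
    then show "\<exists>a\<in>M. \<forall>b\<in>carrier ?R. (\<exists>u\<in>carrier ?R - M. u \<otimes>\<^bsub>?R\<^esub> (a \<otimes>\<^bsub>?R\<^esub> b) = \<zero>\<^bsub>?R\<^esub>) \<longrightarrow>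
        (\<exists>u\<in>carrier ?R - M. u \<otimes>\<^bsub>?R\<^esub> b = \<zero>\<^bsub>?R\<^esub>)"
      using a by (intro bexI[of _ ?a]) auto
  qed
qed

text \<open>At the origin a longest monomial that is annihilated by all variables shows that the maximal ideal
has no nonzerodivisor: a multiplier \<open>h\<close> outside the maximal ideal has constant term \<open>k \<noteq> 0\<close> and acts on
this monomial as the scalar \<open>k\<close>.\<close>

lemma shift_if_cohen_macaulay:
  assumes cm: "cohen_macaulay_ring ((mpoly_ring :: ('v, 'k::field) mpoly ring) Quot relations)"
  shows "shift_preserves_longest"
proof (rule ccontr)
  assume "\<not> shift_preserves_longest"
  then obtain m where m: "longest n m" "\<And>i. \<not> longest n (Poly_Mapping.single i 1 + m)"
    using socle_monomial by blast
  let ?P = "mpoly_ring :: ('v, 'k) mpoly ring"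
  let ?L = "relations :: ('v, 'k) mpoly set"
  let ?R = "?P Quot ?L"
  have L: "ideal ?L ?P" by (rule ideal_longest_relations)
  note res = residue_ring[OF L]
  have zero: "residue ?L f = \<zero>\<^bsub>?R\<^esub> \<longleftrightarrow> f \<in> ?L" for f
    using res(7)[of f 0] by (simp add: res(6))
  interpret R: nil_thickening ?R residue_restrict by (rule nil_thickening_quotient)
  let ?M = "{c \<in> carrier ?R. poly.coeff (residue_restrict c) 0 = 0}"
  have mem: "residue ?L f \<in> ?M \<longleftrightarrow> Poly_Mapping.lookup f 0 = 0" for f
    by (simp add: res(2) restrict_at_residue coeff_restrict_to_var)
  have M: "ideal ?M ?R"
    by (rule R.ideal_of_closed) (auto simp: R.phi_zero R.phi_add R.phi_mult coeff_mult_0)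
  have max: "maximalideal ?M ?R"
  proof (rule maximalidealI[OF M])
    have "residue ?L 1 \<notin> ?M" unfolding mem by simp
    then show "carrier ?R \<noteq> ?M" by (auto simp: res(2))
    fix K assume K: "ideal K ?R" "?M \<subseteq> K" "K \<subseteq> carrier ?R"
    interpret K: ideal K ?R by (rule K)
    show "K = ?M \<or> K = carrier ?R"
    proof (rule disjCI)
      assume ne: "K \<noteq> carrier ?R"
      have "c \<in> ?M" if c: "c \<in> K" for c
      proof (rule ccontr)
        assume cM: "c \<notin> ?M"
        obtain f where f: "c = residue ?L f" using c K(3) by (auto simp: res(2))
        let ?k = "Poly_Mapping.lookup f 0"
        have k: "?k \<noteq> 0" using cM unfolding f mem .
        \<comment> \<open>The constant term of \<open>?g\<close> vanishes, so \<open>1\<close> is an element of \<open>?M\<close> plus a multiple of \<open>c\<close>.\<close>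
        let ?g = "1 - Poly_Mapping.single 0 (inverse ?k) * f"
        have "Poly_Mapping.lookup (Poly_Mapping.single 0 (inverse ?k) * f) 0 = inverse ?k * ?k"
          by (simp add: mult_map_scale_conv_mult[symmetric] Poly_Mapping.map.rep_eq when_def)
        then have "Poly_Mapping.lookup ?g 0 = 0" using k by (simp add: lookup_minus)
        then have "residue ?L ?g \<in> K" using mem[of ?g] K(2) by blast
        moreover have "residue ?L (Poly_Mapping.single 0 (inverse ?k)) \<otimes>\<^bsub>?R\<^esub> c \<in> K"
          by (rule K.I_l_closed[OF c]) (simp add: res(2))
        ultimately have "residue ?L ?g \<oplus>\<^bsub>?R\<^esub> (residue ?L (Poly_Mapping.single 0 (inverse ?k)) \<otimes>\<^bsub>?R\<^esub> c) \<in> K"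
          by (rule additive_subgroup.a_closed[OF K.is_additive_subgroup])
        then have "\<one>\<^bsub>?R\<^esub> \<in> K" by (simp add: f res(3-5))
        then show False using ne K.one_imp_carrier by simp
      qed
      then show "K = ?M" using K(2) by blast
    qed
  qed
  let ?b = "residue ?L (Poly_Mapping.single m 1)"
  have one: "residue ?L 1 \<in> carrier ?R - ?M"
    using mem[of 1] by (simp add: res(2))
  have kill: "\<one>\<^bsub>?R\<^esub> \<otimes>\<^bsub>?R\<^esub> (a \<otimes>\<^bsub>?R\<^esub> ?b) = \<zero>\<^bsub>?R\<^esub>" if a: "a \<in> ?M" for a
  proof -
    obtain f where f: "a = residue ?L f" using a by (auto simp: res(2))
    have "Poly_Mapping.lookup f 0 = 0" using a unfolding f mem .
    then show ?thesis using socle_annihilated[OF m(2)] by (simp add: f res(3,5) zero)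
  qed
  obtain a where a: "a \<in> ?M" and "\<forall>b\<in>carrier ?R. (\<exists>u\<in>carrier ?R - ?M. u \<otimes>\<^bsub>?R\<^esub> (a \<otimes>\<^bsub>?R\<^esub> b) = \<zero>\<^bsub>?R\<^esub>) \<longrightarrow>
        (\<exists>u\<in>carrier ?R - ?M. u \<otimes>\<^bsub>?R\<^esub> b = \<zero>\<^bsub>?R\<^esub>)"
    using cm max unfolding R.cohen_macaulay_iff by blast
  moreover have "?b \<in> carrier ?R" by (simp add: res(2))
  ultimately obtain u where u: "u \<in> carrier ?R - ?M" "u \<otimes>\<^bsub>?R\<^esub> ?b = \<zero>\<^bsub>?R\<^esub>"
    using kill[OF a] one unfolding res(5) by blast
  then obtain h where h: "u = residue ?L h" by (auto simp: res(2))
  let ?k = "Poly_Mapping.lookup h 0"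
  have k: "?k \<noteq> 0" using u(1) mem[of h] unfolding h by blast
  have h1: "h * Poly_Mapping.single m 1 \<in> ?L" using u(2) by (simp add: h res(3) zero)
  have "Poly_Mapping.lookup (h - Poly_Mapping.single 0 ?k) 0 = 0" by (simp add: lookup_minus)
  then have h2: "(h - Poly_Mapping.single 0 ?k) * Poly_Mapping.single m 1 \<in> ?L"
    by (rule socle_annihilated[OF m(2)])
  have "h * Poly_Mapping.single m 1 - (h - Poly_Mapping.single 0 ?k) * Poly_Mapping.single m 1 \<in> ?L"
    by (rule ideal_diff_mem[OF L h1 h2])
  then have "Poly_Mapping.single m ?k \<in> ?L" by (simp add: algebra_simps mult_single)
  then have "class_sum n (weight n m) (Poly_Mapping.single m ?k) = 0" by (simp add: longest_relations_def)
  then show False using m(1) k by (simp add: class_sum_def sum_on_single)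
qed

theorem cohen_macaulay_tangent_cone_iff:
  "cohen_macaulay_tangent_cone TYPE('k::field) n \<longleftrightarrow> shift_preserves_longest"
  unfolding cohen_macaulay_tangent_cone_def initial_ideal_curve_ideal
  using cohen_macaulay_if_shift shift_if_cohen_macaulay by blast

text \<open>If multiplication by \<open>x\<^sub>v\<close> keeps a longest monomial \<open>w'\<close> longest, then \<open>x\<^sub>v w'\<close> is at least as long as
every monomial of its weight.  Conversely, a monomial of the weight of \<open>x\<^sub>v m\<close> that is longer than
\<open>x\<^sub>v m\<close> may be taken to be divisible by \<open>x\<^sub>v\<close>, and dividing by \<open>x\<^sub>v\<close> shows that \<open>m\<close> is not longest.\<close>

lemma shift_preserves_longest_iff:
  assumes npos: "\<And>i. n i > 0"
  shows "shift_preserves_longest \<longleftrightarrow> (\<forall>m m'. Poly_Mapping.lookup m v = 0 \<and> weight n m' = weight n m \<and> 0 < Poly_Mapping.lookup m' v \<longrightarrow>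
    (\<exists>m''. weight n m'' = weight n m \<and> 0 < Poly_Mapping.lookup m'' v \<and> tdeg m \<le> tdeg m''))"
    (is "_ \<longleftrightarrow> ?R")
proof
  have split: "\<exists>w. m = Poly_Mapping.single v 1 + w" if "0 < Poly_Mapping.lookup m v" for m :: "'v \<Rightarrow>\<^sub>0 nat"
  proof
    show "m = Poly_Mapping.single v 1 + (m - Poly_Mapping.single v 1)"
      by (rule poly_mapping_eqI) (use that in \<open>auto simp: lookup_add lookup_minus lookup_single when_def\<close>)
  qed
  have lk: "0 < Poly_Mapping.lookup (Poly_Mapping.single v 1 + w) v" for w :: "'v \<Rightarrow>\<^sub>0 nat"
    by (simp add: lookup_add)
  {
    assume ext: "shift_preserves_longest"
    show ?R
    proof (intro allI impI, elim conjE)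
      fix m m' assume m: "weight n m' = weight n m" "0 < Poly_Mapping.lookup m' v"
      obtain w where w: "m' = Poly_Mapping.single v 1 + w" using split m by blast
      obtain w' where w': "weight n w' = weight n w" "longest n w'" using longest_exists npos by blast
      let ?m = "Poly_Mapping.single v 1 + w'"
      have wt: "weight n ?m = weight n m" using w w' m(1) by (simp add: weight_add)
      have "longest n ?m" using ext w' by (auto simp: shift_preserves_longest_def)
      then show "\<exists>m''. weight n m'' = weight n m \<and> 0 < Poly_Mapping.lookup m'' v \<and> tdeg m \<le> tdeg m''"
        using wt lk unfolding longest_def by metis
    qed
  next
    assume R: ?R
    show "shift_preserves_longest"
      unfolding shift_preserves_longest_def
    proof (intro allI impI)
      fix m assume m: "longest n m"
      show "longest n (Poly_Mapping.single v 1 + m)"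
        unfolding longest_def
      proof (intro allI impI)
        fix m' assume m': "weight n m' = weight n (Poly_Mapping.single v 1 + m)"
        have "\<exists>m''. weight n m'' = weight n m' \<and> 0 < Poly_Mapping.lookup m'' v \<and> tdeg m' \<le> tdeg m''"
        proof (cases "0 < Poly_Mapping.lookup m' v")
          case False
          then show ?thesis using R m' lk by (metis gr0I)
        qed auto
        then obtain w where w: "weight n (Poly_Mapping.single v 1 + w) = weight n m'"
          "tdeg m' \<le> tdeg (Poly_Mapping.single v 1 + w)" using split by metis
        then have "weight n w = weight n m" using m' by (simp add: weight_add)
        then show "tdeg m' \<le> tdeg (Poly_Mapping.single v 1 + m)"
          using m w(2) by (fastforce simp: longest_def tdeg_add)
      qed
    qed
  }
qed

end

section \<open>Classes of monomials of equal weight\<close>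

text \<open>The numerical data of the five generators: \<open>p < q < r < s\<close> are the weights of the variables, and
\<open>rel1\<close>, \<dots>, \<open>rel5\<close> say that the generators are homogeneous for them.\<close>

locale bresinsky_exponents =
  fixes p q r s :: nat
    and a1 a2 a3 a4 a13 a14 a21 a23 a32 a34 a41 a42 :: nat
  assumes order: "0 < p" "p < q" "q < r" "r < s"
    and pos: "0 < a21" "0 < a41" "0 < a32" "0 < a42" "0 < a13" "0 < a23" "0 < a14" "0 < a34"
    and sums: "a1 = a21 + a41" "a2 = a32 + a42" "a3 = a13 + a23" "a4 = a14 + a34"
    and rel1: "a1 * p = a13 * r + a14 * s"
    and rel2: "a2 * q = a21 * p + a23 * r"
    and rel3: "a3 * r = a32 * q + a34 * s"
    and rel4: "a4 * s = a41 * p + a42 * q"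
    and rel5: "a21 * p + a34 * s = a42 * q + a13 * r"
    and le: "a42 \<le> a32"
begin

text \<open>A predicate on exponent vectors that is invariant under replacing one monomial of a generator by the
other one inside a larger monomial.\<close>

definition move_closed :: "(nat \<Rightarrow> nat \<Rightarrow> nat \<Rightarrow> nat \<Rightarrow> bool) \<Rightarrow> bool" where
  "move_closed Q \<longleftrightarrow> (\<forall>a b c d.
     (Q (a + a1) b c d \<longleftrightarrow> Q a b (c + a13) (d + a14)) \<and>
     (Q a (b + a2) c d \<longleftrightarrow> Q (a + a21) b (c + a23) d) \<and>
     (Q a b (c + a3) d \<longleftrightarrow> Q a (b + a32) c (d + a34)) \<and>
     (Q a b c (d + a4) \<longleftrightarrow> Q (a + a41) (b + a42) c d) \<and>
     (Q (a + a21) b c (d + a34) \<longleftrightarrow> Q a (b + a42) (c + a13) d))"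

text \<open>The monomials without \<open>x\<^sub>1\<close> that are divisible by none of the five monomials listed above.  Only the
move of \<open>f\<^sub>3\<close> applies to such a monomial, and \<open>a\<^sub>4\<^sub>2 \<le> a\<^sub>3\<^sub>2\<close> guarantees that it leads to another one.\<close>

lemma move_closed_standard:
  "move_closed (\<lambda>a b c d. a = 0 \<and> b < a2 \<and> d < a4 \<and> \<not> (a13 \<le> c \<and> a14 \<le> d) \<and>
     \<not> (a42 \<le> b \<and> a13 \<le> c) \<and> c < a3 + a13)"
  unfolding move_closed_def
  apply (intro allI conjI)
  using pos le unfolding sums by auto

text \<open>Only the move of \<open>f\<^sub>2\<close> applies to either of the two monomials.\<close>

lemma move_closed_class_of_x2_power: "move_closed (\<lambda>a b c d. (a = 0 \<and> b = a2 \<and> c = 0 \<and> d = 0) \<or> (a = a21 \<and> b = 0 \<and> c = a23 \<and> d = 0))"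
  unfolding move_closed_def
  apply (intro allI conjI)
  using pos le unfolding sums by auto

text \<open>Only the move of \<open>f\<^sub>5\<close> applies to either of the two monomials.\<close>

lemma move_closed_class_of_x2_x3: "move_closed (\<lambda>a b c d. (a = 0 \<and> b = a42 \<and> c = a13 \<and> d = 0) \<or> (a = a21 \<and> b = 0 \<and> c = 0 \<and> d = a34))"
  unfolding move_closed_def
  apply (intro allI conjI)
  using pos le unfolding sums by auto

text \<open>From \<open>x\<^sub>3\<^bsup>a\<^sub>3 + a\<^sub>1\<^sub>3\<^esup>\<close> the move of \<open>f\<^sub>3\<close> leads to the second monomial.  The remaining ones form a
chain under the move of \<open>f\<^sub>4\<close>, indexed by \<open>j\<close>.  It is entered from the second monomial through \<open>f\<^sub>5\<close>
at \<open>j = 1\<close> and, when \<open>a\<^sub>1\<^sub>4 \<le> a\<^sub>3\<^sub>4\<close>, through \<open>f\<^sub>1\<close> at \<open>j = 0\<close>; the exponents are written without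
subtraction.\<close>

lemma move_closed_class_of_x3_power: "move_closed (\<lambda>a b c d.
    (a = 0 \<and> b = 0 \<and> c = a3 + a13 \<and> d = 0) \<or> (a = 0 \<and> b = a32 \<and> c = a13 \<and> d = a34) \<or>
    (c = 0 \<and> (\<exists>j. a + j * a41 = a1 \<and> b + j * a42 = a32 \<and> d + a14 = a34 + j * a4)))"
    (is "move_closed (\<lambda>a b c d. ?X a b c d \<or> ?Y a b c d \<or> (c = 0 \<and> ?T a b d))")
proof -
  \<comment> \<open>The effect of the five moves on the chain; the moves of \<open>f\<^sub>2\<close> and \<open>f\<^sub>3\<close> do not apply to it.\<close>
  have T0: "?T (a + a1) b d \<longleftrightarrow> a = 0 \<and> b = a32 \<and> d + a14 = a34" for a b d
    using pos by (auto intro!: exI[of _ 0])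
  have T2: "\<not> ?T a (b + a2) d" for a b d using pos sums by auto
  have T3: "\<not> ?T a (b + a32) (d + a34)" for a b d
  proof
    assume "?T a (b + a32) (d + a34)"
    then obtain j where j: "b + a32 + j * a42 = a32" "d + a34 + a14 = a34 + j * a4" by auto
    have "j = 0" using j(1) pos by (cases j) auto
    then show False using j pos by simp
  qed
  have T4: "?T a b (d + a4) \<longleftrightarrow> ?T (a + a41) (b + a42) d" for a b d
  proof
    assume "?T a b (d + a4)"
    then obtain j where j: "a + j * a41 = a1" "b + j * a42 = a32" "d + a4 + a14 = a34 + j * a4" by blast
    then obtain i where "j = Suc i" using sums pos by (cases j) auto
    then show "?T (a + a41) (b + a42) d" using j by (intro exI[of _ i]) auto
  next
    assume "?T (a + a41) (b + a42) d"
    then obtain j where "a + a41 + j * a41 = a1" "b + a42 + j * a42 = a32" "d + a14 = a34 + j * a4" by blast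
    then show "?T a b (d + a4)" by (intro exI[of _ "Suc j"]) auto
  qed
  have T5: "?T (a + a21) b (d + a34) \<longleftrightarrow> a = 0 \<and> b + a42 = a32 \<and> d = a34" for a b d
  proof
    assume "?T (a + a21) b (d + a34)"
    then obtain j where j: "a + a21 + j * a41 = a1" "b + j * a42 = a32" "d + a34 + a14 = a34 + j * a4" by blast
    have "j \<noteq> 0" using j(3) pos by (cases j) auto
    moreover have "\<not> 2 \<le> j"
    proof
      assume "2 \<le> j"
      then have "2 * a41 \<le> j * a41" by simp
      then show False using j(1) sums pos by linarith
    qed
    ultimately have "j = 1" by simp
    then have "a + a21 + a41 = a1" "b + a42 = a32" "d + a34 + a14 = a34 + a4" using j by simp_all
    then show "a = 0 \<and> b + a42 = a32 \<and> d = a34" using sums by linarith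
  next
    assume "a = 0 \<and> b + a42 = a32 \<and> d = a34"
    then show "?T (a + a21) b (d + a34)" using sums by (intro exI[of _ 1]) auto
  qed
  define T where "T = (\<lambda>a b d. ?T a b d)"
  note T = T0 T2 T3 T4 T5
  have "move_closed (\<lambda>a b c d. ?X a b c d \<or> ?Y a b c d \<or> (c = 0 \<and> T a b d))"
    unfolding move_closed_def
  proof (intro allI conjI)
    fix a b c d
    note T = T[of a b d, folded T_def[THEN fun_cong, THEN fun_cong, THEN fun_cong]]
    show "?X (a + a1) b c d \<or> ?Y (a + a1) b c d \<or> (c = 0 \<and> T (a + a1) b d) \<longleftrightarrow>
        ?X a b (c + a13) (d + a14) \<or> ?Y a b (c + a13) (d + a14) \<or> (c + a13 = 0 \<and> T a b (d + a14))"
      using pos T(1) unfolding sums by auto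
    show "?X a (b + a2) c d \<or> ?Y a (b + a2) c d \<or> (c = 0 \<and> T a (b + a2) d) \<longleftrightarrow>
        ?X (a + a21) b (c + a23) d \<or> ?Y (a + a21) b (c + a23) d \<or> (c + a23 = 0 \<and> T (a + a21) b d)"
      using pos T(2) unfolding sums by auto
    show "?X a b (c + a3) d \<or> ?Y a b (c + a3) d \<or> (c + a3 = 0 \<and> T a b d) \<longleftrightarrow>
        ?X a (b + a32) c (d + a34) \<or> ?Y a (b + a32) c (d + a34) \<or> (c = 0 \<and> T a (b + a32) (d + a34))"
      using pos T(3) unfolding sums by auto
    show "?X a b c (d + a4) \<or> ?Y a b c (d + a4) \<or> (c = 0 \<and> T a b (d + a4)) \<longleftrightarrow>
        ?X (a + a41) (b + a42) c d \<or> ?Y (a + a41) (b + a42) c d \<or> (c = 0 \<and> T (a + a41) (b + a42) d)"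
      using pos T(4) unfolding sums by auto
    show "?X (a + a21) b c (d + a34) \<or> ?Y (a + a21) b c (d + a34) \<or> (c = 0 \<and> T (a + a21) b (d + a34)) \<longleftrightarrow>
        ?X a (b + a42) (c + a13) d \<or> ?Y a (b + a42) (c + a13) d \<or> (c + a13 = 0 \<and> T a (b + a42) d)"
      using pos T(5) unfolding sums by auto
  qed
  then show ?thesis unfolding T_def .
qed

lemma x1_shorter: "a13 + a14 \<le> a1"
proof -
  have "(a13 + a14) * p \<le> a1 * p"
    unfolding rel1 using order by (simp add: add_mult_distrib add_mono)
  then show ?thesis using order by simp
qed

lemma x4_longer: "a4 \<le> a41 + a42"
proof -
  have "a4 * s \<le> (a41 + a42) * s"
    unfolding rel4 using order by (simp add: add_mult_distrib add_mono)
  then show ?thesis using order by simp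
qed

text \<open>The three conditions of the theorem with all terms moved to the side where they are natural numbers.\<close>

definition exponent_condition :: bool where
  "exponent_condition \<longleftrightarrow>
     a2 \<le> a21 + a23 \<and> a42 + a13 \<le> a21 + a34 \<and>
     (a34 < a14 \<and> a3 + a13 + a42 \<le> a21 + a32 + 2 * a34 \<or>
      a14 \<le> a34 \<and> a3 + a13 + a14 \<le> a1 + a32 + a34)"

text \<open>Each of the five monomials is replaced by another monomial of its class: the first four through one
move, the last one through \<open>f\<^sub>3\<close> followed by \<open>f\<^sub>5\<close> or by \<open>f\<^sub>1\<close>.\<close>

lemma longer_factorization_with_x1:
  assumes cond: "exponent_condition"
    and ns: "\<not> (b < a2 \<and> d < a4 \<and> \<not> (a13 \<le> c \<and> a14 \<le> d) \<and> \<not> (a42 \<le> b \<and> a13 \<le> c) \<and> c < a3 + a13)"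
  shows "\<exists>a' b' c' d'. 0 < a' \<and> a' * p + b' * q + c' * r + d' * s = b * q + c * r + d * s \<and>
    b + c + d \<le> a' + b' + c' + d'"
proof -
  consider "a2 \<le> b" | "a4 \<le> d" | "a13 \<le> c" "a14 \<le> d" | "a42 \<le> b" "a13 \<le> c" | "a3 + a13 \<le> c"
    using ns by linarith
  then show ?thesis
  proof cases
    case 1
    then obtain x where x: "b = x + a2" by (metis le_add_diff_inverse2)
    have "a21 * p + x * q + (c + a23) * r + d * s = b * q + c * r + d * s"
      using rel2 by (simp add: x add_mult_distrib)
    then show ?thesis using cond pos x unfolding exponent_condition_def
      by (intro exI[of _ a21] exI[of _ x] exI[of _ "c + a23"] exI[of _ d]) auto
  next
    case 2
    then obtain x where x: "d = x + a4" by (metis le_add_diff_inverse2)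
    have "a41 * p + (b + a42) * q + c * r + x * s = b * q + c * r + d * s"
      using rel4 by (simp add: x add_mult_distrib)
    then show ?thesis using x4_longer pos x
      by (intro exI[of _ a41] exI[of _ "b + a42"] exI[of _ c] exI[of _ x]) auto
  next
    case 3
    then obtain x y where x: "c = x + a13" "d = y + a14" by (metis le_add_diff_inverse2)
    have "a1 * p + b * q + x * r + y * s = b * q + c * r + d * s"
      using rel1 by (simp add: x add_mult_distrib)
    then show ?thesis using x1_shorter pos x sums
      by (intro exI[of _ a1] exI[of _ b] exI[of _ x] exI[of _ y]) auto
  next
    case 4
    then obtain x y where x: "b = x + a42" "c = y + a13" by (metis le_add_diff_inverse2)
    have "a21 * p + x * q + y * r + (d + a34) * s = b * q + c * r + d * s"
      using rel5 by (simp add: x add_mult_distrib)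
    then show ?thesis using cond pos x unfolding exponent_condition_def
      by (intro exI[of _ a21] exI[of _ x] exI[of _ y] exI[of _ "d + a34"]) auto
  next
    case 5
    then obtain x where x: "c = x + (a3 + a13)" by (metis le_add_diff_inverse2)
    show ?thesis
    proof (cases "a34 < a14")
      case True
      obtain y where y: "a32 = y + a42" using le by (metis le_add_diff_inverse2)
      have "a21 * p + (b + y) * q + x * r + (d + 2 * a34) * s = b * q + c * r + d * s"
        using rel3 rel5 by (simp add: x y add_mult_distrib)
      then show ?thesis using cond pos x y True unfolding exponent_condition_def
        by (intro exI[of _ a21] exI[of _ "b + y"] exI[of _ x] exI[of _ "d + 2 * a34"]) auto
    next
      case False
      then obtain y where y: "a34 = y + a14" by (metis le_add_diff_inverse2 not_le)
      have "a1 * p + (b + a32) * q + x * r + (d + y) * s = b * q + c * r + d * s"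
        using rel3 rel1 by (simp add: x y add_mult_distrib)
      then show ?thesis using cond pos sums x y False unfolding exponent_condition_def
        by (intro exI[of _ a1] exI[of _ "b + a32"] exI[of _ x] exI[of _ "d + y"]) auto
    qed
  qed
qed

text \<open>Lengths do not increase along the chain because \<open>a\<^sub>4 \<le> a\<^sub>4\<^sub>1 + a\<^sub>4\<^sub>2\<close>.  Its first element has \<open>j = 0\<close>
if \<open>a\<^sub>1\<^sub>4 \<le> a\<^sub>3\<^sub>4\<close> and \<open>j = 1\<close> otherwise.\<close>

lemma length_bound_class_of_x3_power:
  assumes T: "a + j * a41 = a1" "b + j * a42 = a32" "d + a14 = a34 + j * a4"
  shows "a34 < a14 \<and> a + b + d + a42 \<le> a21 + a32 + 2 * a34 \<or>
    a14 \<le> a34 \<and> a + b + d + a14 \<le> a1 + a32 + a34"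
proof (cases "a34 < a14")
  case True
  then obtain i where i: "j = Suc i" using T(3) by (cases j) auto
  have "i * a4 \<le> i * (a41 + a42)" using x4_longer by simp
  then have "i * a4 \<le> i * a41 + i * a42" by (simp add: add_mult_distrib2)
  then show ?thesis using True T sums unfolding i mult_Suc by linarith
next
  case False
  have "j * a4 \<le> j * (a41 + a42)" using x4_longer by simp
  then have "j * a4 \<le> j * a41 + j * a42" by (simp add: add_mult_distrib2)
  then show ?thesis using False T by linarith
qed

text \<open>The assumption \<open>prolong\<close> is used for the three monomials whose classes are known; the factorization
it provides must be one of the members of the class that contain \<open>x\<^sub>1\<close>.\<close>

lemma exponent_condition_necessary:
  assumes same_class: "\<And>Q a b c d a' b' c' d'. move_closed Q \<Longrightarrow>
      a * p + b * q + c * r + d * s = a' * p + b' * q + c' * r + d' * s \<Longrightarrow> Q a b c d \<longleftrightarrow> Q a' b' c' d'"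
    and prolong: "\<And>b c d a' b' c' d'. 0 < a' \<Longrightarrow>
      b * q + c * r + d * s = a' * p + b' * q + c' * r + d' * s \<Longrightarrow>
      \<exists>a'' b'' c'' d''. 0 < a'' \<and> b * q + c * r + d * s = a'' * p + b'' * q + c'' * r + d'' * s \<and>
        b + c + d \<le> a'' + b'' + c'' + d''"
  shows "exponent_condition"
proof -
  have 1: "a2 \<le> a21 + a23"
  proof -
    have "a2 * q + 0 * r + 0 * s = a21 * p + 0 * q + a23 * r + 0 * s" using rel2 by simp
    from prolong[OF pos(1) this] obtain a b c d where *: "0 < a" "a2 * q + 0 * r + 0 * s = a * p + b * q + c * r + d * s"
      "a2 + 0 + 0 \<le> a + b + c + d" by blast
    have "0 * p + a2 * q + 0 * r + 0 * s = a * p + b * q + c * r + d * s" using *(2) by simp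
    from same_class[OF move_closed_class_of_x2_power this] have "a = a21 \<and> b = 0 \<and> c = a23 \<and> d = 0" using *(1) by simp
    then show ?thesis using *(3) by simp
  qed
  have 2: "a42 + a13 \<le> a21 + a34"
  proof -
    have "a42 * q + a13 * r + 0 * s = a21 * p + 0 * q + 0 * r + a34 * s" using rel5 by simp
    from prolong[OF pos(1) this] obtain a b c d where *: "0 < a" "a42 * q + a13 * r + 0 * s = a * p + b * q + c * r + d * s"
      "a42 + a13 + 0 \<le> a + b + c + d" by blast
    have "0 * p + a42 * q + a13 * r + 0 * s = a * p + b * q + c * r + d * s" using *(2) by simp
    from same_class[OF move_closed_class_of_x2_x3 this] have "a = a21 \<and> b = 0 \<and> c = 0 \<and> d = a34" using *(1) by simp
    then show ?thesis using *(3) by simp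
  qed
  have 3: "a34 < a14 \<and> a3 + a13 + a42 \<le> a21 + a32 + 2 * a34 \<or>
      a14 \<le> a34 \<and> a3 + a13 + a14 \<le> a1 + a32 + a34"
  proof -
    obtain y where y: "a32 = y + a42" using le by (metis le_add_diff_inverse2)
    have "0 * q + (a3 + a13) * r + 0 * s = a21 * p + y * q + 0 * r + (2 * a34) * s"
      using rel3 rel5 by (simp add: y add_mult_distrib)
    from prolong[OF pos(1) this] obtain a b c d where *: "0 < a" "0 * q + (a3 + a13) * r + 0 * s = a * p + b * q + c * r + d * s"
      "0 + (a3 + a13) + 0 \<le> a + b + c + d" by blast
    have "0 * p + 0 * q + (a3 + a13) * r + 0 * s = a * p + b * q + c * r + d * s" using *(2) by simp
    from same_class[OF move_closed_class_of_x3_power this]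
    have "c = 0" and "\<exists>j. a + j * a41 = a1 \<and> b + j * a42 = a32 \<and> d + a14 = a34 + j * a4"
      using *(1) by auto
    then obtain j where "a + j * a41 = a1" "b + j * a42 = a32" "d + a14 = a34 + j * a4" by blast
    from length_bound_class_of_x3_power[OF this] show ?thesis using *(3) \<open>c = 0\<close> by linarith
  qed
  show ?thesis using 1 2 3 unfolding exponent_condition_def by blast
qed

end

section \<open>Binomial ideals and monomials in four variables\<close>

text \<open>The polynomials all of whose monomial multiples are killed by the functional form an ideal.\<close>

lemma sum_on_ideal_eq_0:
  fixes G :: "('a::cancel_comm_monoid_add \<Rightarrow>\<^sub>0 'b::comm_ring_1) set"
  assumes G: "\<And>g u. g \<in> G \<Longrightarrow> sum_on E (Poly_Mapping.single u 1 * g) = 0"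
    and f: "f \<in> Idl\<^bsub>ring_of_type_algebra\<^esub> G"
  shows "sum_on E f = 0"
proof -
  interpret P: cring "ring_of_type_algebra :: ('a \<Rightarrow>\<^sub>0 'b) ring" by (rule cring_from_type_algebra)
  let ?J = "{f. \<forall>u. sum_on E (Poly_Mapping.single u 1 * f) = 0}"
  have "ideal ?J ring_of_type_algebra"
  proof (rule ideal_of_monomial_closed)
    show "0 \<in> ?J" by (simp add: sum_on_def)
    show "g + h \<in> ?J" if "g \<in> ?J" "h \<in> ?J" for g h
      using that by (simp add: distrib_left sum_on_add)
    show "Poly_Mapping.single w c * g \<in> ?J" if g: "g \<in> ?J" for w c g
    proof -
      have "Poly_Mapping.single u 1 * (Poly_Mapping.single w c * g)
          = Poly_Mapping.single 0 c * (Poly_Mapping.single (u + w) 1 * g)" for u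
        by (simp add: mult.assoc[symmetric] mult_single)
      then show ?thesis using g by (simp add: sum_on_monomial_mult[of E 0 c])
    qed
  qed
  then have "Idl\<^bsub>ring_of_type_algebra\<^esub> G \<subseteq> ?J" by (rule P.genideal_minimal) (use G in auto)
  then have "sum_on E (Poly_Mapping.single 0 1 * f) = 0" using f by blast
  then show ?thesis by simp
qed

text \<open>The sum of the coefficients in \<open>E\<close> vanishes on the curve ideal, and the difference of two monomials of
equal weight belongs to that ideal.\<close>

lemma equal_weight_same_class:
  fixes n :: "'v::finite \<Rightarrow> nat"
  assumes gen: "Idl\<^bsub>mpoly_ring\<^esub> G = (curve_ideal n :: ('v, 'k::field) mpoly set)"
    and closed: "\<And>g. g \<in> G \<Longrightarrow> \<exists>l t. g = Poly_Mapping.single l 1 - Poly_Mapping.single t 1 \<and>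
       (\<forall>u. u + l \<in> E \<longleftrightarrow> u + t \<in> E)"
    and w: "weight n m = weight n m'"
  shows "m \<in> E \<longleftrightarrow> m' \<in> E"
proof -
  have "(Poly_Mapping.single m 1 - Poly_Mapping.single m' 1 :: ('v, 'k) mpoly) \<in> Idl\<^bsub>mpoly_ring\<^esub> G"
    unfolding gen by (rule curve_ideal_binomial[OF w])
  moreover have "sum_on E (Poly_Mapping.single u 1 * g) = 0" if "g \<in> G" for g u
    using closed[OF that] by (auto simp: right_diff_distrib mult_single sum_on_diff sum_on_single)
  ultimately have "sum_on E (Poly_Mapping.single m 1 - Poly_Mapping.single m' 1 :: ('v, 'k) mpoly) = 0"
    by (rule sum_on_ideal_eq_0[rotated])
  then show ?thesis by (auto simp: sum_on_diff sum_on_single split: if_splits)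
qed

text \<open>Both monomials have the same image under \<open>x\<^sub>i \<mapsto> t\<^bsup>n i\<^esup>\<close>.\<close>

lemma weight_of_binomial:
  assumes "(Poly_Mapping.single l 1 - Poly_Mapping.single t 1 :: ('v::finite, 'k::field) mpoly) \<in> curve_ideal n"
  shows "weight n l = weight n t"
proof (rule ccontr)
  assume "weight n l \<noteq> weight n t"
  moreover have "sum_on {m. weight n m = weight n l} (Poly_Mapping.single l 1 - Poly_Mapping.single t 1 :: ('v, 'k) mpoly) = 0"
    using assms curve_ideal_iff by blast
  ultimately show False by (simp add: sum_on_diff sum_on_single)
qed

lemma UNIV_4: "(UNIV :: 4 set) = {1, 2, 3, 4}"
proof -
  \<comment> \<open>In this type \<open>4\<close> is the same element as \<open>0\<close>.\<close>
  have "card {1, 2, 3, 4 :: 4} = 4" by simp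
  then have "card {1, 2, 3, 4 :: 4} = CARD(4)" by simp
  then show ?thesis by (metis card_subset_eq finite subset_UNIV)
qed

lemma sum_4: "(\<Sum>i\<in>(UNIV :: 4 set). f i) = f 1 + f 2 + f 3 + f 4"
  for f :: "4 \<Rightarrow> 'a::comm_monoid_add"
proof -
  have "(1::4) \<notin> {2, 3, 4}" "(2::4) \<notin> {3, 4}" "(3::4) \<notin> {4}" by simp_all
  then show ?thesis unfolding UNIV_4 by (simp only: sum.insert sum.empty finite.intros add.assoc) simp
qed

definition mono4 :: "nat \<Rightarrow> nat \<Rightarrow> nat \<Rightarrow> nat \<Rightarrow> (4 \<Rightarrow>\<^sub>0 nat)" where
  "mono4 a b c d = Poly_Mapping.single 1 a + Poly_Mapping.single 2 b + Poly_Mapping.single 3 c + Poly_Mapping.single 4 d"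

lemma lookup_mono4 [simp]:
  "Poly_Mapping.lookup (mono4 a b c d) 1 = a" "Poly_Mapping.lookup (mono4 a b c d) 2 = b"
  "Poly_Mapping.lookup (mono4 a b c d) 3 = c" "Poly_Mapping.lookup (mono4 a b c d) 4 = d"
  by (simp_all add: mono4_def lookup_add lookup_single when_def)

lemma mono4_lookup: "m = mono4 (Poly_Mapping.lookup m 1) (Poly_Mapping.lookup m 2) (Poly_Mapping.lookup m 3) (Poly_Mapping.lookup m 4)"
proof (rule poly_mapping_eqI)
  fix k :: 4
  have "k \<in> {1, 2, 3, 4}" using UNIV_4 by auto
  then show "Poly_Mapping.lookup m k = Poly_Mapping.lookup (mono4 (Poly_Mapping.lookup m 1) (Poly_Mapping.lookup m 2) (Poly_Mapping.lookup m 3) (Poly_Mapping.lookup m 4)) k"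
    by auto
qed

lemma mono4_add: "mono4 a b c d + mono4 a' b' c' d' = mono4 (a + a') (b + b') (c + c') (d + d')"
  by (simp add: mono4_def single_add ac_simps)

lemma weight_mono4: "weight n (mono4 a b c d) = a * n 1 + b * n 2 + c * n 3 + d * n 4"
  by (simp add: weight_def sum_4 mult.commute)

lemma tdeg_mono4: "tdeg (mono4 a b c d) = a + b + c + d"
  by (simp add: tdeg_def sum_4)

lemma Var_power: "Var i ^ k = (Poly_Mapping.single (Poly_Mapping.single i k) 1 :: ('v, 'k::field) mpoly)"
  by (induction k) (simp_all add: Var_def mult_single single_add[symmetric])

lemma Var_power_mono4:
  "Var 1 ^ k = (Poly_Mapping.single (mono4 k 0 0 0) 1 :: (4, 'k::field) mpoly)"
  "Var 2 ^ k = (Poly_Mapping.single (mono4 0 k 0 0) 1 :: (4, 'k::field) mpoly)"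
  "Var 3 ^ k = (Poly_Mapping.single (mono4 0 0 k 0) 1 :: (4, 'k::field) mpoly)"
  "Var 4 ^ k = (Poly_Mapping.single (mono4 0 0 0 k) 1 :: (4, 'k::field) mpoly)"
  by (simp_all add: Var_power mono4_def)

section \<open>Tangent cones of Gorenstein monomial curves\<close>

theorem theorem3p11:
  fixes n :: "4 \<Rightarrow> nat"
    and f1 f2 f3 f4 f5 :: "(4, 'k::field) mpoly"
    and a1 a2 a3 a4 a13 a14 a21 a23 a32 a34 a41 a42 :: nat
  assumes "\<And>i. n i > 0" and "Gcd (range n) = 1"
    and "n 1 < n 2" and "n 2 < n 3" and "n 3 < n 4"
    and "gorenstein_curve n"
    and "\<not> complete_intersection_curve TYPE('k) n"
    and "f1 = Var 1 ^ a1 - Var 3 ^ a13 * Var 4 ^ a14"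
    and "f2 = Var 2 ^ a2 - Var 1 ^ a21 * Var 3 ^ a23"
    and "f3 = Var 3 ^ a3 - Var 2 ^ a32 * Var 4 ^ a34"
    and "f4 = Var 4 ^ a4 - Var 1 ^ a41 * Var 2 ^ a42"
    and "f5 = Var 1 ^ a21 * Var 4 ^ a34 - Var 2 ^ a42 * Var 3 ^ a13"
    and "0 < a21" "a21 < a1" and "0 < a41" "a41 < a1"
    and "0 < a32" "a32 < a2" and "0 < a42" "a42 < a2"
    and "0 < a13" "a13 < a3" and "0 < a23" "a23 < a3"
    and "0 < a14" "a14 < a4" and "0 < a34" "a34 < a4"
    and "a1 = a21 + a41" and "a2 = a32 + a42" and "a3 = a13 + a23" and "a4 = a14 + a34"
    and "minimally_generated_by mpoly_ring (curve_ideal n) {f1, f2, f3, f4, f5}"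
    and "a42 \<le> a32"
  shows "cohen_macaulay_tangent_cone TYPE('k) n \<longleftrightarrow>
     a2 \<le> a21 + a23 \<and>
     a42 + a13 \<le> a21 + a34 \<and>
     (a34 < a14 \<and> int a3 + int a13 \<le> int a21 + int a32 - int a42 + 2 * int a34 \<or>
      a14 \<le> a34 \<and> int a3 + int a13 \<le> int a1 + int a32 + int a34 - int a14)"
proof -
  let ?m = "\<lambda>a b c d. Poly_Mapping.single (mono4 a b c d) 1 :: (4, 'k) mpoly"
  have f: "f1 = ?m a1 0 0 0 - ?m 0 0 a13 a14" "f2 = ?m 0 a2 0 0 - ?m a21 0 a23 0"
    "f3 = ?m 0 0 a3 0 - ?m 0 a32 0 a34" "f4 = ?m 0 0 0 a4 - ?m a41 a42 0 0"
    "f5 = ?m a21 0 0 a34 - ?m 0 a42 a13 0"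
    unfolding assms(8-12) Var_power_mono4 by (simp_all add: mult_single mono4_add)
  let ?G = "{f1, f2, f3, f4, f5}"
  have gen: "Idl\<^bsub>mpoly_ring\<^esub> ?G = curve_ideal n"
    using assms unfolding minimally_generated_by_def by blast
  interpret P: cring "mpoly_ring :: (4, 'k) mpoly ring" by (rule cring_from_type_algebra)
  have mem: "f1 \<in> curve_ideal n" "f2 \<in> curve_ideal n" "f3 \<in> curve_ideal n" "f4 \<in> curve_ideal n" "f5 \<in> curve_ideal n"
    using P.genideal_self[of ?G] unfolding gen by auto
  note rel = mem[unfolded f, THEN weight_of_binomial, unfolded weight_mono4]
  interpret E: bresinsky_exponents "n 1" "n 2" "n 3" "n 4" a1 a2 a3 a4 a13 a14 a21 a23 a32 a34 a41 a42
    by (rule bresinsky_exponents.intro) (use assms(1)[of 1] assms rel in simp_all)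
  have same_class: "Q a b c d \<longleftrightarrow> Q a' b' c' d'"
    if Q: "E.move_closed Q" and w: "weight n (mono4 a b c d) = weight n (mono4 a' b' c' d')" for Q a b c d a' b' c' d'
  proof -
    let ?E = "{m :: 4 \<Rightarrow>\<^sub>0 nat. Q (Poly_Mapping.lookup m 1) (Poly_Mapping.lookup m 2) (Poly_Mapping.lookup m 3) (Poly_Mapping.lookup m 4)}"
    have binomial: "\<exists>l t. ?m a b c d - ?m a' b' c' d' = Poly_Mapping.single l 1 - Poly_Mapping.single t 1 \<and>
        (\<forall>u. u + l \<in> ?E \<longleftrightarrow> u + t \<in> ?E)"
      if "\<And>x y z w. Q (x + a) (y + b) (z + c) (w + d) \<longleftrightarrow> Q (x + a') (y + b') (z + c') (w + d')"
      for a b c d a' b' c' d'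
      by (rule exI[of _ "mono4 a b c d"], rule exI[of _ "mono4 a' b' c' d'"]) (simp add: lookup_add that)
    have "mono4 a b c d \<in> ?E \<longleftrightarrow> mono4 a' b' c' d' \<in> ?E"
    proof (rule equal_weight_same_class[OF gen _ w])
      fix g assume "g \<in> ?G"
      then consider "g = f1" | "g = f2" | "g = f3" | "g = f4" | "g = f5" by blast
      then show "\<exists>l t. g = Poly_Mapping.single l 1 - Poly_Mapping.single t 1 \<and> (\<forall>u. u + l \<in> ?E \<longleftrightarrow> u + t \<in> ?E)"
        by cases (simp_all only: f, (rule binomial, use Q in \<open>simp add: E.move_closed_def\<close>)+)
    qed
    then show ?thesis by simp
  qed
  interpret W: least_weight n 1
  proof
    fix i :: 4 assume "i \<noteq> 1"
    moreover have "i \<in> {1, 2, 3, 4}" using UNIV_4 by auto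
    ultimately show "n 1 < n i" using assms by auto
  qed (rule assms)
  have tail: "E.exponent_condition \<longleftrightarrow>
     a2 \<le> a21 + a23 \<and>
     a42 + a13 \<le> a21 + a34 \<and>
     (a34 < a14 \<and> int a3 + int a13 \<le> int a21 + int a32 - int a42 + 2 * int a34 \<or>
      a14 \<le> a34 \<and> int a3 + int a13 \<le> int a1 + int a32 + int a34 - int a14)"
    unfolding E.exponent_condition_def by linarith
  have "W.shift_preserves_longest \<longleftrightarrow> E.exponent_condition"
    unfolding W.shift_preserves_longest_iff[OF assms(1)]
  proof (intro iffI allI impI)
    fix m m' assume cond: "E.exponent_condition"
      and m: "Poly_Mapping.lookup m 1 = 0 \<and> weight n m' = weight n m \<and> 0 < Poly_Mapping.lookup m' 1"
    define b c d where bcd: "b = Poly_Mapping.lookup m 2" "c = Poly_Mapping.lookup m 3" "d = Poly_Mapping.lookup m 4"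
    have m4: "m = mono4 0 b c d" using mono4_lookup[of m] m by (simp add: bcd)
    have "weight n (mono4 0 b c d) = weight n (mono4 (Poly_Mapping.lookup m' 1) (Poly_Mapping.lookup m' 2) (Poly_Mapping.lookup m' 3) (Poly_Mapping.lookup m' 4))"
      using m mono4_lookup[of m'] unfolding m4 by simp
    from same_class[OF E.move_closed_standard this]
    have "\<not> (b < a2 \<and> d < a4 \<and> \<not> (a13 \<le> c \<and> a14 \<le> d) \<and> \<not> (a42 \<le> b \<and> a13 \<le> c) \<and> c < a3 + a13)"
      using m by simp
    from E.longer_factorization_with_x1[OF cond this] obtain a' b' c' d' where "0 < a'"
      "a' * n 1 + b' * n 2 + c' * n 3 + d' * n 4 = b * n 2 + c * n 3 + d * n 4" "b + c + d \<le> a' + b' + c' + d'"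
      by blast
    then show "\<exists>m''. weight n m'' = weight n m \<and> 0 < Poly_Mapping.lookup m'' 1 \<and> tdeg m \<le> tdeg m''"
      by (intro exI[of _ "mono4 a' b' c' d'"]) (simp add: m4 weight_mono4 tdeg_mono4)
  next
    assume R: "\<forall>m m'. Poly_Mapping.lookup m 1 = 0 \<and> weight n m' = weight n m \<and> 0 < Poly_Mapping.lookup m' 1 \<longrightarrow>
      (\<exists>m''. weight n m'' = weight n m \<and> 0 < Poly_Mapping.lookup m'' 1 \<and> tdeg m \<le> tdeg m'')"
    show "E.exponent_condition"
    proof (rule E.exponent_condition_necessary)
      show "Q a b c d \<longleftrightarrow> Q a' b' c' d'"
        if "E.move_closed Q" "a * n 1 + b * n 2 + c * n 3 + d * n 4 = a' * n 1 + b' * n 2 + c' * n 3 + d' * n 4"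
        for Q a b c d a' b' c' d'
        by (rule same_class[OF that(1)], unfold weight_mono4, rule that(2))
      fix b c d a' b' c' d' :: nat
      assume "0 < a'" "b * n 2 + c * n 3 + d * n 4 = a' * n 1 + b' * n 2 + c' * n 3 + d' * n 4"
      then obtain m where m: "weight n m = weight n (mono4 0 b c d)" "0 < Poly_Mapping.lookup m 1"
        "tdeg (mono4 0 b c d) \<le> tdeg m"
        using R[rule_format, of "mono4 0 b c d" "mono4 a' b' c' d'"] by (auto simp: weight_mono4)
      obtain a'' b'' c'' d'' where "m = mono4 a'' b'' c'' d''" using mono4_lookup by blast
      then show "\<exists>a'' b'' c'' d''. 0 < a'' \<and> b * n 2 + c * n 3 + d * n 4 = a'' * n 1 + b'' * n 2 + c'' * n 3 + d'' * n 4 \<and>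
        b + c + d \<le> a'' + b'' + c'' + d''"
        using m by (intro exI[of _ a''] exI[of _ b''] exI[of _ c''] exI[of _ d'']) (simp add: weight_mono4 tdeg_mono4)
    qed
  qed
  then show ?thesis unfolding W.cohen_macaulay_tangent_cone_iff tail .
qed

end
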